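(* Let $(\Gamma,\mathrm d)$ be an $S$-compatible $N$-dimensional bicovariant first order differential calculus on a Hopf algebra $A$, with exterior algebra $\Gamma^\wedge$, and let $\mathcal C_\Gamma$ be its quantum Cartan algebra. The map $\lambda:\mathcal C_\Gamma\to\mathrm{End}(\Gamma^\wedge)$, $x\mapsto\lambda_x$, defined on generators by $$\lambda_{X_j}=L_j,\qquad \lambda_{f_{jk}}=L_{jk},\qquad \lambda_{\xi_j}=i_j,\qquad \lambda_\delta=\mathrm d,$$ and extended as a $\mathbb Z_2$-graded algebra homomorphism to the whole of $\mathcal C_\Gamma$, defines a left $\mathcal C_\Gamma$-Hopf module algebra structure on $\Gamma^\wedge$; that is, $\Gamma^\wedge$ is a left $\mathcal C_\Gamma$-module via $\lambda$, and $\lambda_x(\alpha\wedge\beta)=\lambda_{x_{(1)}}(\alpha)\wedge\lambda_{x_{(2)}}(\beta)$ (with the $\mathbb Z_2$-graded sign convention) and $\lambda_x(1)=\varepsilon(x)1$ for all $x\in\mathcal C_\Gamma$, $\alpha,\beta\in\Gamma^\wedge$.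
   Context: Summation over repeated indices is understood; indices run in $\{1,\dots,N\}$; $\delta_{ij}$ is the Kronecker symbol, while $\delta$ without indices is an algebra generator. Calculus. $A$ is a unital complex Hopf algebra with invertible antipode, $H$ its dual Hopf algebra. $(\Gamma,\mathrm d)$ is a bicovariant first order differential calculus in the sense of Woronowicz: $\Gamma$ is an $A$-bimodule, $\mathrm d:A\to\Gamma$ is linear and satisfies the Leibniz rule, every element of $\Gamma$ is a sum $x_k\,\mathrm dy_k$, and there are a left coaction $\Delta_\Gamma:\Gamma\to A\otimes\Gamma$ and a right coaction ${}_\Gamma\Delta:\Gamma\to\Gamma\otimes A$ with $\Delta_\Gamma(x\,\mathrm dy)=\Delta(x)(\mathrm{id}\otimes\mathrm d)\Delta(y)$ and ${}_\Gamma\Delta(x\,\mathrm dy)=\Delta(x)(\mathrm d\otimes\mathrm{id})\Delta(y)$. Its dimension $N$ (the dimension of the space ${}_{inv}\Gamma$ of left-invariant elements, $\Delta_\Gamma(\omega)=1\otimes\omega$) is finite. Fix a basis $\omega_1,\dots,\omega_N$ of ${}_{inv}\Gamma$; it is a free $A$-module basis of $\Gamma$. For $f\in H$, $x\in A$ put $f\triangleright x=x_{(1)}f(x_{(2)})$. There are $f_{ij}\in H$ and $J_{ij}\in A$ with $\omega_ix=(f_{ij}\triangleright x)\omega_j$ for $x\in A$ and ${}_\Gamma\Delta(\omega_i)=\omega_j\otimes J_{ji}$. The quantum tangent space is $\mathcal T=\{X\in A':X(1)=0,\ X|_{R_\Gamma}=0\}\subset H$, where $R_\Gamma\subset\ker\varepsilon$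 is the right ideal characterizing the calculus; $\{X_i\}$ is the basis of $\mathcal T$ dual to $\{\omega_i\}$ under the pairing $\{X,x\,\mathrm dy\}=\varepsilon(x)X(y)$, so $\mathrm dx=(X_i\triangleright x)\omega_i$. Set $\sigma^{kl}_{ij}=f_{il}(J_{kj})$, the components of the Woronowicz braiding, i.e. the $A$-bimodule map $\sigma$ on $\Gamma\otimes_A\Gamma$ with $\sigma(\omega_i\otimes\omega_j)=\sigma_{ij}^{kl}\omega_k\otimes\omega_l$, and $C_{ij}^k=X_j(J_{ik})$. Let $\sigma^t$ be the transposed map on $\mathcal T\otimes\mathcal T$, $\sigma^t(X_i\otimes X_j)=\sigma^{ij}_{kl}X_k\otimes X_l$, and let $t^{ij}_{kl}\in\mathbb C$, with $t^{ij}_{ij}=0$ (no sum), be such that $\ker(\mathrm{id}-\sigma^t)$ is spanned by the elements $X_i\otimes X_j+t^{ij}_{kl}X_k\otimes X_l$. $\mathcal E_\Gamma\subset H$ denotes the unital subalgebra generated by the elements $X_i,f_{jk}$. It is a sub-bialgebra of $H$ in which the relations $$X_iX_j-\sigma^{ij}_{kl}X_kX_l=C^k_{ij}X_k,\qquad \sigma^{ij}_{nm}f_{ip}f_{jq}=f_{ni}f_{mj}\sigma^{pq}_{ij},$$ $$C^i_{mn}f_{mj}f_{nk}+f_{ij}X_k=\sigma^{jk}_{pq}X_pf_{iq}+C^l_{jk}f_{il},\qquad X_kf_{nl}=\sigma^{kl}_{ij}f_{ni}X_j$$ hold. The calculus is called $S$-compatible if the antipode $S$ of $H$ satisfies $S(f_{ij})\in\mathcal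 E_\Gamma$ for all $i,j$. Quantum Cartan algebra. $\mathcal C_\Gamma$ is the unital $\mathbb Z_2$-graded algebra over $\mathbb C$ extending $\mathcal E_\Gamma$: it is generated by the algebra $\mathcal E_\Gamma$ (in even degree, with the relations holding in $\mathcal E_\Gamma$) and odd elements $\xi_i,\delta$, subject to $$\xi_i\xi_j+t^{ij}_{kl}\xi_k\xi_l=0,\quad \xi_i\delta+\delta\xi_i=X_i,\quad \delta\delta=0,\quad \xi_if_{kj}-\sigma^{ij}_{nm}f_{kn}\xi_m=0,$$ $$\xi_iX_j-\sigma^{ij}_{kl}X_k\xi_l=C^k_{ij}\xi_k,\quad f_{ij}\delta-\delta f_{ij}=0,\quad X_i\delta-\delta X_i=0.$$ It is a $\mathbb Z_2$-graded Hopf algebra with $\triangle(X_i)=1\otimes X_i+X_j\otimes f_{ji}$, $\triangle(f_{ij})=f_{ik}\otimes f_{kj}$, $\triangle(\xi_i)=1\otimes\xi_i+\xi_j\otimes f_{ji}$, $\triangle(\delta)=1\otimes\delta+\delta\otimes1$, $\varepsilon(X_i)=\varepsilon(\xi_i)=\varepsilon(\delta)=0$, $\varepsilon(f_{ij})=\delta_{ij}$, and antipode $f_{ij}\mapsto S(f_{ij})$, $X_i\mapsto-X_jS(f_{ji})$, $\xi_i\mapsto-\xi_jS(f_{ji})$, $\delta\mapsto-\delta$. Graded sign convention for module algebras: $\lambda_x(\alpha\wedge\beta)=(-1)^{|x_{(2)}||\alpha|}\lambda_{x_{(1)}}(\alpha)\wedge\lambda_{x_{(2)}}(\beta)$. Exterior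 algebra and operators. $\Gamma^\wedge=\Gamma^{\otimes}/\langle\ker(\mathrm{id}-\sigma)\rangle$, the quotient of the tensor algebra of $\Gamma$ over $A$ by the two-sided ideal generated by $\ker(\mathrm{id}-\sigma)\subset\Gamma\otimes_A\Gamma$; $\mathrm d$ extends uniquely to a degree one graded derivation of $\Gamma^\wedge$ with $\mathrm d^2=0$. $\Gamma^\wedge$ carries left and right $A$-coactions given recursively by $\Delta_\Gamma(x\,\mathrm d\alpha)=\Delta(x)(\mathrm{id}\otimes\mathrm d)\Delta_\Gamma(\alpha)$, ${}_\Gamma\Delta(x\,\mathrm d\alpha)=\Delta(x)(\mathrm d\otimes\mathrm{id})\,{}_\Gamma\Delta(\alpha)$. For $h\in H$, $\alpha\in\Gamma^\wedge$ put $h\triangleright\alpha=(\mathrm{id}\otimes h)\,{}_\Gamma\Delta(\alpha)$. The degree $0$ operators are $L_i(\alpha)=X_i\triangleright\alpha$ and $L_{ij}(\alpha)=f_{ij}\triangleright\alpha$. The inner derivative $i_k$ is the degree $-1$ operator on $\Gamma^\wedge$ (zero on $A$) with $i_k(\omega_j)=\delta_{kj}$ and $i_k(\alpha\wedge\beta)=(-1)^{|\alpha|}\alpha\wedge i_k(\beta)+i_j(\alpha)\wedge L_{jk}(\beta)$ for all $\alpha,\beta\in\Gamma^\wedge$. *)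

theory Defs
  imports Complex_Main "HOL-Library.Poly_Mapping" "HOL-Library.Function_Algebras"
begin

section \<open>Complex vector spaces and algebras\<close>

class complex_vector = ab_group_add +
  fixes cscale :: "complex \<Rightarrow> 'a \<Rightarrow> 'a"  (infixr "*\<^sub>C" 75)
  assumes cscale_add_right: "c *\<^sub>C (x + y) = c *\<^sub>C x + c *\<^sub>C y"
    and cscale_add_left: "(b + c) *\<^sub>C x = b *\<^sub>C x + c *\<^sub>C x"
    and cscale_cscale: "b *\<^sub>C c *\<^sub>C x = (b * c) *\<^sub>C x"
    and cscale_one: "1 *\<^sub>C x = x"

class complex_algebra = complex_vector + ring_1 +
  assumes cscale_mult_left: "(c *\<^sub>C x) * y = c *\<^sub>C (x * y)"
    and cscale_mult_right: "x * (c *\<^sub>C y) = c *\<^sub>C (x * y)"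

global_interpretation complex_vector: vector_space "cscale :: complex \<Rightarrow> 'a::complex_vector \<Rightarrow> 'a"
  by unfold_locales
    (simp_all add: cscale_add_right cscale_add_left cscale_cscale cscale_one)

abbreviation cspan :: "'a::complex_vector set \<Rightarrow> 'a set"
  where "cspan \<equiv> complex_vector.span"

abbreviation csubspace :: "'a::complex_vector set \<Rightarrow> bool"
  where "csubspace \<equiv> complex_vector.subspace"

abbreviation clinear :: "('a::complex_vector \<Rightarrow> 'b::complex_vector) \<Rightarrow> bool"
  where "clinear \<equiv> Vector_Spaces.linear cscale cscale"

definition cbilinear :: "('a::complex_vector \<Rightarrow> 'b::complex_vector \<Rightarrow> 'c::complex_vector) \<Rightarrow> bool"
  where "cbilinear h \<longleftrightarrow> (\<forall>x. clinear (h x)) \<and> (\<forall>y. clinear (\<lambda>x. h x y))"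

instantiation complex :: complex_algebra
begin
definition cscale_complex_def: "cscale = ((*) :: complex \<Rightarrow> complex \<Rightarrow> complex)"
instance
  by standard (simp_all add: cscale_complex_def algebra_simps)
end

instantiation "fun" :: (type, complex_vector) complex_vector
begin
definition cscale_fun_def: "c *\<^sub>C h = (\<lambda>x. c *\<^sub>C h x)"
instance
  by standard
    (simp_all add: fun_eq_iff cscale_fun_def cscale_add_right cscale_add_left cscale_cscale cscale_one)
end

instantiation poly_mapping :: (type, complex_vector) complex_vector
begin
definition cscale_poly_mapping_def: "c *\<^sub>C p = Poly_Mapping.map ((*\<^sub>C) c) p"
instance
proof -
  have lookup: "Poly_Mapping.lookup (c *\<^sub>C p) k = c *\<^sub>C Poly_Mapping.lookup p k" for c k and p :: "'a \<Rightarrow>\<^sub>0 'b"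
    by (simp add: cscale_poly_mapping_def Poly_Mapping.map.rep_eq when_def)
  show "OFCLASS('a \<Rightarrow>\<^sub>0 'b, complex_vector_class)"
    by standard
      (auto intro!: poly_mapping_eqI
        simp: lookup lookup_add cscale_add_right cscale_add_left cscale_cscale cscale_one)
qed
end


section \<open>Tensor products over the complex numbers\<close>

definition tensor_relations :: "(('a::complex_vector \<times> 'b::complex_vector) \<Rightarrow>\<^sub>0 complex) set"
  where "tensor_relations =
     {Poly_Mapping.single (x + y, z) 1 - Poly_Mapping.single (x, z) 1 - Poly_Mapping.single (y, z) 1
       | x y z. True}
   \<union> {Poly_Mapping.single (x, y + z) 1 - Poly_Mapping.single (x, y) 1 - Poly_Mapping.single (x, z) 1
       | x y z. True}
   \<union> {Poly_Mapping.single (c *\<^sub>C x, y) 1 - c *\<^sub>C Poly_Mapping.single (x, y) 1 | c x y. True}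
   \<union> {Poly_Mapping.single (x, c *\<^sub>C y) 1 - c *\<^sub>C Poly_Mapping.single (x, y) 1 | c x y. True}"

definition tensor_equiv ::
  "(('a::complex_vector \<times> 'b::complex_vector) \<Rightarrow>\<^sub>0 complex) \<Rightarrow> (('a \<times> 'b) \<Rightarrow>\<^sub>0 complex) \<Rightarrow> bool"
  where "tensor_equiv p q \<longleftrightarrow> p - q \<in> cspan tensor_relations"

lemma equivp_tensor_equiv:
  "equivp (tensor_equiv :: (('a::complex_vector \<times> 'b::complex_vector) \<Rightarrow>\<^sub>0 complex) \<Rightarrow> _)"
proof (rule equivpI)
  show "reflp (tensor_equiv :: ('a \<times> 'b \<Rightarrow>\<^sub>0 complex) \<Rightarrow> _)"
    by (simp add: reflp_def tensor_equiv_def complex_vector.span_zero)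
  show "symp (tensor_equiv :: ('a \<times> 'b \<Rightarrow>\<^sub>0 complex) \<Rightarrow> _)"
  proof (rule sympI)
    fix p q :: "('a \<times> 'b) \<Rightarrow>\<^sub>0 complex"
    assume "tensor_equiv p q"
    then have "- (p - q) \<in> cspan tensor_relations"
      unfolding tensor_equiv_def by (rule complex_vector.span_neg)
    then show "tensor_equiv q p"
      by (simp add: tensor_equiv_def)
  qed
  show "transp (tensor_equiv :: ('a \<times> 'b \<Rightarrow>\<^sub>0 complex) \<Rightarrow> _)"
  proof (rule transpI)
    fix p q r :: "('a \<times> 'b) \<Rightarrow>\<^sub>0 complex"
    assume "tensor_equiv p q" "tensor_equiv q r"
    then have "(p - q) + (q - r) \<in> cspan tensor_relations"
      unfolding tensor_equiv_def by (rule complex_vector.span_add)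
    then show "tensor_equiv p r"
      by (simp add: tensor_equiv_def)
  qed
qed

quotient_type (overloaded) ('a, 'b) tensor =
  "('a::complex_vector \<times> 'b::complex_vector) \<Rightarrow>\<^sub>0 complex" / tensor_equiv
  by (rule equivp_tensor_equiv)

instantiation tensor :: (complex_vector, complex_vector) complex_vector
begin
lift_definition zero_tensor :: "('a, 'b) tensor" is 0 .
lift_definition plus_tensor :: "('a, 'b) tensor \<Rightarrow> ('a, 'b) tensor \<Rightarrow> ('a, 'b) tensor" is "(+)"
proof -
  fix p q r s :: "('a \<times> 'b) \<Rightarrow>\<^sub>0 complex"
  assume "tensor_equiv p q" "tensor_equiv r s"
  then have "(p - q) + (r - s) \<in> cspan tensor_relations"
    unfolding tensor_equiv_def by (rule complex_vector.span_add)
  then show "tensor_equiv (p + r) (q + s)"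
    by (simp add: tensor_equiv_def algebra_simps)
qed
lift_definition minus_tensor :: "('a, 'b) tensor \<Rightarrow> ('a, 'b) tensor \<Rightarrow> ('a, 'b) tensor" is "(-)"
proof -
  fix p q r s :: "('a \<times> 'b) \<Rightarrow>\<^sub>0 complex"
  assume "tensor_equiv p q" "tensor_equiv r s"
  then have "(p - q) - (r - s) \<in> cspan tensor_relations"
    unfolding tensor_equiv_def by (rule complex_vector.span_diff)
  then show "tensor_equiv (p - r) (q - s)"
    by (simp add: tensor_equiv_def algebra_simps)
qed
lift_definition uminus_tensor :: "('a, 'b) tensor \<Rightarrow> ('a, 'b) tensor" is uminus
proof -
  fix p q :: "('a \<times> 'b) \<Rightarrow>\<^sub>0 complex"
  assume "tensor_equiv p q"
  then have "- (p - q) \<in> cspan tensor_relations"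
    unfolding tensor_equiv_def by (rule complex_vector.span_neg)
  then show "tensor_equiv (- p) (- q)"
    by (simp add: tensor_equiv_def)
qed
lift_definition cscale_tensor :: "complex \<Rightarrow> ('a, 'b) tensor \<Rightarrow> ('a, 'b) tensor" is "(*\<^sub>C)"
proof -
  fix c and p q :: "('a \<times> 'b) \<Rightarrow>\<^sub>0 complex"
  assume "tensor_equiv p q"
  then have "c *\<^sub>C (p - q) \<in> cspan tensor_relations"
    unfolding tensor_equiv_def by (rule complex_vector.span_scale)
  then show "tensor_equiv (c *\<^sub>C p) (c *\<^sub>C q)"
    by (simp add: tensor_equiv_def complex_vector.scale_right_diff_distrib)
qed
instance
proof
  have eqI: "p = q \<Longrightarrow> tensor_equiv p q" for p q :: "('a \<times> 'b) \<Rightarrow>\<^sub>0 complex"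
    by (simp add: tensor_equiv_def complex_vector.span_zero)
  fix s t u :: "('a, 'b) tensor" and b c :: complex
  show "s + t + u = s + (t + u)" by transfer (rule eqI, simp add: add.assoc)
  show "s + t = t + s" by transfer (rule eqI, simp add: add.commute)
  show "0 + s = s" by transfer (rule eqI, simp)
  show "- s + s = 0" by transfer (rule eqI, simp)
  show "s - t = s + - t" by transfer (rule eqI, simp)
  show "c *\<^sub>C (s + t) = c *\<^sub>C s + c *\<^sub>C t" by transfer (rule eqI, rule cscale_add_right)
  show "(b + c) *\<^sub>C s = b *\<^sub>C s + c *\<^sub>C s" by transfer (rule eqI, rule cscale_add_left)
  show "b *\<^sub>C c *\<^sub>C s = (b * c) *\<^sub>C s" by transfer (rule eqI, rule cscale_cscale)
  show "1 *\<^sub>C s = s" by transfer (rule eqI, rule cscale_one)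
qed
end

lift_definition tens :: "'a::complex_vector \<Rightarrow> 'b::complex_vector \<Rightarrow> ('a, 'b) tensor"  (infixr "\<otimes>" 72)
  is "\<lambda>x y. Poly_Mapping.single (x, y) 1" .

text \<open>
  The linear map on the tensor product induced by \<open>h\<close>; it is independent of the chosen
  representative, and linear, as soon as \<open>h\<close> is bilinear (see the two facts below).  In Sweedler
  notation \<open>tensor_lift h (\<Delta> x)\<close> is \<open>h x\<^sub>(\<^sub>1\<^sub>) x\<^sub>(\<^sub>2\<^sub>)\<close>.
\<close>
definition formal_lift ::
  "('a \<Rightarrow> 'b \<Rightarrow> 'c::complex_vector) \<Rightarrow> (('a \<times> 'b) \<Rightarrow>\<^sub>0 complex) \<Rightarrow> 'c"
  where "formal_lift h p = (\<Sum>k\<in>Poly_Mapping.keys p. Poly_Mapping.lookup p k *\<^sub>C h (fst k) (snd k))"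

definition tensor_lift ::
  "('a::complex_vector \<Rightarrow> 'b::complex_vector \<Rightarrow> 'c::complex_vector) \<Rightarrow> ('a, 'b) tensor \<Rightarrow> 'c"
  where "tensor_lift h t = formal_lift h (rep_tensor t)"

lemma lookup_cscale: "Poly_Mapping.lookup (c *\<^sub>C p) k = c *\<^sub>C Poly_Mapping.lookup p k"
  by (simp add: cscale_poly_mapping_def Poly_Mapping.map.rep_eq when_def)

lemma formal_lift_superset:
  assumes "finite K" "Poly_Mapping.keys p \<subseteq> K"
  shows "formal_lift h p = (\<Sum>k\<in>K. Poly_Mapping.lookup p k *\<^sub>C h (fst k) (snd k))"
  unfolding formal_lift_def using assms
  by (intro sum.mono_neutral_left) (auto simp: in_keys_iff complex_vector.scale_zero_left)

lemma clinear_formal_lift: "clinear (formal_lift h)"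
proof (unfold_locales, goal_cases)
  case (1 p q)
  let ?K = "Poly_Mapping.keys p \<union> Poly_Mapping.keys q"
  have "Poly_Mapping.keys (p + q) \<subseteq> ?K" by (rule Poly_Mapping.keys_add)
  then show ?case
    using formal_lift_superset[of ?K "p + q" h] formal_lift_superset[of ?K p h]
      formal_lift_superset[of ?K q h]
    by (simp add: lookup_add cscale_add_left sum.distrib)
next
  case (2 c p)
  have "Poly_Mapping.keys (c *\<^sub>C p) \<subseteq> Poly_Mapping.keys p"
    by (auto simp: in_keys_iff lookup_cscale complex_vector.scale_zero_right)
  then show ?case
    using formal_lift_superset[of "Poly_Mapping.keys p" "c *\<^sub>C p" h] formal_lift_superset[of "Poly_Mapping.keys p" p h]
    by (simp add: lookup_cscale cscale_complex_def complex_vector.scale_sum_right cscale_cscale)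
qed

lemma formal_lift_single: "formal_lift h (Poly_Mapping.single (x, y) 1) = h x y"
  by (simp add: formal_lift_def cscale_one)

lemma formal_lift_tensor_equiv:
  assumes "cbilinear h" "tensor_equiv p q"
  shows "formal_lift h p = formal_lift h q"
proof -
  interpret F: Vector_Spaces.linear cscale cscale "formal_lift h"
    by (rule clinear_formal_lift)
  have right: "clinear (h x)" and left: "clinear (\<lambda>x. h x y)" for x y
    using assms(1) by (auto simp: cbilinear_def)
  have "formal_lift h r = 0" if "r \<in> tensor_relations" for r
    using that unfolding tensor_relations_def
    by (auto simp: F.diff F.scale formal_lift_single
        module_hom.add[OF Vector_Spaces.linear.axioms(3)[OF right]]
        module_hom.scale[OF Vector_Spaces.linear.axioms(3)[OF right]]
        module_hom.add[OF Vector_Spaces.linear.axioms(3)[OF left]]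
        module_hom.scale[OF Vector_Spaces.linear.axioms(3)[OF left]])
  then have "formal_lift h r = 0" if "r \<in> cspan tensor_relations" for r
    using that by (rule F.eq_0_on_span)
  then show ?thesis
    using assms(2) F.diff[of p q] by (simp add: tensor_equiv_def)
qed

lemma tensor_lift_abs:
  assumes "cbilinear h"
  shows "tensor_lift h (abs_tensor p) = formal_lift h p"
proof -
  have "abs_tensor (rep_tensor (abs_tensor p)) = abs_tensor p"
    by (rule Quotient3_abs_rep[OF Quotient3_tensor])
  then have "tensor_equiv (rep_tensor (abs_tensor p)) p"
    by (simp only: tensor.abs_eq_iff)
  with assms show ?thesis
    unfolding tensor_lift_def by (rule formal_lift_tensor_equiv)
qed

lemma tensor_lift_tens: "cbilinear h \<Longrightarrow> tensor_lift h (x \<otimes> y) = h x y"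
  by (simp only: tens.abs_eq tensor_lift_abs formal_lift_single)

lemma clinear_tensor_lift:
  assumes "cbilinear h"
  shows "clinear (tensor_lift h)"
proof -
  interpret F: Vector_Spaces.linear cscale cscale "formal_lift h"
    by (rule clinear_formal_lift)
  note rep = tensor_lift_abs[OF assms]
  show ?thesis
  proof (unfold_locales, goal_cases)
    case (1 s t)
    obtain p q where "s = abs_tensor p" "t = abs_tensor q"
      by (metis Quotient3_abs_rep[OF Quotient3_tensor])
    then show ?case by (simp add: plus_tensor.abs_eq rep F.add)
  next
    case (2 c s)
    obtain p where "s = abs_tensor p"
      by (metis Quotient3_abs_rep[OF Quotient3_tensor])
    then show ?case by (simp add: cscale_tensor.abs_eq rep F.scale)
  qed
qed

definition tensor_map ::
  "('a::complex_vector \<Rightarrow> 'c::complex_vector) \<Rightarrow> ('b::complex_vector \<Rightarrow> 'd::complex_vector)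
    \<Rightarrow> ('a, 'b) tensor \<Rightarrow> ('c, 'd) tensor"
  where "tensor_map g h = tensor_lift (\<lambda>x y. g x \<otimes> h y)"

definition tensor_assoc ::
  "(('a::complex_vector, 'b::complex_vector) tensor, 'c::complex_vector) tensor
    \<Rightarrow> ('a, ('b, 'c) tensor) tensor"
  where "tensor_assoc = tensor_lift (\<lambda>s z. tensor_lift (\<lambda>x y. x \<otimes> (y \<otimes> z)) s)"

text \<open>\<open>(x \<otimes> y) (z \<otimes> w) = m x z \<otimes> n y w\<close>, for algebra products as well as module actions.\<close>
definition tensor_mult ::
  "('a::complex_vector \<Rightarrow> 'c::complex_vector \<Rightarrow> 'e::complex_vector)
    \<Rightarrow> ('b::complex_vector \<Rightarrow> 'd::complex_vector \<Rightarrow> 'f::complex_vector)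
    \<Rightarrow> ('a, 'b) tensor \<Rightarrow> ('c, 'd) tensor \<Rightarrow> ('e, 'f) tensor"
  where "tensor_mult m n s t =
    tensor_lift (\<lambda>x y. tensor_lift (\<lambda>z w. m x z \<otimes> n y w) t) s"


section \<open>Algebras given by generators and relations\<close>

datatype 'x word = Word (letters: "'x list")

instantiation word :: (type) monoid_add
begin
definition zero_word_def: "0 = Word []"
definition plus_word_def: "v + w = Word (letters v @ letters w)"
instance
  by standard (simp_all add: zero_word_def plus_word_def)
end

text \<open>\<open>'x word \<Rightarrow>\<^sub>0 complex\<close> with its convolution product is the free unital complex algebra on \<open>'x\<close>.\<close>
type_synonym 'x free_algebra = "'x word \<Rightarrow>\<^sub>0 complex"

definition letter :: "'x \<Rightarrow> 'x free_algebra"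
  where "letter g = Poly_Mapping.single (Word [g]) 1"

definition free_subalgebra :: "'x set \<Rightarrow> 'x free_algebra set"
  where "free_subalgebra G = {p. \<forall>w\<in>Poly_Mapping.keys p. set (letters w) \<subseteq> G}"

definition free_eval :: "('x \<Rightarrow> 'c::complex_algebra) \<Rightarrow> 'x free_algebra \<Rightarrow> 'c"
  where "free_eval \<phi> p = (\<Sum>w\<in>Poly_Mapping.keys p. Poly_Mapping.lookup p w *\<^sub>C prod_list (map \<phi> (letters w)))"

definition ideal_generated :: "'r::{complex_vector, ring_1} set \<Rightarrow> 'r set \<Rightarrow> 'r set"
  where "ideal_generated B R = cspan {u * r * v | u r v. u \<in> B \<and> r \<in> R \<and> v \<in> B}"

text \<open>
  The algebra \<open>'c\<close> is the free unital algebra on \<open>G\<close> modulo the two-sided ideal generated by \<open>R\<close>,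
  with \<open>\<phi> g\<close> the class of the generator \<open>g\<close>.
\<close>
definition presented_algebra :: "('x \<Rightarrow> 'c::complex_algebra) \<Rightarrow> 'x set \<Rightarrow> 'x free_algebra set \<Rightarrow> bool"
  where "presented_algebra \<phi> G R \<longleftrightarrow>
    free_eval \<phi> ` free_subalgebra G = UNIV \<and>
    {p \<in> free_subalgebra G. free_eval \<phi> p = 0} = ideal_generated (free_subalgebra G) R"


section \<open>Hopf algebras\<close>

locale coalgebra =
  fixes \<Delta> :: "'a::complex_vector \<Rightarrow> ('a, 'a) tensor"
    and \<epsilon> :: "'a \<Rightarrow> complex"
  assumes comult_linear: "clinear \<Delta>"
    and counit_linear: "clinear \<epsilon>"
    and coassoc: "tensor_assoc (tensor_map \<Delta> id (\<Delta> x)) = tensor_map id \<Delta> (\<Delta> x)"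
    and counit_left: "tensor_lift (\<lambda>y z. \<epsilon> y *\<^sub>C z) (\<Delta> x) = x"
    and counit_right: "tensor_lift (\<lambda>y z. \<epsilon> z *\<^sub>C y) (\<Delta> x) = x"

locale hopf_algebra = coalgebra \<Delta> \<epsilon>
  for \<Delta> :: "'a::complex_algebra \<Rightarrow> ('a, 'a) tensor"
    and \<epsilon> :: "'a \<Rightarrow> complex" +
  fixes S :: "'a \<Rightarrow> 'a"
  assumes comult_one: "\<Delta> 1 = 1 \<otimes> 1"
    and comult_mult: "\<Delta> (x * y) = tensor_mult (*) (*) (\<Delta> x) (\<Delta> y)"
    and counit_one: "\<epsilon> 1 = 1"
    and counit_mult: "\<epsilon> (x * y) = \<epsilon> x * \<epsilon> y"
    and antipode_linear: "clinear S"
    and antipode_left: "tensor_lift (\<lambda>y z. S y * z) (\<Delta> x) = \<epsilon> x *\<^sub>C 1"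
    and antipode_right: "tensor_lift (\<lambda>y z. y * S z) (\<Delta> x) = \<epsilon> x *\<^sub>C 1"

locale left_comodule = coalgebra \<Delta> \<epsilon>
  for \<Delta> :: "'a::complex_vector \<Rightarrow> ('a, 'a) tensor"
    and \<epsilon> :: "'a \<Rightarrow> complex" +
  fixes \<rho> :: "'m::complex_vector \<Rightarrow> ('a, 'm) tensor"
  assumes left_coaction_linear: "clinear \<rho>"
    and left_coaction_coassoc: "tensor_assoc (tensor_map \<Delta> id (\<rho> m)) = tensor_map id \<rho> (\<rho> m)"
    and left_coaction_counit: "tensor_lift (\<lambda>x n. \<epsilon> x *\<^sub>C n) (\<rho> m) = m"

locale right_comodule = coalgebra \<Delta> \<epsilon>
  for \<Delta> :: "'a::complex_vector \<Rightarrow> ('a, 'a) tensor"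
    and \<epsilon> :: "'a \<Rightarrow> complex" +
  fixes \<rho> :: "'m::complex_vector \<Rightarrow> ('m, 'a) tensor"
  assumes right_coaction_linear: "clinear \<rho>"
    and right_coaction_coassoc: "tensor_assoc (tensor_map \<rho> id (\<rho> m)) = tensor_map id \<Delta> (\<rho> m)"
    and right_coaction_counit: "tensor_lift (\<lambda>n x. \<epsilon> x *\<^sub>C n) (\<rho> m) = m"

text \<open>The dual Hopf algebra \<open>H\<close>: functionals whose composite with the product of \<open>A\<close> has finite rank.\<close>
definition finite_dual :: "('a::complex_algebra \<Rightarrow> complex) set"
  where "finite_dual = {h. clinear h \<and>
    (\<exists>(n::nat) u v. (\<forall>k<n. clinear (u k) \<and> clinear (v k)) \<and>
       (\<forall>x y. h (x * y) = (\<Sum>k<n. u k x * v k y)))}"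

definition convolution ::
  "('a::complex_vector \<Rightarrow> ('a, 'a) tensor) \<Rightarrow> ('a \<Rightarrow> complex) \<Rightarrow> ('a \<Rightarrow> complex) \<Rightarrow> 'a \<Rightarrow> complex"
  where "convolution \<Delta> g h x = tensor_lift (\<lambda>y z. g y * h z) (\<Delta> x)"

text \<open>\<open>h \<triangleright> m = (id \<otimes> h) (\<rho> m)\<close>; on \<open>A\<close> itself the coaction is \<open>\<rho> = \<Delta>\<close>.\<close>
definition dual_action ::
  "('m::complex_vector \<Rightarrow> ('m, 'a::complex_vector) tensor) \<Rightarrow> ('a \<Rightarrow> complex) \<Rightarrow> 'm \<Rightarrow> 'm"
  where "dual_action \<rho> h m = tensor_lift (\<lambda>n x. h x *\<^sub>C n) (\<rho> m)"

inductive_set generated_dual_subalgebra ::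
  "('a::complex_vector \<Rightarrow> ('a, 'a) tensor) \<Rightarrow> ('a \<Rightarrow> complex) \<Rightarrow> ('a \<Rightarrow> complex) set \<Rightarrow> ('a \<Rightarrow> complex) set"
  for \<Delta> \<epsilon> G where
    gen: "h \<in> G \<Longrightarrow> h \<in> generated_dual_subalgebra \<Delta> \<epsilon> G"
  | unit: "\<epsilon> \<in> generated_dual_subalgebra \<Delta> \<epsilon> G"
  | add: "g \<in> generated_dual_subalgebra \<Delta> \<epsilon> G \<Longrightarrow> h \<in> generated_dual_subalgebra \<Delta> \<epsilon> G
      \<Longrightarrow> g + h \<in> generated_dual_subalgebra \<Delta> \<epsilon> G"
  | scale: "h \<in> generated_dual_subalgebra \<Delta> \<epsilon> G \<Longrightarrow> c *\<^sub>C h \<in> generated_dual_subalgebra \<Delta> \<epsilon> G"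
  | conv: "g \<in> generated_dual_subalgebra \<Delta> \<epsilon> G \<Longrightarrow> h \<in> generated_dual_subalgebra \<Delta> \<epsilon> G
      \<Longrightarrow> convolution \<Delta> g h \<in> generated_dual_subalgebra \<Delta> \<epsilon> G"


section \<open>Graded Hopf algebras and their module algebras\<close>

locale super_algebra =
  fixes C0 C1 :: "'c::complex_algebra set"
  assumes even_subspace: "csubspace C0"
    and odd_subspace: "csubspace C1"
    and even_inter_odd: "C0 \<inter> C1 = {0}"
    and even_plus_odd: "\<exists>y\<in>C0. \<exists>z\<in>C1. x = y + z"
    and one_even: "1 \<in> C0"
    and even_even: "x \<in> C0 \<Longrightarrow> y \<in> C0 \<Longrightarrow> x * y \<in> C0"
    and even_odd: "x \<in> C0 \<Longrightarrow> y \<in> C1 \<Longrightarrow> x * y \<in> C1"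
    and odd_even: "x \<in> C1 \<Longrightarrow> y \<in> C0 \<Longrightarrow> x * y \<in> C1"
    and odd_odd: "x \<in> C1 \<Longrightarrow> y \<in> C1 \<Longrightarrow> x * y \<in> C0"

definition even_part :: "'c::complex_algebra set \<Rightarrow> 'c set \<Rightarrow> 'c \<Rightarrow> 'c"
  where "even_part C0 C1 x = (THE y. y \<in> C0 \<and> x - y \<in> C1)"

definition odd_part :: "'c::complex_algebra set \<Rightarrow> 'c set \<Rightarrow> 'c \<Rightarrow> 'c"
  where "odd_part C0 C1 x = x - even_part C0 C1 x"

text \<open>The linear map with \<open>x \<mapsto> (-1)\<^bsup>|x|\<^esup> x\<close> on homogeneous elements.\<close>
definition grade_involution :: "'c::complex_algebra set \<Rightarrow> 'c set \<Rightarrow> 'c \<Rightarrow> 'c"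
  where "grade_involution C0 C1 x = even_part C0 C1 x - odd_part C0 C1 x"

text \<open>\<open>(x \<otimes> y) (z \<otimes> w) = (-1)\<^bsup>|y||z|\<^esup> x z \<otimes> y w\<close>\<close>
definition super_tensor_mult ::
  "'c::complex_algebra set \<Rightarrow> 'c set \<Rightarrow> ('c, 'c) tensor \<Rightarrow> ('c, 'c) tensor \<Rightarrow> ('c, 'c) tensor"
  where "super_tensor_mult C0 C1 s t =
    tensor_lift (\<lambda>x y. tensor_lift (\<lambda>z w.
      (x * even_part C0 C1 z) \<otimes> (y * w) +
      (x * odd_part C0 C1 z) \<otimes> (grade_involution C0 C1 y * w)) t) s"

locale super_hopf_algebra = super_algebra C0 C1 + coalgebra \<Delta> \<epsilon>
  for C0 C1 :: "'c::complex_algebra set"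
    and \<Delta> :: "'c \<Rightarrow> ('c, 'c) tensor"
    and \<epsilon> :: "'c \<Rightarrow> complex" +
  fixes S :: "'c \<Rightarrow> 'c"
  assumes comult_even: "x \<in> C0 \<Longrightarrow>
        \<Delta> x \<in> cspan ({y \<otimes> z | y z. y \<in> C0 \<and> z \<in> C0} \<union> {y \<otimes> z | y z. y \<in> C1 \<and> z \<in> C1})"
    and comult_odd: "x \<in> C1 \<Longrightarrow>
        \<Delta> x \<in> cspan ({y \<otimes> z | y z. y \<in> C0 \<and> z \<in> C1} \<union> {y \<otimes> z | y z. y \<in> C1 \<and> z \<in> C0})"
    and counit_odd: "x \<in> C1 \<Longrightarrow> \<epsilon> x = 0"
    and antipode_even: "x \<in> C0 \<Longrightarrow> S x \<in> C0"
    and antipode_odd: "x \<in> C1 \<Longrightarrow> S x \<in> C1"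
    and super_comult_one: "\<Delta> 1 = 1 \<otimes> 1"
    and super_comult_mult: "\<Delta> (x * y) = super_tensor_mult C0 C1 (\<Delta> x) (\<Delta> y)"
    and super_counit_one: "\<epsilon> 1 = 1"
    and super_counit_mult: "\<epsilon> (x * y) = \<epsilon> x * \<epsilon> y"
    and super_antipode_linear: "clinear S"
    and super_antipode_left: "tensor_lift (\<lambda>y z. S y * z) (\<Delta> x) = \<epsilon> x *\<^sub>C 1"
    and super_antipode_right: "tensor_lift (\<lambda>y z. y * S z) (\<Delta> x) = \<epsilon> x *\<^sub>C 1"

text \<open>
  \<open>\<lambda>\<close> is a homomorphism of \<open>\<int>/2\<close>-graded unital algebras into the linear endomorphisms of a space with
  homogeneous components \<open>M n\<close>, taken modulo two.
\<close>
definition super_representation ::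
  "'c::complex_algebra set \<Rightarrow> 'c set \<Rightarrow> (nat \<Rightarrow> 'w::complex_vector set) \<Rightarrow> ('c \<Rightarrow> 'w \<Rightarrow> 'w) \<Rightarrow> bool"
  where "super_representation C0 C1 M lam \<longleftrightarrow>
    clinear lam \<and> (\<forall>x. clinear (lam x)) \<and>
    lam 1 = id \<and> (\<forall>x y. lam (x * y) = lam x \<circ> lam y) \<and>
    (let M0 = cspan (\<Union>n. M (2 * n)); M1 = cspan (\<Union>n. M (2 * n + 1)) in
      (\<forall>x\<in>C0. lam x ` M0 \<subseteq> M0 \<and> lam x ` M1 \<subseteq> M1) \<and>
      (\<forall>x\<in>C1. lam x ` M0 \<subseteq> M1 \<and> lam x ` M1 \<subseteq> M0))"

text \<open>
  For \<open>\<alpha>\<close> of degree \<open>n\<close> the sign \<open>(-1)\<^bsup>|z||\<alpha>|\<^esup>\<close> is produced by applying the grade involution to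
  \<open>z = x\<^sub>(\<^sub>2\<^sub>)\<close> exactly \<open>n\<close> times.
\<close>
definition super_module_algebra ::
  "'c::complex_algebra set \<Rightarrow> 'c set \<Rightarrow> ('c \<Rightarrow> ('c, 'c) tensor) \<Rightarrow> ('c \<Rightarrow> complex)
    \<Rightarrow> (nat \<Rightarrow> 'w::complex_algebra set) \<Rightarrow> ('c \<Rightarrow> 'w \<Rightarrow> 'w) \<Rightarrow> bool"
  where "super_module_algebra C0 C1 \<Delta> \<epsilon> M lam \<longleftrightarrow>
    (\<forall>x n \<alpha> \<beta>. \<alpha> \<in> M n \<longrightarrow>
      lam x (\<alpha> * \<beta>) =
        tensor_lift (\<lambda>y z. lam y \<alpha> * lam ((grade_involution C0 C1 ^^ n) z) \<beta>) (\<Delta> x)) \<and>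
    (\<forall>x. lam x 1 = \<epsilon> x *\<^sub>C 1)"


section \<open>Bicovariant first order differential calculi\<close>

locale bimodule =
  fixes lact :: "'a::complex_algebra \<Rightarrow> 'g::complex_vector \<Rightarrow> 'g"
    and ract :: "'g \<Rightarrow> 'a \<Rightarrow> 'g"
  assumes lact_bilinear: "cbilinear lact"
    and ract_bilinear: "cbilinear ract"
    and lact_one: "lact 1 \<gamma> = \<gamma>"
    and ract_one: "ract \<gamma> 1 = \<gamma>"
    and lact_mult: "lact (x * y) \<gamma> = lact x (lact y \<gamma>)"
    and ract_mult: "ract \<gamma> (x * y) = ract (ract \<gamma> x) y"
    and lact_ract: "ract (lact x \<gamma>) y = lact x (ract \<gamma> y)"

locale bicovariant_calculus =
  hopf_algebra \<Delta> \<epsilon> S + bimodule lact ract +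
  left: left_comodule \<Delta> \<epsilon> \<Delta>\<^sub>L + right: right_comodule \<Delta> \<epsilon> \<Delta>\<^sub>R
  for \<Delta> :: "'a::complex_algebra \<Rightarrow> ('a, 'a) tensor"
    and \<epsilon> :: "'a \<Rightarrow> complex"
    and S :: "'a \<Rightarrow> 'a"
    and lact :: "'a \<Rightarrow> 'g::complex_vector \<Rightarrow> 'g"
    and ract :: "'g \<Rightarrow> 'a \<Rightarrow> 'g"
    and \<Delta>\<^sub>L :: "'g \<Rightarrow> ('a, 'g) tensor"
    and \<Delta>\<^sub>R :: "'g \<Rightarrow> ('g, 'a) tensor" +
  fixes d :: "'a \<Rightarrow> 'g"
  assumes antipode_bij: "bij S"
    and d_linear: "clinear d"
    and d_leibniz: "d (x * y) = ract (d x) y + lact x (d y)"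
    and d_generates: "cspan {lact x (d y) | x y. True} = UNIV"
    and left_covariant: "\<Delta>\<^sub>L (lact x (d y)) = tensor_mult (*) lact (\<Delta> x) (tensor_map id d (\<Delta> y))"
    and right_covariant: "\<Delta>\<^sub>R (lact x (d y)) = tensor_mult lact (*) (\<Delta> x) (tensor_map d id (\<Delta> y))"
begin

definition left_invariant_forms :: "'g set"
  where "left_invariant_forms = {\<gamma>. \<Delta>\<^sub>L \<gamma> = 1 \<otimes> \<gamma>}"

text \<open>Woronowicz's right ideal of the calculus: \<open>x\<close> in the kernel of \<open>\<epsilon>\<close> with \<open>S(x\<^sub>(\<^sub>1\<^sub>)) d x\<^sub>(\<^sub>2\<^sub>) = 0\<close>.\<close>
definition calculus_ideal :: "'a set"
  where "calculus_ideal = {x. \<epsilon> x = 0 \<and> tensor_lift (\<lambda>y z. lact (S y) (d z)) (\<Delta> x) = 0}"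

definition tangent_space :: "('a \<Rightarrow> complex) set"
  where "tangent_space = {Y. clinear Y \<and> Y 1 = 0 \<and> (\<forall>x\<in>calculus_ideal. Y x = 0)}"

end

text \<open>
  The calculus with its structure data relative to a basis \<open>\<omega> 1, \<dots>, \<omega> N\<close> of the left-invariant
  forms.  Only the values of \<open>\<omega>\<close>, \<open>f\<close>, \<open>J\<close>, \<open>X\<close> at indices in \<open>{1..N}\<close> matter.
\<close>
locale based_calculus = bicovariant_calculus \<Delta> \<epsilon> S lact ract \<Delta>\<^sub>L \<Delta>\<^sub>R d
  for \<Delta> :: "'a::complex_algebra \<Rightarrow> ('a, 'a) tensor"
    and \<epsilon> :: "'a \<Rightarrow> complex"
    and S :: "'a \<Rightarrow> 'a"
    and lact :: "'a \<Rightarrow> 'g::complex_vector \<Rightarrow> 'g"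
    and ract :: "'g \<Rightarrow> 'a \<Rightarrow> 'g"
    and \<Delta>\<^sub>L :: "'g \<Rightarrow> ('a, 'g) tensor"
    and \<Delta>\<^sub>R :: "'g \<Rightarrow> ('g, 'a) tensor"
    and d :: "'a \<Rightarrow> 'g" +
  fixes N :: nat
    and \<omega> :: "nat \<Rightarrow> 'g"
    and f :: "nat \<Rightarrow> nat \<Rightarrow> 'a \<Rightarrow> complex"
    and J :: "nat \<Rightarrow> nat \<Rightarrow> 'a"
    and pairing :: "('a \<Rightarrow> complex) \<Rightarrow> 'g \<Rightarrow> complex"
    and X :: "nat \<Rightarrow> 'a \<Rightarrow> complex"
  assumes \<omega>_inj: "inj_on \<omega> {1..N}"
    and \<omega>_independent: "complex_vector.independent (\<omega> ` {1..N})"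
    and \<omega>_span: "cspan (\<omega> ` {1..N}) = left_invariant_forms"
    and f_dual: "i \<in> {1..N} \<Longrightarrow> j \<in> {1..N} \<Longrightarrow> f i j \<in> finite_dual"
    and f_commutation: "i \<in> {1..N} \<Longrightarrow>
        ract (\<omega> i) x = (\<Sum>j=1..N. lact (dual_action \<Delta> (f i j) x) (\<omega> j))"
    and J_coaction: "i \<in> {1..N} \<Longrightarrow> \<Delta>\<^sub>R (\<omega> i) = (\<Sum>j=1..N. \<omega> j \<otimes> J j i)"
    and pairing_linear: "Y \<in> tangent_space \<Longrightarrow> clinear (pairing Y)"
    and pairing_eq: "Y \<in> tangent_space \<Longrightarrow> pairing Y (lact x (d y)) = \<epsilon> x * Y y"
    and X_tangent: "i \<in> {1..N} \<Longrightarrow> X i \<in> tangent_space"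
    and X_span: "cspan (X ` {1..N}) = tangent_space"
    and X_dual_basis: "i \<in> {1..N} \<Longrightarrow> j \<in> {1..N} \<Longrightarrow> pairing (X i) (\<omega> j) = (if i = j then 1 else 0)"
begin

text \<open>\<open>\<sigma>\<^sup>k\<^sup>l\<^sub>i\<^sub>j\<close> is \<open>braid k l i j\<close>, and \<open>C\<^sup>k\<^sub>i\<^sub>j\<close> is \<open>struct k i j\<close>.\<close>
definition braid :: "nat \<Rightarrow> nat \<Rightarrow> nat \<Rightarrow> nat \<Rightarrow> complex"
  where "braid k l i j = f i l (J k j)"

definition struct :: "nat \<Rightarrow> nat \<Rightarrow> nat \<Rightarrow> complex"
  where "struct k i j = X j (J i k)"

definition calculus_bialgebra :: "('a \<Rightarrow> complex) set"
  where "calculus_bialgebra =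
    generated_dual_subalgebra \<Delta> \<epsilon> (X ` {1..N} \<union> {f j k | j k. j \<in> {1..N} \<and> k \<in> {1..N}})"

text \<open>The antipode of the dual is \<open>h \<mapsto> h \<circ> S\<close>.\<close>
definition S_compatible :: bool
  where "S_compatible \<longleftrightarrow> (\<forall>i\<in>{1..N}. \<forall>j\<in>{1..N}. f i j \<circ> S \<in> calculus_bialgebra)"

end


section \<open>The exterior algebra of a calculus\<close>

primrec form_degree ::
  "('a \<Rightarrow> 't::complex_algebra) \<Rightarrow> ('g \<Rightarrow> 't) \<Rightarrow> nat \<Rightarrow> 't set"
  where
    "form_degree a g 0 = range a"
  | "form_degree a g (Suc n) = cspan {u * g \<gamma> | u \<gamma>. u \<in> form_degree a g n}"

text \<open>
  The algebra \<open>'t\<close> is the tensor algebra of the bimodule: the direct sum of its components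
  \<open>T n\<close>, where \<open>T 0\<close> is a copy of \<open>A\<close> and the product identifies \<open>T (n + 1)\<close> with
  the tensor product of \<open>T n\<close> and \<open>\<Gamma>\<close> over \<open>A\<close>, that is, with the tensor product over the complex
  numbers modulo the span of the \<open>u x \<otimes> \<gamma> - u \<otimes> x \<gamma>\<close>.
\<close>
locale tensor_algebra = bimodule lact ract
  for lact :: "'a::complex_algebra \<Rightarrow> 'g::complex_vector \<Rightarrow> 'g"
    and ract :: "'g \<Rightarrow> 'a \<Rightarrow> 'g" +
  fixes \<iota>\<^sub>A :: "'a \<Rightarrow> 't::complex_algebra"
    and \<iota>\<^sub>\<Gamma> :: "'g \<Rightarrow> 't"
  assumes \<iota>A_linear: "clinear \<iota>\<^sub>A"
    and \<iota>A_one: "\<iota>\<^sub>A 1 = 1"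
    and \<iota>A_mult: "\<iota>\<^sub>A (x * y) = \<iota>\<^sub>A x * \<iota>\<^sub>A y"
    and \<iota>A_inj: "inj \<iota>\<^sub>A"
    and \<iota>\<Gamma>_linear: "clinear \<iota>\<^sub>\<Gamma>"
    and \<iota>\<Gamma>_lact: "\<iota>\<^sub>\<Gamma> (lact x \<gamma>) = \<iota>\<^sub>A x * \<iota>\<^sub>\<Gamma> \<gamma>"
    and \<iota>\<Gamma>_ract: "\<iota>\<^sub>\<Gamma> (ract \<gamma> x) = \<iota>\<^sub>\<Gamma> \<gamma> * \<iota>\<^sub>A x"
    and degrees_span: "cspan (\<Union>n. form_degree \<iota>\<^sub>A \<iota>\<^sub>\<Gamma> n) = UNIV"
    and degrees_independent: "(\<And>n. n \<le> m \<Longrightarrow> u n \<in> form_degree \<iota>\<^sub>A \<iota>\<^sub>\<Gamma> n) \<Longrightarrow>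
        (\<Sum>n\<le>m. u n) = 0 \<Longrightarrow> n \<le> m \<Longrightarrow> u n = 0"
    and balanced:
      "{s \<in> cspan {u \<otimes> \<gamma> | u \<gamma>. u \<in> form_degree \<iota>\<^sub>A \<iota>\<^sub>\<Gamma> n}.
          tensor_lift (\<lambda>u \<gamma>. u * \<iota>\<^sub>\<Gamma> \<gamma>) s = 0} =
       cspan {(u * \<iota>\<^sub>A x) \<otimes> \<gamma> - u \<otimes> lact x \<gamma> | u x \<gamma>. u \<in> form_degree \<iota>\<^sub>A \<iota>\<^sub>\<Gamma> n}"

text \<open>
  The algebra \<open>'w\<close> is the exterior algebra, with quotient map \<open>\<pi>\<close> from the tensor algebra \<open>'t\<close>.  The
  braiding \<open>\<sigma>\<close> is only constrained (and only used) on the degree two part.  \<open>dw\<close>, \<open>\<rho>\<close> and \<open>inner k\<close>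
  are the exterior differential, the right coaction and the inner derivatives.
\<close>
locale exterior_algebra =
  based_calculus \<Delta> \<epsilon> S lact ract \<Delta>\<^sub>L \<Delta>\<^sub>R d N \<omega> f J pairing X +
  tensor_algebra lact ract \<iota>\<^sub>A \<iota>\<^sub>\<Gamma>
  for \<Delta> :: "'a::complex_algebra \<Rightarrow> ('a, 'a) tensor"
    and \<epsilon> :: "'a \<Rightarrow> complex"
    and S :: "'a \<Rightarrow> 'a"
    and lact :: "'a \<Rightarrow> 'g::complex_vector \<Rightarrow> 'g"
    and ract :: "'g \<Rightarrow> 'a \<Rightarrow> 'g"
    and \<Delta>\<^sub>L :: "'g \<Rightarrow> ('a, 'g) tensor"
    and \<Delta>\<^sub>R :: "'g \<Rightarrow> ('g, 'a) tensor"
    and d :: "'a \<Rightarrow> 'g"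
    and N :: nat
    and \<omega> :: "nat \<Rightarrow> 'g"
    and f :: "nat \<Rightarrow> nat \<Rightarrow> 'a \<Rightarrow> complex"
    and J :: "nat \<Rightarrow> nat \<Rightarrow> 'a"
    and pairing :: "('a \<Rightarrow> complex) \<Rightarrow> 'g \<Rightarrow> complex"
    and X :: "nat \<Rightarrow> 'a \<Rightarrow> complex"
    and \<iota>\<^sub>A :: "'a \<Rightarrow> 't::complex_algebra"
    and \<iota>\<^sub>\<Gamma> :: "'g \<Rightarrow> 't" +
  fixes \<sigma> :: "'t \<Rightarrow> 't"
    and \<pi> :: "'t \<Rightarrow> 'w::complex_algebra"
    and dw :: "'w \<Rightarrow> 'w"
    and \<rho> :: "'w \<Rightarrow> ('w, 'a) tensor"
    and inner :: "nat \<Rightarrow> 'w \<Rightarrow> 'w"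
  assumes \<sigma>_add: "u \<in> form_degree \<iota>\<^sub>A \<iota>\<^sub>\<Gamma> 2 \<Longrightarrow> v \<in> form_degree \<iota>\<^sub>A \<iota>\<^sub>\<Gamma> 2 \<Longrightarrow> \<sigma> (u + v) = \<sigma> u + \<sigma> v"
    and \<sigma>_left: "u \<in> form_degree \<iota>\<^sub>A \<iota>\<^sub>\<Gamma> 2 \<Longrightarrow> \<sigma> (\<iota>\<^sub>A x * u) = \<iota>\<^sub>A x * \<sigma> u"
    and \<sigma>_right: "u \<in> form_degree \<iota>\<^sub>A \<iota>\<^sub>\<Gamma> 2 \<Longrightarrow> \<sigma> (u * \<iota>\<^sub>A x) = \<sigma> u * \<iota>\<^sub>A x"
    and \<sigma>_basis: "i \<in> {1..N} \<Longrightarrow> j \<in> {1..N} \<Longrightarrow>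
        \<sigma> (\<iota>\<^sub>\<Gamma> (\<omega> i) * \<iota>\<^sub>\<Gamma> (\<omega> j)) =
          (\<Sum>k=1..N. \<Sum>l=1..N. braid k l i j *\<^sub>C (\<iota>\<^sub>\<Gamma> (\<omega> k) * \<iota>\<^sub>\<Gamma> (\<omega> l)))"
    and \<pi>_linear: "clinear \<pi>"
    and \<pi>_one: "\<pi> 1 = 1"
    and \<pi>_mult: "\<pi> (u * v) = \<pi> u * \<pi> v"
    and \<pi>_surj: "surj \<pi>"
    and \<pi>_kernel: "{u. \<pi> u = 0} = ideal_generated UNIV {u \<in> form_degree \<iota>\<^sub>A \<iota>\<^sub>\<Gamma> 2. \<sigma> u = u}"
    and dw_linear: "clinear dw"
    and dw_degree: "\<alpha> \<in> form_degree (\<pi> \<circ> \<iota>\<^sub>A) (\<pi> \<circ> \<iota>\<^sub>\<Gamma>) n \<Longrightarrow>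
        dw \<alpha> \<in> form_degree (\<pi> \<circ> \<iota>\<^sub>A) (\<pi> \<circ> \<iota>\<^sub>\<Gamma>) (Suc n)"
    and dw_extends: "dw (\<pi> (\<iota>\<^sub>A x)) = \<pi> (\<iota>\<^sub>\<Gamma> (d x))"
    and dw_leibniz: "\<alpha> \<in> form_degree (\<pi> \<circ> \<iota>\<^sub>A) (\<pi> \<circ> \<iota>\<^sub>\<Gamma>) n \<Longrightarrow>
        dw (\<alpha> * \<beta>) = dw \<alpha> * \<beta> + (- 1) ^ n * \<alpha> * dw \<beta>"
    and dw_dw: "dw (dw \<alpha>) = 0"
    and \<rho>_comodule: "right_comodule \<Delta> \<epsilon> \<rho>"
    and \<rho>_zero: "\<rho> (\<pi> (\<iota>\<^sub>A x)) = tensor_map (\<pi> \<circ> \<iota>\<^sub>A) id (\<Delta> x)"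
    and \<rho>_dw: "\<rho> (\<pi> (\<iota>\<^sub>A x) * dw \<alpha>) =
        tensor_mult (\<lambda>y \<beta>. \<pi> (\<iota>\<^sub>A y) * \<beta>) (*) (\<Delta> x) (tensor_map dw id (\<rho> \<alpha>))"
    and inner_linear: "k \<in> {1..N} \<Longrightarrow> clinear (inner k)"
    and inner_degree: "k \<in> {1..N} \<Longrightarrow> \<alpha> \<in> form_degree (\<pi> \<circ> \<iota>\<^sub>A) (\<pi> \<circ> \<iota>\<^sub>\<Gamma>) (Suc n) \<Longrightarrow>
        inner k \<alpha> \<in> form_degree (\<pi> \<circ> \<iota>\<^sub>A) (\<pi> \<circ> \<iota>\<^sub>\<Gamma>) n"
    and inner_zero: "k \<in> {1..N} \<Longrightarrow> inner k (\<pi> (\<iota>\<^sub>A x)) = 0"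
    and inner_\<omega>: "k \<in> {1..N} \<Longrightarrow> j \<in> {1..N} \<Longrightarrow> inner k (\<pi> (\<iota>\<^sub>\<Gamma> (\<omega> j))) = (if k = j then 1 else 0)"
    and inner_product: "k \<in> {1..N} \<Longrightarrow> \<alpha> \<in> form_degree (\<pi> \<circ> \<iota>\<^sub>A) (\<pi> \<circ> \<iota>\<^sub>\<Gamma>) n \<Longrightarrow>
        inner k (\<alpha> * \<beta>) =
          (- 1) ^ n * \<alpha> * inner k \<beta> + (\<Sum>j=1..N. inner j \<alpha> * dual_action \<rho> (f j k) \<beta>)"


section \<open>The quantum Cartan algebra\<close>

datatype 'a cartan_generator = Fun "'a \<Rightarrow> complex" | Xi nat | Delta

context based_calculus
begin

definition cartan_generators :: "'a cartan_generator set"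
  where "cartan_generators = Fun ` calculus_bialgebra \<union> Xi ` {1..N} \<union> {Delta}"

text \<open>The first four sets force \<open>Fun\<close> to induce a unital algebra homomorphism.\<close>
definition cartan_relations ::
  "(nat \<times> nat) set \<Rightarrow> (nat \<Rightarrow> nat \<Rightarrow> nat \<Rightarrow> nat \<Rightarrow> complex) \<Rightarrow> 'a cartan_generator free_algebra set"
  where "cartan_relations P t =
     {letter (Fun (g + h)) - letter (Fun g) - letter (Fun h)
       | g h. g \<in> calculus_bialgebra \<and> h \<in> calculus_bialgebra}
   \<union> {letter (Fun (c *\<^sub>C h)) - c *\<^sub>C letter (Fun h) | c h. h \<in> calculus_bialgebra}
   \<union> {letter (Fun (convolution \<Delta> g h)) - letter (Fun g) * letter (Fun h)
       | g h. g \<in> calculus_bialgebra \<and> h \<in> calculus_bialgebra}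
   \<union> {letter (Fun \<epsilon>) - 1}
   \<union> {letter (Xi i) * letter (Xi j)
        + (\<Sum>k=1..N. \<Sum>l=1..N. t i j k l *\<^sub>C (letter (Xi k) * letter (Xi l)))
       | i j. (i, j) \<in> P}
   \<union> {letter (Xi i) * letter Delta + letter Delta * letter (Xi i) - letter (Fun (X i))
       | i. i \<in> {1..N}}
   \<union> {letter Delta * letter Delta}
   \<union> {letter (Xi i) * letter (Fun (f k j))
        - (\<Sum>n=1..N. \<Sum>m=1..N. braid i j n m *\<^sub>C (letter (Fun (f k n)) * letter (Xi m)))
       | i j k. i \<in> {1..N} \<and> j \<in> {1..N} \<and> k \<in> {1..N}}
   \<union> {letter (Xi i) * letter (Fun (X j))
        - (\<Sum>k=1..N. \<Sum>l=1..N. braid i j k l *\<^sub>C (letter (Fun (X k)) * letter (Xi l)))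
        - (\<Sum>k=1..N. struct k i j *\<^sub>C letter (Xi k))
       | i j. i \<in> {1..N} \<and> j \<in> {1..N}}
   \<union> {letter (Fun (f i j)) * letter Delta - letter Delta * letter (Fun (f i j))
       | i j. i \<in> {1..N} \<and> j \<in> {1..N}}
   \<union> {letter (Fun (X i)) * letter Delta - letter Delta * letter (Fun (X i)) | i. i \<in> {1..N}}"

end

text \<open>
  \<open>\<sigma>\<^sub>t\<close> is the transposed braiding and \<open>t i j k l\<close> is \<open>t\<^sup>i\<^sup>j\<^sub>k\<^sub>l\<close>.  The set \<open>P\<close> lists the index pairs
  \<open>(i, j)\<close> for which a spanning vector of \<open>ker (id - \<sigma>\<^sub>t)\<close>, and hence a quadratic relation among the
  \<open>\<xi>\<close>, is given; it may be the set of all pairs, but with \<open>t\<^sup>i\<^sup>j\<^sub>i\<^sub>j = 0\<close> a spanning vector at every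
  pair need not exist, whereas the pivots of a reduced basis of the kernel always provide such a \<open>P\<close>.
  The algebra \<open>'c\<close> is the quantum Cartan algebra, \<open>emb\<close> the canonical map of the calculus bialgebra
  into it.  The formulas for the antipode \<open>S\<^sub>C\<close> are meaningful when the calculus is S-compatible, since
  only then \<open>f i j \<circ> S\<close> lies in the calculus bialgebra.
\<close>
locale quantum_cartan_algebra =
  based_calculus \<Delta> \<epsilon> S lact ract \<Delta>\<^sub>L \<Delta>\<^sub>R d N \<omega> f J pairing X +
  cartan: super_hopf_algebra C0 C1 \<Delta>\<^sub>C \<epsilon>\<^sub>C S\<^sub>C
  for \<Delta> :: "'a::complex_algebra \<Rightarrow> ('a, 'a) tensor"
    and \<epsilon> :: "'a \<Rightarrow> complex"
    and S :: "'a \<Rightarrow> 'a"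
    and lact :: "'a \<Rightarrow> 'g::complex_vector \<Rightarrow> 'g"
    and ract :: "'g \<Rightarrow> 'a \<Rightarrow> 'g"
    and \<Delta>\<^sub>L :: "'g \<Rightarrow> ('a, 'g) tensor"
    and \<Delta>\<^sub>R :: "'g \<Rightarrow> ('g, 'a) tensor"
    and d :: "'a \<Rightarrow> 'g"
    and N :: nat
    and \<omega> :: "nat \<Rightarrow> 'g"
    and f :: "nat \<Rightarrow> nat \<Rightarrow> 'a \<Rightarrow> complex"
    and J :: "nat \<Rightarrow> nat \<Rightarrow> 'a"
    and pairing :: "('a \<Rightarrow> complex) \<Rightarrow> 'g \<Rightarrow> complex"
    and X :: "nat \<Rightarrow> 'a \<Rightarrow> complex"
    and C0 C1 :: "'c::complex_algebra set"
    and \<Delta>\<^sub>C :: "'c \<Rightarrow> ('c, 'c) tensor"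
    and \<epsilon>\<^sub>C :: "'c \<Rightarrow> complex"
    and S\<^sub>C :: "'c \<Rightarrow> 'c" +
  fixes \<sigma>\<^sub>t :: "('a \<Rightarrow> complex, 'a \<Rightarrow> complex) tensor \<Rightarrow> ('a \<Rightarrow> complex, 'a \<Rightarrow> complex) tensor"
    and P :: "(nat \<times> nat) set"
    and t :: "nat \<Rightarrow> nat \<Rightarrow> nat \<Rightarrow> nat \<Rightarrow> complex"
    and emb :: "('a \<Rightarrow> complex) \<Rightarrow> 'c"
    and \<xi> :: "nat \<Rightarrow> 'c"
    and \<delta> :: 'c
  assumes \<sigma>t_linear: "clinear \<sigma>\<^sub>t"
    and \<sigma>t_basis: "i \<in> {1..N} \<Longrightarrow> j \<in> {1..N} \<Longrightarrow>
        \<sigma>\<^sub>t (X i \<otimes> X j) = (\<Sum>k=1..N. \<Sum>l=1..N. braid i j k l *\<^sub>C (X k \<otimes> X l))"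
    and P_pairs: "P \<subseteq> {1..N} \<times> {1..N}"
    and t_normalized: "(i, j) \<in> P \<Longrightarrow> t i j i j = 0"
    and t_spans: "{s \<in> cspan {Y \<otimes> Z | Y Z. Y \<in> tangent_space \<and> Z \<in> tangent_space}. \<sigma>\<^sub>t s = s} =
        cspan {X i \<otimes> X j + (\<Sum>k=1..N. \<Sum>l=1..N. t i j k l *\<^sub>C (X k \<otimes> X l)) | i j. (i, j) \<in> P}"
    and cartan_presented:
      "presented_algebra (case_cartan_generator emb \<xi> \<delta>) cartan_generators (cartan_relations P t)"
    and emb_even: "h \<in> calculus_bialgebra \<Longrightarrow> emb h \<in> C0"
    and \<xi>_odd: "i \<in> {1..N} \<Longrightarrow> \<xi> i \<in> C1"
    and \<delta>_odd: "\<delta> \<in> C1"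
    and comult_X: "i \<in> {1..N} \<Longrightarrow>
        \<Delta>\<^sub>C (emb (X i)) = 1 \<otimes> emb (X i) + (\<Sum>j=1..N. emb (X j) \<otimes> emb (f j i))"
    and comult_f: "i \<in> {1..N} \<Longrightarrow> j \<in> {1..N} \<Longrightarrow>
        \<Delta>\<^sub>C (emb (f i j)) = (\<Sum>k=1..N. emb (f i k) \<otimes> emb (f k j))"
    and comult_\<xi>: "i \<in> {1..N} \<Longrightarrow>
        \<Delta>\<^sub>C (\<xi> i) = 1 \<otimes> \<xi> i + (\<Sum>j=1..N. \<xi> j \<otimes> emb (f j i))"
    and comult_\<delta>: "\<Delta>\<^sub>C \<delta> = 1 \<otimes> \<delta> + \<delta> \<otimes> 1"
    and counit_X: "i \<in> {1..N} \<Longrightarrow> \<epsilon>\<^sub>C (emb (X i)) = 0"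
    and counit_f: "i \<in> {1..N} \<Longrightarrow> j \<in> {1..N} \<Longrightarrow> \<epsilon>\<^sub>C (emb (f i j)) = (if i = j then 1 else 0)"
    and counit_\<xi>: "i \<in> {1..N} \<Longrightarrow> \<epsilon>\<^sub>C (\<xi> i) = 0"
    and counit_\<delta>: "\<epsilon>\<^sub>C \<delta> = 0"
    and antipode_f: "i \<in> {1..N} \<Longrightarrow> j \<in> {1..N} \<Longrightarrow> S\<^sub>C (emb (f i j)) = emb (f i j \<circ> S)"
    and antipode_X: "i \<in> {1..N} \<Longrightarrow> S\<^sub>C (emb (X i)) = - (\<Sum>j=1..N. emb (X j) * emb (f j i \<circ> S))"
    and antipode_\<xi>: "i \<in> {1..N} \<Longrightarrow> S\<^sub>C (\<xi> i) = - (\<Sum>j=1..N. \<xi> j * emb (f j i \<circ> S))"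
    and antipode_\<delta>: "S\<^sub>C \<delta> = - \<delta>"

definition cartan_action ::
  "'c::complex_algebra set \<Rightarrow> 'c set \<Rightarrow> (nat \<Rightarrow> 'w::complex_algebra set) \<Rightarrow> nat
    \<Rightarrow> (nat \<Rightarrow> nat \<Rightarrow> 'a::complex_algebra \<Rightarrow> complex) \<Rightarrow> (nat \<Rightarrow> 'a \<Rightarrow> complex)
    \<Rightarrow> (('a \<Rightarrow> complex) \<Rightarrow> 'c) \<Rightarrow> (nat \<Rightarrow> 'c) \<Rightarrow> 'c
    \<Rightarrow> ('w \<Rightarrow> ('w, 'a) tensor) \<Rightarrow> (nat \<Rightarrow> 'w \<Rightarrow> 'w) \<Rightarrow> ('w \<Rightarrow> 'w) \<Rightarrow> ('c \<Rightarrow> 'w \<Rightarrow> 'w) \<Rightarrow> bool"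
  where "cartan_action C0 C1 M N f X emb \<xi> \<delta> \<rho> inner dw lam \<longleftrightarrow>
    super_representation C0 C1 M lam \<and>
    (\<forall>j\<in>{1..N}. lam (emb (X j)) = dual_action \<rho> (X j)) \<and>
    (\<forall>j\<in>{1..N}. \<forall>k\<in>{1..N}. lam (emb (f j k)) = dual_action \<rho> (f j k)) \<and>
    (\<forall>j\<in>{1..N}. lam (\<xi> j) = inner j) \<and>
    lam \<delta> = dw"

end

theory Submission
  imports Defs
begin

text \<open>
  The Leibniz rules of \<open>d\<close>, \<open>i\<^sub>k\<close>, \<open>L\<^sub>k\<close> and \<open>L\<^sub>j\<^sub>k\<close> are exactly the coproducts of the generators, and the
  elements acting through their coproduct form a subalgebra; so the point is that the operators satisfy
  the defining relations of the quantum Cartan algebra.  Since \<open>\<Gamma>\<^sup>\<and>\<close> is spanned by the forms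
  \<open>x\<^sub>0 d(x\<^sub>1 d(x\<^sub>2 \<dots>))\<close>, an identity between operators may be checked on \<open>A\<close> and then propagated through
  \<open>\<alpha> \<mapsto> x \<alpha>\<close> and \<open>\<alpha> \<mapsto> d \<alpha>\<close>.  This gives the Cartan formula \<open>i\<^sub>k d + d i\<^sub>k = L\<^sub>k\<close> first.  Commuting \<open>d\<close>
  past a relation that involves \<open>i\<^sub>k\<close> turns it, by the Cartan formula, into a relation between
  functionals: \<open>X\<^sub>i f\<^sub>k\<^sub>j = \<sigma>\<^sup>i\<^sup>j\<^sub>n\<^sub>m f\<^sub>k\<^sub>n X\<^sub>m\<close> and \<open>X\<^sub>i X\<^sub>j - \<sigma>\<^sup>i\<^sup>j\<^sub>k\<^sub>l X\<^sub>k X\<^sub>l = C\<^sup>k\<^sub>i\<^sub>j X\<^sub>k\<close>.  Both follow by evaluating \<open>f\<^sub>k\<^sub>j\<close> and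
  \<open>X\<^sub>j\<close> on the identity \<open>X\<^sub>l(x\<^sub>(\<^sub>1\<^sub>)) x\<^sub>(\<^sub>2\<^sub>) = x\<^sub>(\<^sub>1\<^sub>) X\<^sub>i(x\<^sub>(\<^sub>2\<^sub>)) J\<^sub>l\<^sub>i\<close>, which is the right covariance of \<open>d\<close>.  For the
  quadratic relation between the \<open>i\<^sub>k\<close> one also needs that a \<open>\<sigma>\<^sup>t\<close>-invariant tensor is annihilated by the
  structure constants, because the \<open>X\<^sub>k\<close> are linearly independent.
\<close>


section \<open>Linear maps and tensors\<close>

lemma clinear_iff:
  "clinear F \<longleftrightarrow> (\<forall>x y. F (x + y) = F x + F y) \<and> (\<forall>c x. F (c *\<^sub>C x) = c *\<^sub>C F x)"
  by (simp add: complex_vector.vector_space_axioms vector_space.vector_space_assms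
      Vector_Spaces.linear_iff)

lemma clinear_add: "clinear F \<Longrightarrow> F (x + y) = F x + F y"
  and clinear_scale: "clinear F \<Longrightarrow> F (c *\<^sub>C x) = c *\<^sub>C F x"
  by (auto simp: clinear_iff)

lemma clinear_zero: "clinear F \<Longrightarrow> F 0 = 0"
  using clinear_scale[of F 0 0] by (simp add: complex_vector.scale_zero_left)

lemma clinear_neg: "clinear F \<Longrightarrow> F (- x) = - F x"
  using clinear_scale[of F "-1" x] by (simp add: complex_vector.scale_minus_left cscale_one)

lemma clinear_diff: "clinear F \<Longrightarrow> F (x - y) = F x - F y"
  using clinear_add[of F x "- y"] by (simp add: clinear_neg)

lemma clinear_sum: "clinear F \<Longrightarrow> F (\<Sum>i\<in>I. h i) = (\<Sum>i\<in>I. F (h i))"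
  by (induction I rule: infinite_finite_induct) (simp_all add: clinear_zero clinear_add)

lemma cbilinear_iff:
  "cbilinear h \<longleftrightarrow> (\<forall>x y z. h x (y + z) = h x y + h x z) \<and> (\<forall>c x y. h x (c *\<^sub>C y) = c *\<^sub>C h x y)
    \<and> (\<forall>x y z. h (x + y) z = h x z + h y z) \<and> (\<forall>c x y. h (c *\<^sub>C x) y = c *\<^sub>C h x y)"
  by (auto simp: cbilinear_def clinear_iff)

lemma tens_add_left: "(x + y) \<otimes> z = x \<otimes> z + y \<otimes> z"
  and tens_add_right: "x \<otimes> (z + w) = x \<otimes> z + x \<otimes> w"
  and tens_scale_left: "(c *\<^sub>C x) \<otimes> z = c *\<^sub>C (x \<otimes> z)"
  and tens_scale_right: "x \<otimes> (c *\<^sub>C z) = c *\<^sub>C (x \<otimes> z)"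
proof -
  have rel: "tensor_equiv p q" if "p - q \<in> tensor_relations" for p q :: "('a \<times> 'b) \<Rightarrow>\<^sub>0 complex"
    using that by (simp add: tensor_equiv_def complex_vector.span_base)
  show "(x + y) \<otimes> z = x \<otimes> z + y \<otimes> z" "x \<otimes> (z + w) = x \<otimes> z + x \<otimes> w"
    "(c *\<^sub>C x) \<otimes> z = c *\<^sub>C (x \<otimes> z)" "x \<otimes> (c *\<^sub>C z) = c *\<^sub>C (x \<otimes> z)"
    by (transfer, rule rel, simp add: tensor_relations_def diff_diff_eq, blast)+
qed

lemmas tens_linear = tens_add_left tens_add_right tens_scale_left tens_scale_right

text \<open>For a fixed tensor, \<open>tensor_lift\<close> is a finite linear combination of values of \<open>h\<close>, so the next
  facts need no bilinearity.\<close>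

lemma tensor_lift_fun_add: "tensor_lift (\<lambda>x y. g x y + h x y) s = tensor_lift g s + tensor_lift h s"
  by (simp add: tensor_lift_def formal_lift_def cscale_add_right sum.distrib)

lemma tensor_lift_fun_scale: "tensor_lift (\<lambda>x y. c *\<^sub>C h x y) s = c *\<^sub>C tensor_lift h s"
  by (simp add: tensor_lift_def formal_lift_def complex_vector.scale_sum_right cscale_cscale mult.commute)

lemma tensor_lift_fun_zero: "tensor_lift (\<lambda>x y. 0) s = 0"
  by (simp add: tensor_lift_def formal_lift_def complex_vector.scale_zero_right)

lemma clinear_tensor_lift_commute:
  "clinear F \<Longrightarrow> F (tensor_lift h s) = tensor_lift (\<lambda>x y. F (h x y)) s"
  by (simp add: tensor_lift_def formal_lift_def clinear_sum clinear_scale)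

lemma tensor_lift_fun_sum: "tensor_lift (\<lambda>x y. \<Sum>i\<in>I. h i x y) s = (\<Sum>i\<in>I. tensor_lift (h i) s)"
  by (induction I rule: infinite_finite_induct)
    (simp_all add: tensor_lift_fun_zero tensor_lift_fun_add)

lemma tensor_lift_swap:
  "tensor_lift (\<lambda>x y. tensor_lift (\<lambda>z w. h x y z w) t) s =
    tensor_lift (\<lambda>z w. tensor_lift (\<lambda>x y. h x y z w) s) t"
  unfolding tensor_lift_def formal_lift_def complex_vector.scale_sum_right cscale_cscale
  by (subst sum.swap) (simp add: mult.commute)

lemma tensor_lift_add: "cbilinear h \<Longrightarrow> tensor_lift h (s + t) = tensor_lift h s + tensor_lift h t"
  and tensor_lift_scale: "cbilinear h \<Longrightarrow> tensor_lift h (c *\<^sub>C s) = c *\<^sub>C tensor_lift h s"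
  and tensor_lift_zero: "cbilinear h \<Longrightarrow> tensor_lift h 0 = 0"
  and tensor_lift_sum: "cbilinear h \<Longrightarrow> tensor_lift h (\<Sum>i\<in>I. r i) = (\<Sum>i\<in>I. tensor_lift h (r i))"
  by (simp_all add: clinear_tensor_lift clinear_add clinear_scale clinear_zero clinear_sum)

lemma tensor_lift_tensor_lift:
  "cbilinear h \<Longrightarrow> tensor_lift h (tensor_lift g s) = tensor_lift (\<lambda>x y. tensor_lift h (g x y)) s"
  by (rule clinear_tensor_lift_commute) (rule clinear_tensor_lift)

section \<open>Induction over finite sums and elementary tensors\<close>

lemma poly_mapping_induct_single [case_names single add]:
  fixes p :: "'k \<Rightarrow>\<^sub>0 'v::comm_monoid_add"
  assumes single: "\<And>k c. Q (Poly_Mapping.single k c)" and add: "\<And>p q. Q p \<Longrightarrow> Q q \<Longrightarrow> Q (p + q)"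
  shows "Q p"
proof -
  have zero: "Q 0" using single[of undefined 0] by simp
  have "Q (\<Sum>k\<in>K. Poly_Mapping.single k (c k))" if "finite K" for K and c :: "'k \<Rightarrow> 'v"
    using that by (induction K) (simp_all add: zero single add)
  moreover have "p = (\<Sum>k\<in>Poly_Mapping.keys p. Poly_Mapping.single k (Poly_Mapping.lookup p k))"
    by (rule poly_mapping_eqI) (auto simp: lookup_sum lookup_single when_def sum.delta in_keys_iff)
  ultimately show ?thesis by (metis finite_keys)
qed

lemma single_eq_cscale: "Poly_Mapping.single k c = c *\<^sub>C Poly_Mapping.single k 1" for c :: complex
  by (rule poly_mapping_eqI) (simp add: lookup_cscale lookup_single cscale_complex_def when_def)

text \<open>Scalars are absorbed into the left factor, so sums of pure tensors already exhaust the
  tensor product. Identities between additive maps on tensors then need a check on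
  \<open>x \<otimes> y\<close> only.\<close>

lemma tensor_induct [case_names tens add]:
  fixes s :: "('a::complex_vector, 'b::complex_vector) tensor"
  assumes tens: "\<And>x y. Q (x \<otimes> y)" and add: "\<And>s t. Q s \<Longrightarrow> Q t \<Longrightarrow> Q (s + t)"
  shows "Q s"
proof -
  have "Q (abs_tensor p)" for p
  proof (induction p rule: poly_mapping_induct_single)
    case (single k c)
    have "abs_tensor (Poly_Mapping.single k c) = c *\<^sub>C abs_tensor (Poly_Mapping.single k 1)"
      by (subst single_eq_cscale) (simp only: cscale_tensor.abs_eq)
    moreover have "abs_tensor (Poly_Mapping.single k 1) = fst k \<otimes> snd k"
      by (simp only: tens.abs_eq prod.collapse)
    ultimately have "abs_tensor (Poly_Mapping.single k c) = (c *\<^sub>C fst k) \<otimes> snd k"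
      by (simp only: tens_scale_left)
    then show ?case by (simp only: tens)
  next
    case (add p q)
    then have "Q (abs_tensor p + abs_tensor q)" by (rule assms(2))
    then show ?case by (simp only: plus_tensor.abs_eq)
  qed
  then show ?thesis by (metis Quotient3_abs_rep[OF Quotient3_tensor])
qed

lemma tensor_map_tens: "clinear g \<Longrightarrow> clinear h \<Longrightarrow> tensor_map g h (x \<otimes> y) = g x \<otimes> h y"
  unfolding tensor_map_def
  by (subst tensor_lift_tens) (simp_all add: cbilinear_iff clinear_iff tens_linear)

lemma clinear_tensor_map: "clinear g \<Longrightarrow> clinear h \<Longrightarrow> clinear (tensor_map g h)"
  unfolding tensor_map_def
  by (rule clinear_tensor_lift) (simp_all add: cbilinear_iff clinear_iff tens_linear)

lemma tensor_lift_map: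
  assumes "cbilinear h" "clinear F" "clinear G"
  shows "tensor_lift h (tensor_map F G s) = tensor_lift (\<lambda>x y. h (F x) (G y)) s"
  unfolding tensor_map_def using assms
  by (simp add: tensor_lift_tensor_lift tensor_lift_tens)

text \<open>In Sweedler notation: equality of the two ways to write \<open>h m\<^sub>(\<^sub>0\<^sub>) m\<^sub>(\<^sub>1\<^sub>) m\<^sub>(\<^sub>2\<^sub>)\<close>.\<close>

lemma tensor_lift_assoc:
  assumes eq: "tensor_assoc (tensor_map R id s) = tensor_map id D t"
    and R: "clinear R" and D: "clinear D"
    and h1: "\<And>x y. clinear (h x y)" and h2: "\<And>x z. clinear (\<lambda>y. h x y z)"
    and h3: "\<And>y z. clinear (\<lambda>x. h x y z)"
  shows "tensor_lift (\<lambda>a b. tensor_lift (\<lambda>c e. h c e b) (R a)) s =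
    tensor_lift (\<lambda>a b. tensor_lift (\<lambda>c e. h a c e) (D b)) t"
proof -
  note lin = cbilinear_iff clinear_iff[THEN iffD1, OF h1] clinear_iff[THEN iffD1, OF h2]
    clinear_iff[THEN iffD1, OF h3] clinear_iff[THEN iffD1, OF R] clinear_iff[THEN iffD1, OF D]
  have bil: "cbilinear (h a)" for a by (simp add: lin)
  have h_fun: "h (a + b) = (\<lambda>x y. h a x y + h b x y)" "h (c *\<^sub>C a) = (\<lambda>x y. c *\<^sub>C h a x y)" for a b c
    by (simp_all add: fun_eq_iff lin)
  \<comment> \<open>Currying turns the trilinear \<open>h\<close> into a bilinear map on the first
    factor and the tensor product of the other two. Its lift can then be applied to both sides of
    the assumed equation.\<close>
  have bil2: "cbilinear (\<lambda>a s. tensor_lift (h a) s)"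
    unfolding cbilinear_iff
    by (simp add: h_fun bil tensor_lift_add tensor_lift_scale tensor_lift_fun_add tensor_lift_fun_scale)
  have tri: "cbilinear (\<lambda>x y. x \<otimes> y \<otimes> z)" for z by (simp add: cbilinear_iff tens_linear)
  have tri2: "cbilinear (\<lambda>s z. tensor_lift (\<lambda>x y. x \<otimes> y \<otimes> z) s)"
    by (simp add: lin tri tensor_lift_add tensor_lift_scale tens_linear tensor_lift_fun_add tensor_lift_fun_scale)
  have m1: "cbilinear (\<lambda>a b. R a \<otimes> id b)" and m2: "cbilinear (\<lambda>a b. id a \<otimes> D b)"
    by (simp_all add: lin tens_linear)
  have L: "tensor_lift (\<lambda>a s. tensor_lift (h a) s) (tensor_assoc (tensor_map R id s)) =
    tensor_lift (\<lambda>a b. tensor_lift (\<lambda>c e. h c e b) (R a)) s"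
    unfolding tensor_assoc_def tensor_map_def
    by (simp add: tensor_lift_tensor_lift tensor_lift_tens bil bil2 tri tri2)
  have "tensor_lift (\<lambda>a s. tensor_lift (h a) s) (tensor_map id D t) =
    tensor_lift (\<lambda>a b. tensor_lift (\<lambda>c e. h a c e) (D b)) t"
    unfolding tensor_map_def by (simp add: tensor_lift_tensor_lift tensor_lift_tens bil2 bil)
  with L eq show ?thesis by simp
qed


lemma cscale_complex: "c *\<^sub>C z = c * z" for z :: complex
  by (simp add: cscale_complex_def)

lemma cbilinear_mult: "cbilinear ((*) :: 'a::complex_algebra \<Rightarrow> _)"
  by (simp add: cbilinear_iff cscale_mult_left cscale_mult_right distrib_left distrib_right)

text \<open>Rules that decide linearity of expressions built from multilinear operations: scalars are moved
  to the front and collected.\<close>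
lemmas lin_simps = clinear_iff cbilinear_iff cscale_add_right cscale_add_left cscale_cscale cscale_complex
  tens_linear tensor_lift_fun_add tensor_lift_fun_scale tensor_lift_add tensor_lift_scale
  cscale_mult_left cscale_mult_right distrib_left distrib_right
  complex_vector.scale_sum_right sum.distrib mult.assoc mult.left_commute

section \<open>Products of tensors\<close>

lemma tensor_mult_tens:
  "cbilinear m \<Longrightarrow> cbilinear n \<Longrightarrow> tensor_mult m n (x \<otimes> y) (z \<otimes> w) = m x z \<otimes> n y w"
  unfolding tensor_mult_def
  by (simp add: tensor_lift_tens lin_simps)

lemma cbilinear_tensor_mult:
  "cbilinear m \<Longrightarrow> cbilinear n \<Longrightarrow> cbilinear (tensor_mult m n)"
  unfolding tensor_mult_def
  by (simp add: lin_simps)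

text \<open>Four pairs of operations are kept apart so that one statement serves both algebra
  products and module actions: it is used for the product on the tensor square of the Hopf algebra,
  for the left action on forms tensor functions, and for the exterior algebra.\<close>

lemma tensor_mult_assoc:
  fixes m :: "'a::complex_vector \<Rightarrow> 'b::complex_vector \<Rightarrow> 'c::complex_vector"
    and n :: "'d::complex_vector \<Rightarrow> 'e::complex_vector \<Rightarrow> 'f::complex_vector"
  assumes "cbilinear m" "cbilinear n" "cbilinear m'" "cbilinear n'"
    "cbilinear k" "cbilinear l" "cbilinear k'" "cbilinear l'"
    and "\<And>x y z. m' (m x y) z = k' x (k y z)" "\<And>x y z. n' (n x y) z = l' x (l y z)"
  shows "tensor_mult m' n' (tensor_mult m n r s) t = tensor_mult k' l' r (tensor_mult k l s t)"
proof -
  note bil = assms(1-8)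
  note tm = cbilinear_tensor_mult[OF bil(1,2), unfolded cbilinear_iff]
    cbilinear_tensor_mult[OF bil(3,4), unfolded cbilinear_iff]
    cbilinear_tensor_mult[OF bil(5,6), unfolded cbilinear_iff]
    cbilinear_tensor_mult[OF bil(7,8), unfolded cbilinear_iff]
  show ?thesis
  proof (induction r rule: tensor_induct)
    case (tens x y)
    show ?case
    proof (induction s rule: tensor_induct)
      case (tens z w)
      show ?case
        by (induction t rule: tensor_induct) (simp_all add: tm tensor_mult_tens bil assms(9,10))
    qed (simp add: tm)
  qed (simp add: tm)
qed


section \<open>The calculus\<close>

text \<open>The simplifier should leave index ranges \<open>{1..N}\<close> and membership in them alone, since they
  appear in the premises of the rewrite rules below.\<close>
declare One_nat_def [simp del] atLeastAtMost_iff [simp del]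

section \<open>Sweedler calculus in coalgebras and Hopf algebras\<close>

context coalgebra
begin

lemmas comult_lin = clinear_add[OF comult_linear] clinear_scale[OF comult_linear]
lemmas counit_lin = clinear_add[OF counit_linear] clinear_scale[OF counit_linear, unfolded cscale_complex]

lemma sweedler_coassoc:
  assumes "\<And>x y. clinear (h x y)" "\<And>x z. clinear (\<lambda>y. h x y z)" "\<And>y z. clinear (\<lambda>x. h x y z)"
  shows "tensor_lift (\<lambda>a b. tensor_lift (\<lambda>c e. h c e b) (\<Delta> a)) (\<Delta> x) =
    tensor_lift (\<lambda>a b. tensor_lift (\<lambda>c e. h a c e) (\<Delta> b)) (\<Delta> x)"
  by (rule tensor_lift_assoc[OF coassoc comult_linear comult_linear]) (rule assms)+

lemma sweedler_counit_left: "clinear F \<Longrightarrow> tensor_lift (\<lambda>y z. \<epsilon> y *\<^sub>C F z) (\<Delta> x) = F x"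
  and sweedler_counit_right: "clinear F \<Longrightarrow> tensor_lift (\<lambda>y z. \<epsilon> z *\<^sub>C F y) (\<Delta> x) = F x"
proof -
  assume F: "clinear F"
  from clinear_tensor_lift_commute[OF F, of "\<lambda>y z. \<epsilon> y *\<^sub>C z" "\<Delta> x"]
  show "tensor_lift (\<lambda>y z. \<epsilon> y *\<^sub>C F z) (\<Delta> x) = F x"
    by (simp add: counit_left clinear_scale[OF F])
  from clinear_tensor_lift_commute[OF F, of "\<lambda>y z. \<epsilon> z *\<^sub>C y" "\<Delta> x"]
  show "tensor_lift (\<lambda>y z. \<epsilon> z *\<^sub>C F y) (\<Delta> x) = F x"
    by (simp add: counit_right clinear_scale[OF F])
qed

text \<open>The counit removes the leg that \<open>dual_action\<close> keeps. This recovers the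
  values of \<open>f i j\<close> and \<open>X i\<close> from the coefficient functions in expansions
  over the basis \<open>\<omega>\<close>.\<close>

lemma counit_dual_action: "clinear h \<Longrightarrow> \<epsilon> (dual_action \<Delta> h x) = h x"
  using sweedler_counit_left[of h x]
  by (simp add: dual_action_def clinear_tensor_lift_commute[OF counit_linear] counit_lin cscale_complex mult.commute)

lemma functional_dual_action:
  "clinear g \<Longrightarrow> g (dual_action \<Delta> h x) = convolution \<Delta> g h x"
  by (simp add: dual_action_def convolution_def clinear_tensor_lift_commute[of g] clinear_scale cscale_complex mult.commute)

lemma clinear_convolution: "clinear g \<Longrightarrow> clinear h \<Longrightarrow> clinear (convolution \<Delta> g h)"
  unfolding convolution_def by (simp add: lin_simps comult_lin)

end

context hopf_algebra
begin

lemmas antipode_lin = clinear_add[OF antipode_linear] clinear_scale[OF antipode_linear]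

lemma sweedler_antipode_left: "clinear F \<Longrightarrow> tensor_lift (\<lambda>y z. F (S y * z)) (\<Delta> x) = \<epsilon> x *\<^sub>C F 1"
  and sweedler_antipode_right: "clinear F \<Longrightarrow> tensor_lift (\<lambda>y z. F (y * S z)) (\<Delta> x) = \<epsilon> x *\<^sub>C F 1"
  using clinear_tensor_lift_commute[of F "\<lambda>y z. S y * z" "\<Delta> x"]
    clinear_tensor_lift_commute[of F "\<lambda>y z. y * S z" "\<Delta> x"]
  by (simp_all add: antipode_left antipode_right clinear_scale)

text \<open>Apply the multiplicative counit to the left antipode axiom; the counit axiom then
  collapses the second factor.\<close>

lemma counit_antipode: "\<epsilon> (S x) = \<epsilon> x"
proof -
  have "clinear (\<lambda>x. \<epsilon> (S x))" by (simp add: clinear_iff antipode_lin counit_lin cscale_complex)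
  from sweedler_counit_right[OF this, of x] sweedler_antipode_left[OF counit_linear, of x]
  show ?thesis by (simp add: counit_mult counit_one cscale_complex mult.commute)
qed

text \<open>Both sides are convolution inverses of \<open>\<Delta>\<close> in \<open>Hom(A, A \<otimes> A)\<close>.\<close>
lemma comult_antipode: "\<Delta> (S x) = tensor_lift (\<lambda>a b. S b \<otimes> S a) (\<Delta> x)"
proof -
  let ?m = "tensor_mult (*) (*) :: ('a, 'a) tensor \<Rightarrow> _"
  let ?G = "\<lambda>x. tensor_lift (\<lambda>a b. S b \<otimes> S a) (\<Delta> x)"
  note bil = cbilinear_mult[where 'a = 'a]
  note m_lin = cbilinear_tensor_mult[OF bil bil, unfolded cbilinear_iff]
  note lins = lin_simps m_lin comult_lin antipode_lin
  have m_assoc: "?m (?m r s) t = ?m r (?m s t)" for r s t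
    by (rule tensor_mult_assoc) (simp_all add: bil mult.assoc)
  have m_one: "?m (1 \<otimes> 1) s = s" "?m s (1 \<otimes> 1) = s" for s
    by (induction s rule: tensor_induct) (simp_all add: tensor_mult_tens bil m_lin)
  \<comment> \<open>In Sweedler indices the sum is x1 S(x4) \<otimes> x2 S(x3). Coassociativity
    brings x2 and x3 together, the right leg contracts to 1, and then the left leg does.\<close>
  have right_inv: "tensor_lift (\<lambda>a b. ?m (\<Delta> a) (?G b)) (\<Delta> x) = \<epsilon> x *\<^sub>C (1 \<otimes> 1)" for x
  proof -
    have "tensor_lift (\<lambda>a b. ?m (\<Delta> a) (?G b)) (\<Delta> x) =
      tensor_lift (\<lambda>a b. tensor_lift (\<lambda>p q. tensor_lift (\<lambda>c e. (p * S e) \<otimes> (q * S c)) (\<Delta> b)) (\<Delta> a)) (\<Delta> x)"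
      by (simp add: tensor_mult_def tensor_lift_tensor_lift tensor_lift_tens lins)
    also have "\<dots> = tensor_lift (\<lambda>p b. tensor_lift (\<lambda>q b'. tensor_lift (\<lambda>c e. (p * S e) \<otimes> (q * S c)) (\<Delta> b')) (\<Delta> b)) (\<Delta> x)"
      by (rule sweedler_coassoc) (simp_all add: lins)
    also have "\<dots> = tensor_lift (\<lambda>p b. tensor_lift (\<lambda>a e. tensor_lift (\<lambda>q c. (p * S e) \<otimes> (q * S c)) (\<Delta> a)) (\<Delta> b)) (\<Delta> x)"
      by (subst sweedler_coassoc) (simp_all add: lins)
    also have "\<dots> = tensor_lift (\<lambda>p b. (p * S b) \<otimes> 1) (\<Delta> x)"
      by (simp add: sweedler_antipode_right sweedler_counit_left lins)
    also have "\<dots> = \<epsilon> x *\<^sub>C (1 \<otimes> 1)"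
      by (simp add: sweedler_antipode_right[where F = "\<lambda>z. z \<otimes> _"] lins)
    finally show ?thesis .
  qed
  have left_inv: "tensor_lift (\<lambda>a b. ?m (\<Delta> (S a)) (\<Delta> b)) (\<Delta> x) = \<epsilon> x *\<^sub>C (1 \<otimes> 1)" for x
    by (simp add: sweedler_antipode_left comult_linear comult_one flip: comult_mult)
  \<comment> \<open>Uniqueness of inverses: insert the product of \<Delta> with \<open>?G\<close> on
    the right of \<Delta> after \<open>S\<close>, reassociate, and cancel by
    \<open>left_inv\<close>.\<close>
  have "\<Delta> (S x) = tensor_lift (\<lambda>a b. \<epsilon> b *\<^sub>C \<Delta> (S a)) (\<Delta> x)"
    by (simp add: sweedler_counit_right lins)
  also have "\<dots> = tensor_lift (\<lambda>a b. ?m (\<Delta> (S a)) (\<epsilon> b *\<^sub>C (1 \<otimes> 1))) (\<Delta> x)"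
    by (simp add: m_lin m_one)
  also have "\<dots> = tensor_lift (\<lambda>a b. tensor_lift (\<lambda>c e. ?m (\<Delta> (S a)) (?m (\<Delta> c) (?G e))) (\<Delta> b)) (\<Delta> x)"
    by (subst right_inv[symmetric])
      (simp add: clinear_tensor_lift_commute[where F = "?m _"] clinear_iff m_lin)
  also have "\<dots> = tensor_lift (\<lambda>a b. tensor_lift (\<lambda>c e. ?m (\<Delta> (S c)) (?m (\<Delta> e) (?G b))) (\<Delta> a)) (\<Delta> x)"
    by (rule sweedler_coassoc[symmetric]) (simp_all add: lins)
  also have "\<dots> = tensor_lift (\<lambda>a b. ?m (tensor_lift (\<lambda>c e. ?m (\<Delta> (S c)) (\<Delta> e)) (\<Delta> a)) (?G b)) (\<Delta> x)"
    by (simp add: clinear_tensor_lift_commute[where F = "\<lambda>s. ?m s _"] clinear_iff m_lin m_assoc)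
  also have "\<dots> = ?G x"
    unfolding left_inv by (simp add: m_lin m_one sweedler_counit_left lins)
  finally show ?thesis .
qed

end

section \<open>Left-invariant forms and covariance\<close>

context bicovariant_calculus
begin

lemmas d_lin = clinear_add[OF d_linear] clinear_scale[OF d_linear]
lemmas lact_lin = lact_bilinear[unfolded cbilinear_iff, THEN conjunct1]
  lact_bilinear[unfolded cbilinear_iff, THEN conjunct2, THEN conjunct1]
  lact_bilinear[unfolded cbilinear_iff, THEN conjunct2, THEN conjunct2]
lemmas ract_lin = ract_bilinear[unfolded cbilinear_iff, THEN conjunct1]
  ract_bilinear[unfolded cbilinear_iff, THEN conjunct2, THEN conjunct1]
  ract_bilinear[unfolded cbilinear_iff, THEN conjunct2, THEN conjunct2]

lemmas calculus_lin = lin_simps comult_lin antipode_lin d_lin lact_lin ract_lin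

lemma calculus_induct:
  assumes "clinear g" "clinear h" "\<And>x y. g (lact x (d y)) = h (lact x (d y))"
  shows "g \<gamma> = h \<gamma>"
proof -
  have "\<gamma> \<in> cspan {lact x (d y) | x y. True}" unfolding d_generates by simp
  then show ?thesis
  proof (induction rule: complex_vector.span_induct_alt)
    case base
    then show ?case using assms by (simp add: clinear_zero)
  next
    case (step c \<beta> \<gamma>)
    then show ?case using assms by (auto simp: clinear_add clinear_scale)
  qed
qed

text \<open>Woronowicz's quantum Maurer-Cartan form S(y1) d(y2). Its zeros inside the kernel of the
  counit are \<open>calculus_ideal\<close>.\<close>

definition cartan_form :: "'a \<Rightarrow> 'g"
  where "cartan_form y = tensor_lift (\<lambda>a b. lact (S a) (d b)) (\<Delta> y)"

text \<open>Since \<open>S\<close> reverses the coproduct, the left coaction gives S(y2) y3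
  \<otimes> S(y1) d(y4), and the first leg contracts to 1 by the antipode axiom.\<close>

lemma cartan_form_left_invariant: "cartan_form y \<in> left_invariant_forms"
proof -
  have dL: "\<Delta>\<^sub>L (lact (S a) (d b)) =
    tensor_lift (\<lambda>p q. tensor_lift (\<lambda>c e. (S q * c) \<otimes> lact (S p) (d e)) (\<Delta> b)) (\<Delta> a)" for a b
    by (simp add: left_covariant comult_antipode tensor_mult_def tensor_map_def tensor_lift_tensor_lift
        tensor_lift_tens calculus_lin)
  have "\<Delta>\<^sub>L (cartan_form y) = tensor_lift (\<lambda>a b. tensor_lift (\<lambda>p q.
      tensor_lift (\<lambda>c e. (S q * c) \<otimes> lact (S p) (d e)) (\<Delta> b)) (\<Delta> a)) (\<Delta> y)"
    by (simp add: cartan_form_def clinear_tensor_lift_commute[OF left.left_coaction_linear] dL)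
  also have "\<dots> = tensor_lift (\<lambda>p b. tensor_lift (\<lambda>q b'.
      tensor_lift (\<lambda>c e. (S q * c) \<otimes> lact (S p) (d e)) (\<Delta> b')) (\<Delta> b)) (\<Delta> y)"
    by (rule sweedler_coassoc) (simp_all add: calculus_lin)
  also have "\<dots> = tensor_lift (\<lambda>p b. tensor_lift (\<lambda>a e.
      tensor_lift (\<lambda>q c. (S q * c) \<otimes> lact (S p) (d e)) (\<Delta> a)) (\<Delta> b)) (\<Delta> y)"
    by (subst sweedler_coassoc) (simp_all add: calculus_lin)
  also have "\<dots> = tensor_lift (\<lambda>p b. 1 \<otimes> lact (S p) (d b)) (\<Delta> y)"
    by (simp add: sweedler_antipode_left[where F = "\<lambda>z. z \<otimes> _"] sweedler_counit_left calculus_lin)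
  also have "\<dots> = 1 \<otimes> cartan_form y"
    unfolding cartan_form_def
    by (rule clinear_tensor_lift_commute[symmetric]) (simp add: calculus_lin)
  finally show ?thesis by (simp add: left_invariant_forms_def)
qed

text \<open>The product y1 S(y2) contracts in y1 S(y2) d(y3). This writes differentials as
  combinations of left-invariant forms with coefficients in \<open>A\<close>.\<close>

lemma d_cartan_form: "d y = tensor_lift (\<lambda>a b. lact a (cartan_form b)) (\<Delta> y)"
proof -
  have "tensor_lift (\<lambda>a b. lact a (cartan_form b)) (\<Delta> y) =
    tensor_lift (\<lambda>a b. tensor_lift (\<lambda>c e. lact (a * S c) (d e)) (\<Delta> b)) (\<Delta> y)"
    by (simp add: cartan_form_def lact_mult clinear_tensor_lift_commute[where F = "lact _"] clinear_iff lact_lin)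
  also have "\<dots> = tensor_lift (\<lambda>a b. tensor_lift (\<lambda>c e. lact (c * S e) (d b)) (\<Delta> a)) (\<Delta> y)"
    by (rule sweedler_coassoc[symmetric]) (simp_all add: calculus_lin)
  also have "\<dots> = d y"
    by (simp add: sweedler_antipode_right[where F = "\<lambda>x. lact x _"] sweedler_counit_left calculus_lin lact_one)
  finally show ?thesis by simp
qed

text \<open>Covariance is given for forms \<open>lact x (d y)\<close>. These span, and
  multiplicativity of \<Delta> together with associativity of \<open>tensor_mult\<close> handles a
  further left factor.\<close>

lemma right_coaction_lact: "\<Delta>\<^sub>R (lact x \<gamma>) = tensor_mult lact (*) (\<Delta> x) (\<Delta>\<^sub>R \<gamma>)"
proof -
  note tm = cbilinear_tensor_mult[OF lact_bilinear cbilinear_mult, unfolded cbilinear_iff]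
  note tm' = cbilinear_tensor_mult[OF cbilinear_mult cbilinear_mult, unfolded cbilinear_iff]
  note R = clinear_iff[THEN iffD1, OF right.right_coaction_linear]
  show ?thesis
  proof (rule calculus_induct[where \<gamma> = \<gamma>])
    show "clinear (\<lambda>\<gamma>. \<Delta>\<^sub>R (lact x \<gamma>))" "clinear (\<lambda>\<gamma>. tensor_mult lact (*) (\<Delta> x) (\<Delta>\<^sub>R \<gamma>))"
      by (simp_all add: clinear_iff lact_lin R tm)
    show "\<Delta>\<^sub>R (lact x (lact y (d z))) = tensor_mult lact (*) (\<Delta> x) (\<Delta>\<^sub>R (lact y (d z)))" for y z
      unfolding right_covariant lact_mult[symmetric] comult_mult
      by (rule tensor_mult_assoc) (simp_all add: cbilinear_mult lact_bilinear lact_mult mult.assoc)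
  qed
qed

lemma right_coaction_d: "\<Delta>\<^sub>R (d y) = tensor_map d id (\<Delta> y)"
proof -
  have bil: "cbilinear lact" "cbilinear ((*) :: 'a \<Rightarrow> _)"
    by (rule lact_bilinear cbilinear_mult)+
  note tm = cbilinear_tensor_mult[OF bil, unfolded cbilinear_iff]
  have "tensor_mult lact (*) (1 \<otimes> 1) s = s" for s :: "('g, 'a) tensor"
    by (induction s rule: tensor_induct) (simp_all add: tensor_mult_tens bil tm lact_one)
  then show ?thesis using right_covariant[of 1 y] by (simp add: lact_one comult_one)
qed

end


lemma sum_fun_apply: "(\<Sum>i\<in>I. h i) x = (\<Sum>i\<in>I. h i x)"
  by (induction I rule: infinite_finite_induct) simp_all

lemma sum_indicator: "(\<Sum>j=1..N. (if i = j then 1 else 0) *\<^sub>C g j) = g i"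
  and sum_indicator': "(\<Sum>j=1..N. (if j = i then 1 else 0) *\<^sub>C g j) = g i"
  if "i \<in> {1..N}" for g :: "nat \<Rightarrow> 'v::complex_vector"
  using that
  by (simp_all add: if_distrib[where f = "\<lambda>c. c *\<^sub>C _"] cscale_one complex_vector.scale_zero_left
      cong: if_cong)

section \<open>Coproducts and quadratic relations of the structure functionals\<close>

context based_calculus
begin

lemmas basis_sum = sum_indicator sum_indicator'
  sum_indicator[where 'v = complex, unfolded cscale_complex] sum_indicator'[where 'v = complex, unfolded cscale_complex]

lemma f_linear: "i \<in> {1..N} \<Longrightarrow> j \<in> {1..N} \<Longrightarrow> clinear (f i j)"
  using f_dual by (simp add: finite_dual_def)

lemma X_linear: "i \<in> {1..N} \<Longrightarrow> clinear (X i)"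
  and X_one: "i \<in> {1..N} \<Longrightarrow> X i 1 = 0"
  using X_tangent by (simp_all add: tangent_space_def)

text \<open>On generators this is multiplicativity of the counit. With the dual bases it makes the
  pairing with \<open>X i\<close> the counit of the coefficient of
  \<open>\<omega> i\<close>.\<close>

lemma pairing_lact: 
  assumes "Y \<in> tangent_space"
  shows "pairing Y (lact a \<gamma>) = \<epsilon> a * pairing Y \<gamma>"
proof (rule calculus_induct[where \<gamma> = \<gamma>])
  show "clinear (\<lambda>\<gamma>. pairing Y (lact a \<gamma>))" "clinear (\<lambda>\<gamma>. \<epsilon> a * pairing Y \<gamma>)"
    using clinear_add[OF pairing_linear[OF assms]] clinear_scale[OF pairing_linear[OF assms]]
    by (simp_all add: calculus_lin)
  show "pairing Y (lact a (lact x (d y))) = \<epsilon> a * pairing Y (lact x (d y))" for x y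
    by (simp add: pairing_eq[OF assms] counit_mult flip: lact_mult)
qed

lemma pairing_X_lact_\<omega>:
  "i \<in> {1..N} \<Longrightarrow> j \<in> {1..N} \<Longrightarrow> pairing (X i) (lact a (\<omega> j)) = (if i = j then \<epsilon> a else 0)"
  by (simp add: pairing_lact X_tangent X_dual_basis)

lemma pairing_X_d: "i \<in> {1..N} \<Longrightarrow> pairing (X i) (d y) = X i y"
  using pairing_eq[OF X_tangent, of i 1 y] by (simp add: lact_one counit_one)

text \<open>Left invariance supplies some constant coefficients. Pairing with \<open>X j\<close>
  identifies them, as it sends S(y1) d(y2) to \<epsilon>(S(y1)) \<open>X j\<close> (y2), which sums
  to the value of \<open>X j\<close> at \<open>y\<close>.\<close>

lemma cartan_form_expand: "cartan_form y = (\<Sum>i=1..N. X i y *\<^sub>C \<omega> i)"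
proof -
  have "cartan_form y \<in> cspan (\<omega> ` {1..N})"
    using cartan_form_left_invariant \<omega>_span by simp
  then obtain u where "cartan_form y = (\<Sum>v\<in>\<omega> ` {1..N}. u v *\<^sub>C v)"
    by (auto simp: complex_vector.span_finite)
  then have c: "cartan_form y = (\<Sum>i=1..N. u (\<omega> i) *\<^sub>C \<omega> i)"
    by (simp only: sum.reindex[OF \<omega>_inj] o_def)
  have "u (\<omega> j) = X j y" if j: "j \<in> {1..N}" for j
  proof -
    have lin: "clinear (pairing (X j))" by (simp add: j pairing_linear X_tangent)
    have "pairing (X j) (cartan_form y) = (\<Sum>i=1..N. u (\<omega> i) * (if j = i then 1 else 0))"
      unfolding c by (simp add: clinear_sum[OF lin] clinear_scale[OF lin] X_dual_basis j cscale_complex)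
    also have "\<dots> = u (\<omega> j)" using basis_sum(3)[OF j, of "\<lambda>i. u (\<omega> i)"] by (simp add: mult.commute)
    finally have "u (\<omega> j) = pairing (X j) (cartan_form y)" ..
    also have "\<dots> = tensor_lift (\<lambda>a b. \<epsilon> a *\<^sub>C X j b) (\<Delta> y)"
      by (simp add: cartan_form_def clinear_tensor_lift_commute[OF lin] pairing_lact X_tangent j
          counit_antipode pairing_X_d cscale_complex)
    also have "\<dots> = X j y" by (rule sweedler_counit_left) (rule X_linear[OF j])
    finally show ?thesis .
  qed
  with c show ?thesis by simp
qed

text \<open>Substitute the expansion of the Maurer-Cartan form into \<open>d_cartan_form\<close>;
  the leftover sum over the coproduct is \<open>dual_action\<close>.\<close>

lemma d_expand: "d y = (\<Sum>i=1..N. lact (dual_action \<Delta> (X i) y) (\<omega> i))"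
proof -
  have "d y = tensor_lift (\<lambda>a b. \<Sum>i=1..N. lact (X i b *\<^sub>C a) (\<omega> i)) (\<Delta> y)"
    unfolding d_cartan_form[of y] cartan_form_expand
    by (simp add: clinear_sum[where F = "lact _"] clinear_iff lact_lin)
  also have "\<dots> = (\<Sum>i=1..N. lact (dual_action \<Delta> (X i) y) (\<omega> i))"
    by (simp add: tensor_lift_fun_sum dual_action_def
        clinear_tensor_lift_commute[where F = "\<lambda>a. lact a _"] clinear_iff lact_lin)
  finally show ?thesis .
qed

text \<open>The matrix coproduct of \<open>f\<close> expresses associativity of the right action:
  move \<open>x\<close> and then \<open>y\<close> past \<open>\<omega> i\<close>, and read the
  coefficient of \<open>\<omega> j\<close> with the pairing.\<close>

lemma f_mult:
  assumes i: "i \<in> {1..N}" and j: "j \<in> {1..N}"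
  shows "f i j (x * y) = (\<Sum>k=1..N. f i k x * f k j y)"
proof -
  note lin = clinear_sum[OF pairing_linear[OF X_tangent[OF j]]]
  have pair: "pairing (X j) (ract (\<omega> i) z) = f i j z" if "i \<in> {1..N}" for i z
    unfolding f_commutation[OF that] lin
    using j that basis_sum(3)[OF j, of "\<lambda>k. f i k z"]
    by (simp add: pairing_X_lact_\<omega> counit_dual_action f_linear)
  have "f i j (x * y) = pairing (X j) (ract (ract (\<omega> i) x) y)"
    by (simp add: pair[OF i] flip: ract_mult)
  also have "\<dots> = (\<Sum>k=1..N. pairing (X j) (lact (dual_action \<Delta> (f i k) x) (ract (\<omega> k) y)))"
    unfolding f_commutation[OF i]
    by (simp add: lin lact_ract clinear_sum[where F = "\<lambda>\<gamma>. ract \<gamma> y"] clinear_iff ract_lin)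
  also have "\<dots> = (\<Sum>k=1..N. f i k x * f k j y)"
    using i j by (simp add: pairing_lact X_tangent counit_dual_action f_linear pair)
  finally show ?thesis .
qed

lemma f_one:
  assumes i: "i \<in> {1..N}" and j: "j \<in> {1..N}"
  shows "f i j 1 = (if i = j then 1 else 0)"
proof -
  note lin = clinear_sum[OF pairing_linear[OF X_tangent[OF j]]]
  have "f i j 1 = pairing (X j) (ract (\<omega> i) 1)"
    unfolding f_commutation[OF i] lin
    using i j basis_sum(3)[OF j, of "\<lambda>k. f i k 1"]
    by (simp add: pairing_X_lact_\<omega> counit_dual_action f_linear)
  then show ?thesis using i j by (simp add: ract_one X_dual_basis eq_commute[of j i])
qed

text \<open>This is the Leibniz rule of \<open>d\<close> paired with \<open>X i\<close>. In the term
  with \<open>d x\<close> on the left, \<open>x\<close> is differentiated by \<open>d_expand\<close>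
  and \<open>y\<close> is moved past the basis forms.\<close>

lemma X_mult:
  assumes i: "i \<in> {1..N}"
  shows "X i (x * y) = \<epsilon> x * X i y + (\<Sum>j=1..N. X j x * f j i y)"
proof -
  note lin = pairing_linear[OF X_tangent[OF i]]
  have pair: "pairing (X i) (ract (\<omega> j) y) = f j i y" if "j \<in> {1..N}" for j
    unfolding f_commutation[OF that] clinear_sum[OF lin]
    using i that basis_sum(3)[OF i, of "\<lambda>k. f j k y"]
    by (simp add: pairing_X_lact_\<omega> counit_dual_action f_linear)
  have "X i (x * y) = pairing (X i) (ract (d x) y) + \<epsilon> x * X i y"
    using pairing_X_d[OF i, of "x * y"]
    by (simp add: d_leibniz clinear_add[OF lin] pairing_lact X_tangent i pairing_X_d)
  also have "pairing (X i) (ract (d x) y) =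
      (\<Sum>j=1..N. pairing (X i) (lact (dual_action \<Delta> (X j) x) (ract (\<omega> j) y)))"
    unfolding d_expand[of x]
    by (simp add: clinear_sum[OF lin] lact_ract clinear_sum[where F = "\<lambda>\<gamma>. ract \<gamma> y"] clinear_iff ract_lin)
  also have "\<dots> = (\<Sum>j=1..N. X j x * f j i y)"
    using i by (simp add: pairing_lact X_tangent counit_dual_action X_linear pair)
  finally show ?thesis by simp
qed

text \<open>Coefficients of \<open>\<omega>\<^sub>l\<close> in \<open>\<^sub>\<Gamma>\<Delta>(d x) = d x\<^sub>(\<^sub>1\<^sub>) \<otimes> x\<^sub>(\<^sub>2\<^sub>)\<close>, both sides expanded in the basis.\<close>
lemma right_covariance_X:
  assumes l: "l \<in> {1..N}"
  shows "tensor_lift (\<lambda>a b. X l a *\<^sub>C b) (\<Delta> x) = (\<Sum>i=1..N. dual_action \<Delta> (X i) x * J l i)"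
proof -
  let ?p = "tensor_lift (\<lambda>\<gamma> a. pairing (X l) \<gamma> *\<^sub>C a)"
  note lin = pairing_linear[OF X_tangent[OF l]]
  have bil: "cbilinear (\<lambda>\<gamma> a. pairing (X l) \<gamma> *\<^sub>C a)"
    by (simp add: calculus_lin clinear_add[OF lin] clinear_scale[OF lin])
  have tm: "clinear (tensor_mult lact (*) s)" for s :: "('a, 'a) tensor"
    by (rule cbilinear_tensor_mult[OF lact_bilinear cbilinear_mult, unfolded cbilinear_def, THEN conjunct1, rule_format])
  have p_lin: "clinear ?p" by (rule clinear_tensor_lift[OF bil])
  \<comment> \<open>Only the first leg of the coproduct of \<open>a\<close> meets the pairing, which
    replaces it by its counit, so the counit axiom restores \<open>a\<close> itself.\<close>
  have step: "?p (tensor_mult lact (*) (\<Delta> a) (\<omega> j \<otimes> b)) = (if l = j then 1 else 0) *\<^sub>C (a * b)"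
    if "j \<in> {1..N}" for a b j
  proof -
    have "?p (tensor_mult lact (*) (\<Delta> a) (\<omega> j \<otimes> b)) =
        tensor_lift (\<lambda>x y. pairing (X l) (lact x (\<omega> j)) *\<^sub>C (y * b)) (\<Delta> a)"
      by (simp add: tensor_mult_def tensor_lift_tensor_lift tensor_lift_tens bil calculus_lin)
    also have "\<dots> = tensor_lift (\<lambda>x y. (if l = j then \<epsilon> x else 0) *\<^sub>C (y * b)) (\<Delta> a)"
      by (simp only: pairing_X_lact_\<omega>[OF l that])
    also have "\<dots> = (if l = j then 1 else 0) *\<^sub>C (a * b)"
      by (cases "l = j") (simp_all add: sweedler_counit_left clinear_iff distrib_right cscale_mult_left
          cscale_one complex_vector.scale_zero_left tensor_lift_fun_zero)
    finally show ?thesis .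
  qed
  have "?p (\<Delta>\<^sub>R (d x)) = (\<Sum>i=1..N. \<Sum>j=1..N.
      ?p (tensor_mult lact (*) (\<Delta> (dual_action \<Delta> (X i) x)) (\<omega> j \<otimes> J j i)))"
    unfolding d_expand[of x]
    by (simp add: clinear_sum[OF right.right_coaction_linear] right_coaction_lact J_coaction
        clinear_sum[OF tm] clinear_sum[OF p_lin])
  also have "\<dots> = (\<Sum>i=1..N. dual_action \<Delta> (X i) x * J l i)"
    using l by (simp add: step basis_sum)
  finally show ?thesis
    by (simp add: right_coaction_d tensor_lift_map[OF bil d_linear] pairing_X_d l clinear_iff)
qed

text \<open>Evaluate \<open>f k l\<close> on \<open>right_covariance_X\<close>.
  \<open>f_mult\<close> splits the product with \<open>J j i\<close>, and the factor
  \<open>f p l (J j i)\<close> is a braiding coefficient by definition.\<close>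

lemma X_f_relation:
  assumes j: "j \<in> {1..N}" and k: "k \<in> {1..N}" and l: "l \<in> {1..N}"
  shows "convolution \<Delta> (X j) (f k l) =
    (\<Sum>p=1..N. \<Sum>i=1..N. braid j l p i *\<^sub>C convolution \<Delta> (f k p) (X i))"
proof
  fix x
  note lin = f_linear[OF k l]
  have "convolution \<Delta> (X j) (f k l) x = f k l (tensor_lift (\<lambda>a b. X j a *\<^sub>C b) (\<Delta> x))"
    by (simp add: convolution_def clinear_tensor_lift_commute[OF lin] clinear_scale[OF lin] cscale_complex)
  also have "\<dots> = (\<Sum>i=1..N. \<Sum>p=1..N. f k p (dual_action \<Delta> (X i) x) * f p l (J j i))"
    unfolding right_covariance_X[OF j] by (simp add: clinear_sum[OF lin] f_mult k l)
  also have "\<dots> = (\<Sum>p=1..N. \<Sum>i=1..N. braid j l p i * convolution \<Delta> (f k p) (X i) x)"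
    by (subst sum.swap) (simp add: functional_dual_action f_linear k braid_def mult.commute)
  finally show "convolution \<Delta> (X j) (f k l) x =
      (\<Sum>p=1..N. \<Sum>i=1..N. braid j l p i *\<^sub>C convolution \<Delta> (f k p) (X i)) x"
    by (simp add: sum_fun_apply cscale_fun_def cscale_complex)
qed

text \<open>The same evaluation with \<open>X l\<close>. Of the two terms of \<open>X_mult\<close>,
  the one with the counit yields the structure constants and the other the braiding.\<close>

lemma X_X_relation:
  assumes j: "j \<in> {1..N}" and l: "l \<in> {1..N}"
  shows "convolution \<Delta> (X j) (X l) =
    (\<Sum>p=1..N. \<Sum>i=1..N. braid j l p i *\<^sub>C convolution \<Delta> (X p) (X i)) + (\<Sum>i=1..N. struct i j l *\<^sub>C X i)"
proof
  fix x
  note lin = X_linear[OF l]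
  have "convolution \<Delta> (X j) (X l) x = X l (tensor_lift (\<lambda>a b. X j a *\<^sub>C b) (\<Delta> x))"
    by (simp add: convolution_def clinear_tensor_lift_commute[OF lin] clinear_scale[OF lin] cscale_complex)
  also have "\<dots> = (\<Sum>i=1..N. X i x * X l (J j i)) +
      (\<Sum>i=1..N. \<Sum>p=1..N. X p (dual_action \<Delta> (X i) x) * f p l (J j i))"
    unfolding right_covariance_X[OF j]
    by (simp add: clinear_sum[OF lin] X_mult l sum.distrib counit_dual_action X_linear)
  also have "\<dots> = (\<Sum>i=1..N. struct i j l * X i x) +
      (\<Sum>p=1..N. \<Sum>i=1..N. braid j l p i * convolution \<Delta> (X p) (X i) x)"
    by (subst sum.swap) (simp add: functional_dual_action X_linear braid_def struct_def mult.commute)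
  finally show "convolution \<Delta> (X j) (X l) x =
      ((\<Sum>p=1..N. \<Sum>i=1..N. braid j l p i *\<^sub>C convolution \<Delta> (X p) (X i)) + (\<Sum>i=1..N. struct i j l *\<^sub>C X i)) x"
    by (simp add: sum_fun_apply cscale_fun_def cscale_complex)
qed

text \<open>As far as the \<open>X i\<close> are concerned, a form \<open>lact x (d y)\<close> acts
  like the element \<open>\<epsilon> x *\<^sub>C y\<close>, so every form can be replaced by an
  element of \<open>A\<close>. Applied to the basis forms this makes the independence of the
  \<open>X i\<close> usable by evaluation at points.\<close>

lemma dual_points: "\<exists>z. \<forall>i\<in>{1..N}. \<forall>j\<in>{1..N}. X i (z j) = (if i = j then 1 else 0)"
proof -
  have "\<exists>z. \<forall>i\<in>{1..N}. X i z = pairing (X i) \<gamma>" for \<gamma>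
  proof -
    have "\<gamma> \<in> cspan {lact x (d y) | x y. True}" unfolding d_generates by simp
    then show ?thesis
    proof (induction rule: complex_vector.span_induct_alt)
      case base
      then show ?case by (intro exI[of _ 0]) (simp add: clinear_zero X_linear pairing_linear X_tangent)
    next
      case (step c \<beta> \<gamma>)
      then obtain x y z where \<beta>: "\<beta> = lact x (d y)" and z: "\<forall>i\<in>{1..N}. X i z = pairing (X i) \<gamma>"
        by auto
      then show ?case
        by (intro exI[of _ "c *\<^sub>C \<epsilon> x *\<^sub>C y + z"])
          (auto simp: clinear_add clinear_scale X_linear pairing_linear X_tangent pairing_eq cscale_complex)
    qed
  qed
  then have "\<forall>j. \<exists>z. \<forall>i\<in>{1..N}. X i z = pairing (X i) (\<omega> j)" by blast
  then obtain z where "\<forall>j. \<forall>i\<in>{1..N}. X i (z j) = pairing (X i) (\<omega> j)" by metis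
  then show ?thesis by (intro exI[of _ z]) (simp add: X_dual_basis)
qed

end


section \<open>Operators on the exterior algebra\<close>

context right_comodule
begin

lemmas coaction_lin = clinear_add[OF right_coaction_linear] clinear_scale[OF right_coaction_linear]

lemma clinear_coaction_dual_action: "clinear h \<Longrightarrow> clinear (dual_action \<rho> h)"
  unfolding dual_action_def by (simp add: lin_simps coaction_lin)

lemma dual_action_add: "dual_action \<rho> (g + h) m = dual_action \<rho> g m + dual_action \<rho> h m"
  by (simp only: dual_action_def plus_fun_apply cscale_add_left tensor_lift_fun_add)

lemma dual_action_scale: "dual_action \<rho> (c *\<^sub>C h) m = c *\<^sub>C dual_action \<rho> h m"
proof -
  have "(c *\<^sub>C h) x *\<^sub>C n = c *\<^sub>C h x *\<^sub>C n" for x and n :: 'm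
    by (simp only: cscale_fun_def cscale_complex cscale_cscale)
  then show ?thesis by (simp only: dual_action_def tensor_lift_fun_scale)
qed

lemma dual_action_sum: "dual_action \<rho> (\<Sum>i\<in>I. h i) m = (\<Sum>i\<in>I. dual_action \<rho> (h i) m)"
  by (rule clinear_sum[where F = "\<lambda>h. dual_action \<rho> h m"]) (simp add: clinear_iff dual_action_add dual_action_scale)

lemma dual_action_counit: "dual_action \<rho> \<epsilon> m = m"
  by (simp add: dual_action_def right_coaction_counit)

text \<open>Coassociativity of the coaction turns splitting the algebra leg into coacting twice.
  Products in the dual thus become compositions in the same order.\<close>

lemma dual_action_convolution:
  assumes g: "clinear g" and h: "clinear h"
  shows "dual_action \<rho> (convolution \<Delta> g h) m = dual_action \<rho> g (dual_action \<rho> h m)"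
proof -
  note gh = clinear_add[OF g] clinear_scale[OF g] clinear_add[OF h] clinear_scale[OF h]
  have "dual_action \<rho> (convolution \<Delta> g h) m =
    tensor_lift (\<lambda>n x. tensor_lift (\<lambda>y z. (g y * h z) *\<^sub>C n) (\<Delta> x)) (\<rho> m)"
    by (simp add: dual_action_def convolution_def clinear_tensor_lift_commute[where F = "\<lambda>c. c *\<^sub>C _"]
        clinear_iff cscale_add_left cscale_cscale cscale_complex)
  also have "\<dots> = tensor_lift (\<lambda>n z. tensor_lift (\<lambda>k y. (g y * h z) *\<^sub>C k) (\<rho> n)) (\<rho> m)"
    by (rule tensor_lift_assoc[OF right_coaction_coassoc right_coaction_linear comult_linear, symmetric])
      (simp_all add: lin_simps gh)
  also have "\<dots> = tensor_lift (\<lambda>n z. h z *\<^sub>C dual_action \<rho> g n) (\<rho> m)"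
    by (simp add: dual_action_def cscale_cscale mult.commute flip: tensor_lift_fun_scale)
  also have "\<dots> = dual_action \<rho> g (tensor_lift (\<lambda>n z. h z *\<^sub>C n) (\<rho> m))"
    using clinear_coaction_dual_action[OF g] by (simp only: clinear_tensor_lift_commute[of "dual_action \<rho> g"] clinear_scale)
  also have "\<dots> = dual_action \<rho> g (dual_action \<rho> h m)"
    by (simp only: dual_action_def[of _ h])
  finally show ?thesis .
qed

end

lemma cspan_induct [consumes 1, case_names zero step]:
  assumes "x \<in> cspan B" "Q 0" "\<And>c b y. b \<in> B \<Longrightarrow> Q y \<Longrightarrow> Q (c *\<^sub>C b + y)"
  shows "Q x"
  using assms(1) by (rule complex_vector.span_induct_alt) (auto intro: assms)

lemma sign_mult: "(- 1) ^ n * x = (- 1) ^ n *\<^sub>C x" for x :: "'c::complex_algebra"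
proof (induction n)
  case (Suc n)
  have "(- 1) ^ Suc n * x = - ((- 1) ^ n *\<^sub>C x)" by (simp add: Suc)
  then show ?case by (simp add: complex_vector.scale_minus_left)
qed (simp add: cscale_one)

section \<open>Degrees of forms and spanning by iterated differentials\<close>

context exterior_algebra
begin

sublocale exterior: right_comodule \<Delta> \<epsilon> \<rho>
  by (rule \<rho>_comodule)

abbreviation fn :: "'a \<Rightarrow> 'w"
  where "fn x \<equiv> \<pi> (\<iota>\<^sub>A x)"

abbreviation one_form :: "'g \<Rightarrow> 'w"
  where "one_form \<gamma> \<equiv> \<pi> (\<iota>\<^sub>\<Gamma> \<gamma>)"

abbreviation forms :: "nat \<Rightarrow> 'w set"
  where "forms \<equiv> form_degree (\<pi> \<circ> \<iota>\<^sub>A) (\<pi> \<circ> \<iota>\<^sub>\<Gamma>)"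

abbreviation act :: "('a \<Rightarrow> complex) \<Rightarrow> 'w \<Rightarrow> 'w"
  where "act \<equiv> dual_action \<rho>"

lemma clinear_fn: "clinear fn" and clinear_one_form: "clinear one_form"
  using \<pi>_linear \<iota>A_linear \<iota>\<Gamma>_linear by (simp_all add: clinear_iff)

lemma fn_one: "fn 1 = 1" and fn_mult: "fn (x * y) = fn x * fn y"
  and one_form_lact: "one_form (lact x \<gamma>) = fn x * one_form \<gamma>"
  and one_form_ract: "one_form (ract \<gamma> x) = one_form \<gamma> * fn x"
  by (simp_all add: \<iota>A_one \<pi>_one \<iota>A_mult \<pi>_mult \<iota>\<Gamma>_lact \<iota>\<Gamma>_ract)

lemmas exterior_lin = lin_simps comult_lin exterior.coaction_lin
  clinear_add[OF clinear_fn] clinear_scale[OF clinear_fn]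
  clinear_add[OF clinear_one_form] clinear_scale[OF clinear_one_form]
  clinear_add[OF dw_linear] clinear_scale[OF dw_linear]

lemma forms_subspace: "csubspace (forms n)"
proof (cases n)
  case 0
  have "complex_vector.subspace (range fn)"
  proof (rule complex_vector.subspaceI)
    show "0 \<in> range fn" using clinear_zero[OF clinear_fn] by (metis rangeI)
  qed (auto simp flip: clinear_add[OF clinear_fn] clinear_scale[OF clinear_fn])
  then show ?thesis using 0 by (simp add: o_def)
qed (simp add: complex_vector.subspace_span)

lemma forms_add: "\<alpha> \<in> forms n \<Longrightarrow> \<beta> \<in> forms n \<Longrightarrow> \<alpha> + \<beta> \<in> forms n"
  and forms_scale: "\<alpha> \<in> forms n \<Longrightarrow> c *\<^sub>C \<alpha> \<in> forms n"
  and forms_zero: "0 \<in> forms n"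
  using forms_subspace[of n]
  by (auto simp: complex_vector.subspace_add complex_vector.subspace_scale complex_vector.subspace_0)

lemma fn_in_forms: "fn x \<in> forms 0"
  by auto

lemma forms_SucI: "\<alpha> \<in> forms n \<Longrightarrow> \<alpha> * one_form \<gamma> \<in> forms (Suc n)"
  by (auto intro!: complex_vector.span_base)

lemma forms_Suc_induct [consumes 1, case_names zero step]:
  assumes "\<alpha> \<in> forms (Suc n)" "Q 0"
    "\<And>c \<beta> \<gamma> \<alpha>. \<beta> \<in> forms n \<Longrightarrow> Q \<alpha> \<Longrightarrow> Q (c *\<^sub>C (\<beta> * one_form \<gamma>) + \<alpha>)"
  shows "Q \<alpha>"
  using assms(1) unfolding form_degree.simps
  by (induction rule: cspan_induct) (auto intro: assms)

text \<open>By induction on the degree of the right factor. A function on the right is absorbed into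
  the last one-form through the right module structure.\<close>

lemma forms_mult: "\<alpha> \<in> forms m \<Longrightarrow> \<beta> \<in> forms n \<Longrightarrow> \<alpha> * \<beta> \<in> forms (m + n)"
proof (induction n arbitrary: \<beta>)
  case 0
  then obtain y where \<beta>: "\<beta> = fn y" by auto
  show ?case
  proof (cases m)
    case (Suc k)
    from 0(1)[unfolded Suc] show ?thesis unfolding Suc \<beta>
    proof (induction rule: forms_Suc_induct)
      case (step c \<beta> \<gamma> \<alpha>)
      have "\<beta> * one_form \<gamma> * fn y \<in> forms (Suc k)"
        using forms_SucI[OF step(1), of "ract \<gamma> y"] by (simp only: one_form_ract mult.assoc)
      with step(2) show ?case
        by (auto simp only: distrib_right cscale_mult_left add_0_right intro: forms_add forms_scale)
    qed (simp only: mult_zero_left forms_zero)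
  qed (use 0 \<beta> in \<open>auto simp flip: fn_mult\<close>)
next
  case (Suc n)
  from Suc.prems(2) show ?case
  proof (induction rule: forms_Suc_induct)
    case (step c \<beta> \<gamma> \<beta>')
    then have "\<alpha> * \<beta> * one_form \<gamma> \<in> forms (Suc (m + n))"
      by (intro forms_SucI Suc.IH Suc.prems)
    with step show ?case
      by (simp only: distrib_left cscale_mult_right add_Suc_right mult.assoc forms_add forms_scale)
  qed (simp only: mult_zero_right forms_zero)
qed

text \<open>The components of the tensor algebra span it, and the surjection \<pi> carries each of
  them into the forms of the same degree.\<close>

lemma forms_span: "cspan (\<Union>n. forms n) = UNIV"
proof -
  have deg: "\<pi> u \<in> forms n" if "u \<in> form_degree \<iota>\<^sub>A \<iota>\<^sub>\<Gamma> n" for u n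
    using that
  proof (induction n arbitrary: u)
    case (Suc n)
    from Suc.prems[unfolded form_degree.simps] show ?case
    proof (induction rule: cspan_induct)
      case zero
      show ?case by (simp only: clinear_zero[OF \<pi>_linear] forms_zero)
    next
      case (step c b y)
      then obtain v \<gamma> where "b = v * \<iota>\<^sub>\<Gamma> \<gamma>" "v \<in> form_degree \<iota>\<^sub>A \<iota>\<^sub>\<Gamma> n" by auto
      with step(2) show ?case
        by (simp only: clinear_add[OF \<pi>_linear] clinear_scale[OF \<pi>_linear] \<pi>_mult forms_add
            forms_scale forms_SucI Suc.IH)
    qed
  qed auto
  have "\<pi> u \<in> cspan (\<Union>n. forms n)" for u
  proof -
    have "u \<in> cspan (\<Union>n. form_degree \<iota>\<^sub>A \<iota>\<^sub>\<Gamma> n)" by (simp add: degrees_span)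
    then show ?thesis
    proof (induction rule: cspan_induct)
      case zero
      show ?case by (simp only: clinear_zero[OF \<pi>_linear] complex_vector.span_zero)
    next
      case (step c b y)
      then have "\<pi> b \<in> cspan (\<Union>n. forms n)"
        using deg by (blast intro: complex_vector.span_base)
      with step(2) show ?case
        by (simp only: clinear_add[OF \<pi>_linear] clinear_scale[OF \<pi>_linear]
            complex_vector.span_add complex_vector.span_scale)
    qed
  qed
  then show ?thesis using \<pi>_surj by (metis UNIV_eq_I surjD)
qed

lemma forms_induct:
  assumes "clinear F" "clinear G" "\<And>n \<alpha>. \<alpha> \<in> forms n \<Longrightarrow> F \<alpha> = G \<alpha>"
  shows "F \<alpha> = G \<alpha>"
proof -
  have "\<alpha> \<in> cspan (\<Union>n. forms n)" by (simp add: forms_span)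
  then show ?thesis
    by (induction rule: cspan_induct) (auto simp: assms clinear_zero clinear_add clinear_scale)
qed

lemma one_form_in_forms: "one_form \<gamma> \<in> forms 1"
  using forms_SucI[OF fn_in_forms[of 1], of \<gamma>] by (simp only: fn_one mult_1_left One_nat_def)

lemma dw_fn: "dw (fn x) = one_form (d x)"
  by (rule dw_extends)

lemma dw_fn_mult: "dw (fn x * \<beta>) = one_form (d x) * \<beta> + fn x * dw \<beta>"
  using dw_leibniz[OF fn_in_forms, of x \<beta>] by (simp add: dw_fn)

text \<open>The induction hypothesis on \<open>u = x dw v\<close> is used through \<open>u d y = x dw (v d y)\<close>, as \<open>d\<^sup>2 = 0\<close>.\<close>
lemma forms_Suc_exact:
  "\<alpha> \<in> forms (Suc n) \<Longrightarrow> \<alpha> \<in> cspan {fn x * dw \<beta> | x \<beta>. \<beta> \<in> forms n}"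
proof (induction n arbitrary: \<alpha>)
  have one_form_span: "one_form \<gamma> \<in> cspan {fn x * dw (fn y) | x y. True}" for \<gamma>
  proof -
    have "\<gamma> \<in> cspan {lact x (d y) | x y. True}" unfolding d_generates by simp
    then show ?thesis
    proof (induction rule: cspan_induct)
      case (step c b y)
      then obtain u v where "one_form b = fn u * dw (fn v)" by (auto simp: one_form_lact dw_fn)
      then have "one_form b \<in> cspan {fn x * dw (fn y) | x y. True}"
        by (intro complex_vector.span_base) auto
      with step(2) show ?case
        by (simp add: clinear_add[OF clinear_one_form] clinear_scale[OF clinear_one_form]
            complex_vector.span_add complex_vector.span_scale)
    qed (simp add: clinear_zero[OF clinear_one_form] complex_vector.span_zero)
  qed
  \<comment> \<open>One-forms are spanned by the \<open>fn x * dw (fn y)\<close>, and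
    \<open>u * fn x\<close> has the degree of \<open>u\<close>. A subspace therefore contains all
    forms of the next degree once it contains the products \<open>u * dw (fn y)\<close>.\<close>
  have key: "\<alpha> \<in> K" if deg: "\<alpha> \<in> forms (Suc n)" and sub: "csubspace K"
    and gen: "\<And>u y. u \<in> forms n \<Longrightarrow> u * dw (fn y) \<in> K" for K \<alpha> n
  proof -
    have "u * one_form \<gamma> \<in> K" if u: "u \<in> forms n" for u \<gamma>
      using one_form_span[of \<gamma>]
    proof (induction rule: cspan_induct)
      case (step c b w)
      then obtain x y where b: "b = fn x * dw (fn y)" by auto
      have "u * fn x * dw (fn y) \<in> K"
        using gen[of "u * fn x" y] forms_mult[OF u fn_in_forms, of x] by simp
      with step(2) sub show ?case
        by (simp add: b distrib_left cscale_mult_right mult.assoc complex_vector.subspace_add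
            complex_vector.subspace_scale)
    qed (simp add: sub complex_vector.subspace_0)
    with deg show ?thesis
      by (induction rule: forms_Suc_induct)
        (simp_all add: sub complex_vector.subspace_0 complex_vector.subspace_add complex_vector.subspace_scale)
  qed
  {
    case 0
    then show ?case
      by (rule key) (auto simp: complex_vector.subspace_span intro!: complex_vector.span_base)
  next
    case (Suc n)
    let ?K = "{fn x * dw \<beta> | x \<beta>. \<beta> \<in> forms (Suc n)}"
    show ?case
    proof (rule key[OF Suc.prems complex_vector.subspace_span])
      fix u y assume "u \<in> forms (Suc n)"
      then have "u \<in> cspan {fn x * dw \<beta> | x \<beta>. \<beta> \<in> forms n}" by (rule Suc.IH)
      then show "u * dw (fn y) \<in> cspan ?K"
      proof (induction rule: cspan_induct)
        case (step c b w)
        then obtain x v where b: "b = fn x * dw v" and v: "v \<in> forms n" by auto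
        have "dw v * dw (fn y) = dw (v * dw (fn y))"
          using dw_leibniz[OF v, of "dw (fn y)"] by (simp add: dw_dw)
        then have "b * dw (fn y) = fn x * dw (v * one_form (d y))"
          by (simp add: b mult.assoc dw_fn)
        then have "b * dw (fn y) \<in> ?K"
          using forms_SucI[OF v, of "d y"] by blast
        with step(2) show ?case
          by (simp only: distrib_right cscale_mult_left complex_vector.span_add complex_vector.span_scale
              complex_vector.span_base)
      qed (simp only: mult_zero_left complex_vector.span_zero)
    qed
  }
qed

lemma forms_exact_induct [consumes 1, case_names fn add step]:
  assumes "\<alpha> \<in> forms n"
    and fn: "\<And>x. Q 0 (fn x)"
    and add: "\<And>n \<alpha> \<beta> c. Q n \<alpha> \<Longrightarrow> Q n \<beta> \<Longrightarrow> Q n (c *\<^sub>C \<alpha> + \<beta>)"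
    and step: "\<And>n x \<alpha>. \<alpha> \<in> forms n \<Longrightarrow> Q n \<alpha> \<Longrightarrow> Q (Suc n) (fn x * dw \<alpha>)"
  shows "Q n \<alpha>"
  using assms(1)
proof (induction n arbitrary: \<alpha>)
  case (Suc n)
  \<comment> \<open>Zero is itself of the form \<open>fn x * dw \<alpha>\<close>, with both entries
    zero; it starts the induction over the span.\<close>
  have "Q (Suc n) 0"
    using step[OF forms_zero Suc.IH[OF forms_zero], of 0] by (simp add: clinear_zero[OF dw_linear])
  with forms_Suc_exact[OF Suc.prems] show ?case
    by (induction rule: cspan_induct) (auto intro: add step Suc.IH)
qed (use fn in auto)

text \<open>A form \<open>fn x * dw \<alpha>\<close> is reached by using the hypothesis on
  \<open>dw\<close> first and the one on left multiplication afterwards. Neither hypothesis mentions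
  degrees.\<close>

lemma operator_eqI:
  assumes F: "clinear F" and G: "clinear G"
    and fn: "\<And>x. F (fn x) = G (fn x)"
    and mult: "\<And>x \<beta>. F \<beta> = G \<beta> \<Longrightarrow> F (fn x * \<beta>) = G (fn x * \<beta>)"
    and dw: "\<And>\<beta>. F \<beta> = G \<beta> \<Longrightarrow> F (dw \<beta>) = G (dw \<beta>)"
  shows "F \<alpha> = G \<alpha>"
proof (rule forms_induct[OF F G])
  fix n \<alpha> assume "\<alpha> \<in> forms n"
  then show "F \<alpha> = G \<alpha>"
    by (induction rule: forms_exact_induct)
      (simp_all add: fn mult dw clinear_add[OF F] clinear_scale[OF F] clinear_add[OF G] clinear_scale[OF G])
qed

end


section \<open>Multiplicativity of the right coaction\<close>

context exterior_algebra
begin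

lemmas wmult_bilinear = cbilinear_mult[where 'a = 'w] and amult_bilinear = cbilinear_mult[where 'a = 'a]
lemmas tensor_alg_bilinear = cbilinear_tensor_mult[OF wmult_bilinear amult_bilinear]
lemmas tensor_alg_lin = tensor_alg_bilinear[unfolded cbilinear_iff]
lemmas tensor_alg_tens = tensor_mult_tens[OF wmult_bilinear amult_bilinear]

abbreviation tmult :: "('w, 'a) tensor \<Rightarrow> ('w, 'a) tensor \<Rightarrow> ('w, 'a) tensor"
  where "tmult \<equiv> tensor_mult (*) (*)"

lemma tmult_assoc: "tmult (tmult r s) t = tmult r (tmult s t)"
  by (rule tensor_mult_assoc) (simp_all add: wmult_bilinear amult_bilinear mult.assoc)

lemma clinear_ident: "clinear (\<lambda>x :: 'v::complex_vector. x)"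
  by (simp add: clinear_iff)

lemmas clinear_map_fn = clinear_tensor_map[OF clinear_fn clinear_ident[where 'v = 'a]]
lemmas clinear_map_dw = clinear_tensor_map[OF dw_linear clinear_ident[where 'v = 'a]]
lemmas map_tens = tensor_map_tens[OF clinear_fn clinear_ident[where 'v = 'a]]
  tensor_map_tens[OF dw_linear clinear_ident[where 'v = 'a]]
lemmas map_lin = clinear_add[OF clinear_map_fn] clinear_scale[OF clinear_map_fn]
  clinear_add[OF clinear_map_dw] clinear_scale[OF clinear_map_dw]

lemma coaction_fn: "\<rho> (fn x) = tensor_map fn (\<lambda>y. y) (\<Delta> x)"
  by (simp add: \<rho>_zero o_def id_def)

text \<open>The recursive rule for \<rho>, rewritten with the product of the tensor product algebra
  in place of the action of \<open>A\<close>, so that associativity of \<open>tmult\<close> becomes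
  available.\<close>

lemma coaction_fn_dw: "\<rho> (fn x * dw \<alpha>) = tmult (\<rho> (fn x)) (tensor_map dw (\<lambda>y. y) (\<rho> \<alpha>))"
proof -
  have bil: "cbilinear (\<lambda>y \<beta>. fn y * \<beta>)"
    by (simp add: exterior_lin)
  note lin = cbilinear_tensor_mult[OF bil amult_bilinear, unfolded cbilinear_iff] map_lin
  have "tensor_mult (\<lambda>y \<beta>. fn y * \<beta>) (*) s r = tmult (tensor_map fn (\<lambda>y. y) s) r" for s :: "('a, 'a) tensor" and r
  proof (induction s rule: tensor_induct)
    case (tens x y)
    show ?case
      by (induction r rule: tensor_induct)
        (simp_all add: tensor_mult_tens[OF bil amult_bilinear] tensor_alg_tens lin tensor_alg_lin
          map_tens)
  qed (simp add: lin tensor_alg_lin)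
  then show ?thesis by (simp add: \<rho>_dw coaction_fn id_def)
qed

lemma coaction_one: "\<rho> 1 = 1 \<otimes> 1"
  using coaction_fn[of 1] by (simp add: fn_one comult_one map_tens)

lemma tmult_one: "tmult (1 \<otimes> 1) s = s"
  by (induction s rule: tensor_induct) (simp_all add: tensor_alg_tens tensor_alg_lin)

lemma coaction_dw: "\<rho> (dw \<alpha>) = tensor_map dw (\<lambda>y. y) (\<rho> \<alpha>)"
  using coaction_fn_dw[of 1 \<alpha>] by (simp add: fn_one coaction_one tmult_one)

lemma coaction_fn_mult_fn: "\<rho> (fn x * fn y) = tmult (\<rho> (fn x)) (\<rho> (fn y))"
proof -
  note bil = cbilinear_tensor_mult[OF amult_bilinear amult_bilinear, unfolded cbilinear_iff]
    map_lin
  have "tensor_map fn (\<lambda>y. y) (tensor_mult (*) (*) s t) =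
    tmult (tensor_map fn (\<lambda>y. y) s) (tensor_map fn (\<lambda>y. y) t)" for s t :: "('a, 'a) tensor"
  proof (induction s rule: tensor_induct)
    case (tens x y)
    show ?case
      by (induction t rule: tensor_induct)
        (simp_all add: tensor_mult_tens[OF amult_bilinear amult_bilinear] tensor_alg_tens bil tensor_alg_lin
          map_tens fn_mult)
  qed (simp add: bil tensor_alg_lin)
  then show ?thesis by (simp add: coaction_fn comult_mult flip: fn_mult)
qed

lemma coaction_fn_mult: "\<rho> (fn x * \<beta>) = tmult (\<rho> (fn x)) (\<rho> \<beta>)"
proof (rule forms_induct[where F = "\<lambda>\<beta>. \<rho> (fn x * \<beta>)"])
  show "clinear (\<lambda>\<beta>. \<rho> (fn x * \<beta>))" "clinear (\<lambda>\<beta>. tmult (\<rho> (fn x)) (\<rho> \<beta>))"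
    by (simp_all add: exterior_lin tensor_alg_lin)
  fix n \<beta> assume "\<beta> \<in> forms n"
  then show "\<rho> (fn x * \<beta>) = tmult (\<rho> (fn x)) (\<rho> \<beta>)"
  proof (induction rule: forms_exact_induct)
    case (step n y \<beta>)
    have "\<rho> (fn x * (fn y * dw \<beta>)) = tmult (\<rho> (fn x * fn y)) (tensor_map dw (\<lambda>y. y) (\<rho> \<beta>))"
      using coaction_fn_dw[of "x * y" \<beta>] by (simp add: fn_mult mult.assoc)
    then show ?case by (simp add: coaction_fn_mult_fn coaction_fn_dw tmult_assoc)
  qed (simp_all add: coaction_fn_mult_fn exterior_lin tensor_alg_lin)
qed

text \<open>Homogeneity of the first leg is what fixes the sign when \<open>dw\<close> is applied to
  a product of tensors, and it makes functionals act without changing the degree.\<close>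

lemma coaction_forms: "\<alpha> \<in> forms n \<Longrightarrow> \<rho> \<alpha> \<in> cspan {\<beta> \<otimes> y | \<beta> y. \<beta> \<in> forms n}"
proof (induction rule: forms_exact_induct)
  case (fn x)
  have "tensor_map fn (\<lambda>y. y) s \<in> cspan {\<beta> \<otimes> y | \<beta> y. \<beta> \<in> forms 0}" for s :: "('a, 'a) tensor"
  proof (induction s rule: tensor_induct)
    case (tens x y)
    then show ?case
      using fn_in_forms[of x]
      by (auto simp only: map_tens 
          intro!: complex_vector.span_base)
  qed (simp only: map_lin complex_vector.span_add)
  then show ?case by (simp only: coaction_fn)
next
  case (add n \<alpha> \<beta> c)
  then show ?case by (simp only: exterior.coaction_lin complex_vector.span_add complex_vector.span_scale)
next
  case (step n x \<alpha>)
  let ?K = "{\<beta> \<otimes> y | \<beta> y. \<beta> \<in> forms (Suc n)}"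
  from step(2) have "tmult (tensor_map fn (\<lambda>y. y) s) (tensor_map dw (\<lambda>y. y) (\<rho> \<alpha>)) \<in> cspan ?K"
    for s :: "('a, 'a) tensor"
  proof (induction rule: cspan_induct)
    case zero
    then show ?case
      by (simp only: clinear_zero[OF clinear_map_dw]
          clinear_zero[of "tmult _"] clinear_iff tensor_alg_lin simp_thms complex_vector.span_zero)
  next
    case (step c b r)
    from step(1) obtain \<beta> y where b: "b = \<beta> \<otimes> y" and \<beta>: "\<beta> \<in> forms n" by blast
    have "tmult (tensor_map fn (\<lambda>y. y) s) (tensor_map dw (\<lambda>y. y) b) \<in> cspan ?K"
    proof (induction s rule: tensor_induct)
      case (tens x z)
      have "fn x * dw \<beta> \<in> forms (Suc n)"
        using forms_mult[OF fn_in_forms dw_degree[OF \<beta>], of x] by (simp only: add_0)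
      then have "(fn x * dw \<beta>) \<otimes> (z * y) \<in> cspan ?K" by (blast intro: complex_vector.span_base)
      then show ?case
        by (simp only: b map_tens
            tensor_alg_tens )
    qed (simp only: map_lin tensor_alg_lin
        complex_vector.span_add)
    with step(2) show ?case
      by (simp only: map_lin tensor_alg_lin
        complex_vector.span_add complex_vector.span_scale)
  qed
  then show ?case by (simp only: coaction_fn_dw coaction_fn)
qed

text \<open>Induction on the left factor with \<beta> arbitrary: the Leibniz rule removes the
  differential from the left factor at the price of replacing \<beta> by
  \<open>dw \<beta>\<close>.\<close>

lemma coaction_mult: "\<rho> (\<alpha> * \<beta>) = tmult (\<rho> \<alpha>) (\<rho> \<beta>)"
proof (rule forms_induct[where F = "\<lambda>\<alpha>. \<rho> (\<alpha> * \<beta>)"])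
  show "clinear (\<lambda>\<alpha>. \<rho> (\<alpha> * \<beta>))" "clinear (\<lambda>\<alpha>. tmult (\<rho> \<alpha>) (\<rho> \<beta>))"
    by (simp_all add: exterior_lin tensor_alg_lin)
  fix n \<alpha> assume "\<alpha> \<in> forms n"
  then show "\<rho> (\<alpha> * \<beta>) = tmult (\<rho> \<alpha>) (\<rho> \<beta>)"
  proof (induction arbitrary: \<beta> rule: forms_exact_induct)
    case (step n x \<alpha>)
    let ?d = "tensor_map dw (\<lambda>y. y) :: ('w, 'a) tensor \<Rightarrow> _"
    \<comment> \<open>The differential on the first leg is again a graded derivation, with the sign
      governed by the degree of that leg.\<close>
    have leibniz: "?d (tmult s r) = tmult (?d s) r + (- 1) ^ n *\<^sub>C tmult s (?d r)"
      if "s \<in> cspan {\<beta> \<otimes> y | \<beta> y. \<beta> \<in> forms n}" for s r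
      using that
    proof (induction rule: cspan_induct)
      case zero
      have "?d 0 = 0" "tmult 0 r = 0" for r
        using clinear_zero[OF clinear_map_dw] clinear_zero[where F = "\<lambda>s. tmult s r"]
        by (simp_all add: clinear_iff tensor_alg_lin)
      then show ?case by (simp add: complex_vector.scale_zero_right)
    next
      case (step c b s)
      from step(1) obtain \<beta> y where b: "b = \<beta> \<otimes> y" and \<beta>: "\<beta> \<in> forms n" by blast
      have "?d (tmult b r) = tmult (?d b) r + (- 1) ^ n *\<^sub>C tmult b (?d r)"
        by (induction r rule: tensor_induct)
          (simp_all add: b map_lin map_tens tensor_alg_lin tensor_alg_tens dw_leibniz[OF \<beta>] tens_linear
            sign_mult mult.assoc cscale_add_right cscale_mult_left)
      with step(2) show ?case
        by (simp add: map_lin tensor_alg_lin cscale_add_right cscale_cscale mult.commute)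
    qed
    have "fn x * dw \<alpha> * \<beta> = fn x * dw (\<alpha> * \<beta>) - (- 1) ^ n *\<^sub>C (fn x * (\<alpha> * dw \<beta>))"
      by (simp add: dw_leibniz[OF step(1)] sign_mult distrib_left mult.assoc cscale_mult_left cscale_mult_right)
    then have "\<rho> (fn x * dw \<alpha> * \<beta>) =
        tmult (\<rho> (fn x)) (?d (tmult (\<rho> \<alpha>) (\<rho> \<beta>)) - (- 1) ^ n *\<^sub>C tmult (\<rho> \<alpha>) (?d (\<rho> \<beta>)))"
      by (simp add: clinear_diff[OF exterior.right_coaction_linear] exterior.coaction_lin coaction_fn_mult
          coaction_dw step(2) clinear_diff[where F = "tmult _"] clinear_iff tensor_alg_lin)
    also have "\<dots> = tmult (\<rho> (fn x)) (tmult (?d (\<rho> \<alpha>)) (\<rho> \<beta>))"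
      by (simp add: leibniz[OF coaction_forms[OF step(1)]])
    finally show ?case by (simp add: coaction_fn_dw tmult_assoc)
  qed (simp_all add: coaction_fn_mult exterior_lin tensor_alg_lin)
qed

lemma act_mult: "act h (\<alpha> * \<beta>) = tensor_lift (\<lambda>m x. tensor_lift (\<lambda>n y. h (x * y) *\<^sub>C (m * n)) (\<rho> \<beta>)) (\<rho> \<alpha>)"
  if h: "clinear h"
  by (simp add: dual_action_def coaction_mult tensor_mult_def tensor_lift_tensor_lift tensor_lift_tens
      lin_simps clinear_add[OF h] clinear_scale[OF h])

text \<open>Brings products of two actions to the same double sum as \<open>act_mult\<close>.
  Comparing coefficients, a formula for a functional on \<open>x * y\<close> turns directly into a
  Leibniz rule.\<close>

lemma act_mult_act:
  "act g \<alpha> * act h \<beta> = tensor_lift (\<lambda>m x. tensor_lift (\<lambda>n y. (g x * h y) *\<^sub>C (m * n)) (\<rho> \<beta>)) (\<rho> \<alpha>)"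
proof -
  have "tensor_lift k s * w = tensor_lift (\<lambda>x y. k x y * w) s" and
    "w * tensor_lift k s = tensor_lift (\<lambda>x y. w * k x y) s" for k and s :: "('w, 'a) tensor" and w :: 'w
    by (rule clinear_tensor_lift_commute, simp add: lin_simps)+
  then show ?thesis
    by (simp only: dual_action_def cscale_mult_left cscale_mult_right cscale_cscale flip: tensor_lift_fun_scale)
      (subst tensor_lift_swap, simp only: mult.commute)
qed

lemma act_f_mult:
  assumes "i \<in> {1..N}" "j \<in> {1..N}"
  shows "act (f i j) (\<alpha> * \<beta>) = (\<Sum>k=1..N. act (f i k) \<alpha> * act (f k j) \<beta>)"
  using assms
  by (simp only: act_mult f_linear f_mult act_mult_act complex_vector.scale_sum_left tensor_lift_fun_sum)

lemma act_X_mult: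
  assumes "i \<in> {1..N}"
  shows "act (X i) (\<alpha> * \<beta>) = \<alpha> * act (X i) \<beta> + (\<Sum>j=1..N. act (X j) \<alpha> * act (f j i) \<beta>)"
proof -
  \<comment> \<open>The identity is written as the action of the counit, which gives every term of
    \<open>X_mult\<close> the shape of \<open>act_mult_act\<close>.\<close>
  have "act (X i) (\<alpha> * \<beta>) = act \<epsilon> \<alpha> * act (X i) \<beta> + (\<Sum>j=1..N. act (X j) \<alpha> * act (f j i) \<beta>)"
    using assms
    by (simp only: act_mult X_linear X_mult act_mult_act complex_vector.scale_sum_left tensor_lift_fun_sum
      cscale_add_left tensor_lift_fun_add)
  then show ?thesis by (simp only: exterior.dual_action_counit)
qed

lemma act_dw: "act h (dw \<alpha>) = dw (act h \<alpha>)" if h: "clinear h"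
  by (simp add: dual_action_def coaction_dw tensor_lift_map[OF _ dw_linear clinear_ident] lin_simps
      clinear_add[OF h] clinear_scale[OF h] clinear_tensor_lift_commute[OF dw_linear] clinear_scale[OF dw_linear])

lemma act_forms: "clinear h \<Longrightarrow> \<alpha> \<in> forms n \<Longrightarrow> act h \<alpha> \<in> forms n"
proof -
  assume h: "clinear h" and "\<alpha> \<in> forms n"
  have bil: "cbilinear (\<lambda>(n :: 'w) x. h x *\<^sub>C n)"
    by (simp add: lin_simps clinear_add[OF h] clinear_scale[OF h])
  from coaction_forms[OF \<open>\<alpha> \<in> forms n\<close>] show ?thesis
    unfolding dual_action_def
  proof (induction rule: cspan_induct)
    case (step c b s)
    then show ?case
      by (auto simp only: tensor_lift_add[OF bil] tensor_lift_scale[OF bil] tensor_lift_tens[OF bil]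
          intro!: forms_add forms_scale)
  qed (simp only: tensor_lift_zero[OF bil] forms_zero)
qed

lemma act_fn: "act h (fn x) = fn (dual_action \<Delta> h x)" if h: "clinear h"
  by (simp add: dual_action_def coaction_fn tensor_lift_map[OF _ clinear_fn clinear_ident] lin_simps
      clinear_add[OF h] clinear_scale[OF h] clinear_tensor_lift_commute[OF clinear_fn] clinear_scale[OF clinear_fn])

lemma act_one: "act h 1 = h 1 *\<^sub>C 1" if h: "clinear h"
  by (simp add: dual_action_def coaction_one tensor_lift_tens lin_simps clinear_add[OF h] clinear_scale[OF h])

section \<open>Inner derivatives and their commutation relations\<close>

lemma inner_fn_mult: "k \<in> {1..N} \<Longrightarrow> inner k (fn x * \<beta>) = fn x * inner k \<beta>"
  using inner_product[OF _ fn_in_forms, of k x \<beta>] by (simp add: inner_zero)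

text \<open>Expand the differential in the basis; the inner derivative passes the coefficient
  functions and selects the one with index \<open>k\<close>. This is the Cartan formula on
  functions.\<close>

lemma inner_dw_fn: 
  assumes k: "k \<in> {1..N}"
  shows "inner k (dw (fn x)) = act (X k) (fn x)"
proof -
  have "dw (fn x) = (\<Sum>i=1..N. fn (dual_action \<Delta> (X i) x) * one_form (\<omega> i))"
    by (simp add: dw_fn d_expand clinear_sum[OF clinear_one_form] one_form_lact)
  then have "inner k (dw (fn x)) = (\<Sum>i=1..N. (if k = i then 1 else 0) *\<^sub>C fn (dual_action \<Delta> (X i) x))"
    using k by (simp add: clinear_sum[OF inner_linear] inner_fn_mult inner_\<omega>)
      (intro sum.cong, auto simp: cscale_one complex_vector.scale_zero_left)
  then show ?thesis using k by (simp add: basis_sum act_fn X_linear)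
qed

lemmas operator_lin = clinear_add[OF inner_linear] clinear_scale[OF inner_linear]
  clinear_add[OF exterior.clinear_coaction_dual_action] clinear_scale[OF exterior.clinear_coaction_dual_action]
  clinear_add[OF dw_linear] clinear_scale[OF dw_linear]
  X_linear f_linear cscale_add_right cscale_cscale mult.commute sum.distrib distrib_left cscale_mult_right
  complex_vector.scale_sum_right

lemma cartan_formula:
  assumes k: "k \<in> {1..N}"
  shows "inner k (dw \<alpha>) + dw (inner k \<alpha>) = act (X k) \<alpha>"
proof (rule operator_eqI[where F = "\<lambda>\<alpha>. inner k (dw \<alpha>) + dw (inner k \<alpha>)"])
  show "clinear (\<lambda>\<alpha>. inner k (dw \<alpha>) + dw (inner k \<alpha>))"
    unfolding clinear_iff using k by (simp add: operator_lin add_ac)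
  show "clinear (act (X k))"
    using k by (simp only: exterior.clinear_coaction_dual_action X_linear)
  show "inner k (dw (fn x)) + dw (inner k (fn x)) = act (X k) (fn x)" for x
    by (simp add: inner_dw_fn k inner_zero clinear_zero[OF dw_linear])
next
  fix x \<beta> assume IH: "inner k (dw \<beta>) + dw (inner k \<beta>) = act (X k) \<beta>"
  \<comment> \<open>The one-form \<open>dw (fn x)\<close> is odd, so its product with
    \<open>inner k \<beta>\<close> appears here with a minus sign and cancels against the same term
    from the differential of \<open>inner k (fn x * \<beta>)\<close>. What remains is the Leibniz
    rule of \<open>act (X k)\<close>.\<close>
  have "inner k (dw (fn x * \<beta>)) = - dw (fn x) * inner k \<beta> + (\<Sum>j=1..N. act (X j) (fn x) * act (f j k) \<beta>)
      + fn x * inner k (dw \<beta>)"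
    using k inner_product[OF k one_form_in_forms[of "d x"], of \<beta>]
    by (simp add: dw_fn_mult clinear_add[OF inner_linear] inner_fn_mult inner_dw_fn flip: dw_fn)
  moreover have "dw (inner k (fn x * \<beta>)) = dw (fn x) * inner k \<beta> + fn x * dw (inner k \<beta>)"
    by (simp add: inner_fn_mult k dw_fn_mult dw_fn)
  ultimately show "inner k (dw (fn x * \<beta>)) + dw (inner k (fn x * \<beta>)) = act (X k) (fn x * \<beta>)"
    using k by (simp add: act_X_mult distrib_left flip: IH)
next
  fix \<beta> assume IH: "inner k (dw \<beta>) + dw (inner k \<beta>) = act (X k) \<beta>"
  show "inner k (dw (dw \<beta>)) + dw (inner k (dw \<beta>)) = act (X k) (dw \<beta>)"
    using k by (simp add: dw_dw clinear_zero[OF inner_linear] act_dw X_linear clinear_add[OF dw_linear] flip: IH)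
qed

lemma inner_dw: "k \<in> {1..N} \<Longrightarrow> inner k (dw \<alpha>) = act (X k) \<alpha> - dw (inner k \<alpha>)"
  using cartan_formula[of k \<alpha>] by (simp add: algebra_simps)

lemma act_linear: "i \<in> {1..N} \<Longrightarrow> clinear (act (X i))"
  "i \<in> {1..N} \<Longrightarrow> j \<in> {1..N} \<Longrightarrow> clinear (act (f i j))"
  by (simp_all only: exterior.clinear_coaction_dual_action X_linear f_linear)

lemma act_zero: "i \<in> {1..N} \<Longrightarrow> act (X i) 0 = 0"
  "i \<in> {1..N} \<Longrightarrow> j \<in> {1..N} \<Longrightarrow> act (f i j) 0 = 0"
  by (simp_all only: clinear_zero act_linear)

text \<open>Moving a function through \<open>act (f k j)\<close> produces \<open>act (f p j)\<close>
  for all \<open>p\<close>. The induction therefore has to treat all first indices simultaneously,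
  for which \<open>forms_exact_induct\<close> is used directly.\<close>

lemma inner_act_f:
  assumes i: "i \<in> {1..N}" and j: "j \<in> {1..N}" and k: "k \<in> {1..N}"
  shows "inner i (act (f k j) \<alpha>) = (\<Sum>n=1..N. \<Sum>m=1..N. braid i j n m *\<^sub>C act (f k n) (inner m \<alpha>))"
proof -
  define R where "R k \<alpha> = (\<Sum>n=1..N. \<Sum>m=1..N. braid i j n m *\<^sub>C act (f k n) (inner m \<alpha>))" for k \<alpha>
  have lin: "clinear (\<lambda>\<alpha>. inner i (act (f k j) \<alpha>))" "clinear (R k)" if "k \<in> {1..N}" for k
    unfolding clinear_iff R_def using i j that by (simp_all add: operator_lin)
  have all: "\<forall>k\<in>{1..N}. inner i (act (f k j) \<alpha>) = R k \<alpha>" if "\<alpha> \<in> forms n" for n \<alpha>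
    using that
  proof (induction rule: forms_exact_induct)
    case (fn x)
    show ?case
      using i j by (simp add: R_def act_fn f_linear inner_zero act_zero complex_vector.scale_zero_right)
  next
    case (add n \<alpha> \<beta> c)
    then show ?case by (simp add: lin[unfolded clinear_iff])
  next
    case (step n x \<beta>)
    show ?case
    proof
      fix k assume k: "k \<in> {1..N}"
      \<comment> \<open>The Cartan formula trades the differential for \<open>act (X i)\<close> and
        the induction hypothesis. \<open>X_f_relation\<close> reorders the functionals, and the
        Cartan formula read backwards reassembles the right side.\<close>
      have dw: "inner i (act (f p j) (dw \<beta>)) = R p (dw \<beta>)" if p: "p \<in> {1..N}" for p
      proof -
        have "inner i (act (f p j) (dw \<beta>)) = act (X i) (act (f p j) \<beta>) - dw (R p \<beta>)"
          using i j p step(2) by (simp add: act_dw f_linear inner_dw)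
        also have "act (X i) (act (f p j) \<beta>) =
            (\<Sum>n=1..N. \<Sum>m=1..N. braid i j n m *\<^sub>C act (f p n) (act (X m) \<beta>))"
        proof -
          have "act (X i) (act (f p j) \<beta>) = act (convolution \<Delta> (X i) (f p j)) \<beta>"
            using i j p by (simp only: exterior.dual_action_convolution X_linear f_linear)
          then show ?thesis
            using p by (simp add: X_f_relation[OF i p j] exterior.dual_action_sum exterior.dual_action_scale
                exterior.dual_action_convolution X_linear f_linear)
        qed
        also have "\<dots> - dw (R p \<beta>) = R p (dw \<beta>)"
          using p
          by (simp add: R_def inner_dw clinear_diff act_linear clinear_sum[OF dw_linear] clinear_scale[OF dw_linear]
              act_dw f_linear complex_vector.scale_right_diff_distrib sum_subtractf)
        finally show ?thesis .
      qed
      have "inner i (act (f k j) (fn x * dw \<beta>)) = (\<Sum>p=1..N. act (f k p) (fn x) * inner i (act (f p j) (dw \<beta>)))"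
        using i j k by (simp add: act_f_mult clinear_sum[OF inner_linear] act_fn f_linear inner_fn_mult)
      also have "\<dots> = (\<Sum>p=1..N. act (f k p) (fn x) * R p (dw \<beta>))"
        by (simp add: dw)
      also have "\<dots> = R k (fn x * dw \<beta>)"
        unfolding R_def using k
        by (simp add: inner_fn_mult act_f_mult sum_distrib_left cscale_mult_right complex_vector.scale_sum_right)
          (subst sum.swap, rule sum.cong, rule refl, rule sum.swap)
      finally show "inner i (act (f k j) (fn x * dw \<beta>)) = R k (fn x * dw \<beta>)" .
    qed
  qed
  have "inner i (act (f k j) \<alpha>) = R k \<alpha>"
    by (rule forms_induct[OF lin[OF k]]) (use all k in blast)
  then show ?thesis by (simp add: R_def)
qed

text \<open>For left multiplication by functions, the terms \<open>f p j\<close> in the coproduct of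
  \<open>X j\<close> call for \<open>inner_act_f\<close>. For the differential, the Cartan formula
  reduces the claim to \<open>X_X_relation\<close>.\<close>

lemma inner_act_X:
  assumes i: "i \<in> {1..N}" and j: "j \<in> {1..N}"
  shows "inner i (act (X j) \<alpha>) = (\<Sum>k=1..N. \<Sum>l=1..N. braid i j k l *\<^sub>C act (X k) (inner l \<alpha>))
    + (\<Sum>k=1..N. struct k i j *\<^sub>C inner k \<alpha>)"
proof -
  define R where "R \<alpha> = (\<Sum>k=1..N. \<Sum>l=1..N. braid i j k l *\<^sub>C act (X k) (inner l \<alpha>))
    + (\<Sum>k=1..N. struct k i j *\<^sub>C inner k \<alpha>)" for \<alpha>
  have "inner i (act (X j) \<alpha>) = R \<alpha>"
  proof (rule operator_eqI[where F = "\<lambda>\<alpha>. inner i (act (X j) \<alpha>)"])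
    show "clinear (\<lambda>\<alpha>. inner i (act (X j) \<alpha>))" "clinear R"
      unfolding clinear_iff R_def using i j by (simp_all add: operator_lin add_ac)
    show "inner i (act (X j) (fn x)) = R (fn x)" for x
      using i j by (simp add: R_def act_fn X_linear inner_zero act_zero complex_vector.scale_zero_right)
  next
    fix x \<beta> assume IH: "inner i (act (X j) \<beta>) = R \<beta>"
    have "inner i (act (X j) (fn x * \<beta>)) = fn x * R \<beta> + (\<Sum>p=1..N. act (X p) (fn x) * inner i (act (f p j) \<beta>))"
      using i j
      by (simp add: act_X_mult clinear_add[OF inner_linear] clinear_sum[OF inner_linear] act_fn X_linear
          inner_fn_mult IH)
    also have "(\<Sum>p=1..N. act (X p) (fn x) * inner i (act (f p j) \<beta>)) =
        (\<Sum>k=1..N. \<Sum>l=1..N. \<Sum>p=1..N. braid i j k l *\<^sub>C (act (X p) (fn x) * act (f p k) (inner l \<beta>)))"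
      using i j
      by (simp add: inner_act_f sum_distrib_left cscale_mult_right)
        (subst sum.swap, rule sum.cong, rule refl, rule sum.swap)
    also have "fn x * R \<beta> + \<dots> = R (fn x * \<beta>)"
      by (simp add: R_def inner_fn_mult act_X_mult distrib_left sum_distrib_left cscale_mult_right
          cscale_add_right complex_vector.scale_sum_right sum.distrib add_ac)
    finally show "inner i (act (X j) (fn x * \<beta>)) = R (fn x * \<beta>)" .
  next
    fix \<beta> assume IH: "inner i (act (X j) \<beta>) = R \<beta>"
    have "inner i (act (X j) (dw \<beta>)) = act (X i) (act (X j) \<beta>) - dw (R \<beta>)"
      using i j IH by (simp add: act_dw X_linear inner_dw)
    also have "act (X i) (act (X j) \<beta>) =
        (\<Sum>k=1..N. \<Sum>l=1..N. braid i j k l *\<^sub>C act (X k) (act (X l) \<beta>)) + (\<Sum>k=1..N. struct k i j *\<^sub>C act (X k) \<beta>)"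
    proof -
      have "act (X i) (act (X j) \<beta>) = act (convolution \<Delta> (X i) (X j)) \<beta>"
        using i j by (simp only: exterior.dual_action_convolution X_linear)
      then show ?thesis
        by (simp add: X_X_relation[OF i j] exterior.dual_action_add exterior.dual_action_sum
            exterior.dual_action_scale exterior.dual_action_convolution X_linear)
    qed
    also have "\<dots> - dw (R \<beta>) = R (dw \<beta>)"
      by (simp add: R_def inner_dw clinear_diff act_linear clinear_add[OF dw_linear] clinear_sum[OF dw_linear]
          clinear_scale[OF dw_linear] act_dw X_linear complex_vector.scale_right_diff_distrib sum_subtractf)
    finally show "inner i (act (X j) (dw \<beta>)) = R (dw \<beta>)" .
  qed
  then show ?thesis by (simp add: R_def)
qed

lemma sum_swap_pairs:
  "(\<Sum>a\<in>A. \<Sum>b\<in>B. \<Sum>k\<in>C. \<Sum>l\<in>D. h a b k l) = (\<Sum>k\<in>C. \<Sum>l\<in>D. \<Sum>a\<in>A. \<Sum>b\<in>B. h a b k l)"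
proof -
  have "(\<Sum>a\<in>A. \<Sum>b\<in>B. \<Sum>k\<in>C. \<Sum>l\<in>D. h a b k l) = (\<Sum>a\<in>A. \<Sum>k\<in>C. \<Sum>b\<in>B. \<Sum>l\<in>D. h a b k l)"
    by (rule sum.cong[OF refl], rule sum.swap)
  also have "\<dots> = (\<Sum>k\<in>C. \<Sum>a\<in>A. \<Sum>b\<in>B. \<Sum>l\<in>D. h a b k l)"
    by (rule sum.swap)
  also have "\<dots> = (\<Sum>k\<in>C. \<Sum>a\<in>A. \<Sum>l\<in>D. \<Sum>b\<in>B. h a b k l)"
    by (rule sum.cong[OF refl], rule sum.cong[OF refl], rule sum.swap)
  also have "\<dots> = (\<Sum>k\<in>C. \<Sum>l\<in>D. \<Sum>a\<in>A. \<Sum>b\<in>B. h a b k l)"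
    by (rule sum.cong[OF refl], rule sum.swap)
  finally show ?thesis .
qed

text \<open>The premise says that \<open>v\<close> is the coefficient array of a tensor fixed by the
  transposed braiding; interchanging the sums lets the braiding act on \<open>v\<close>. The values
  lie in any vector space because both numbers and forms are summed later.\<close>

lemma braid_invariant_sum:
  fixes h :: "nat \<Rightarrow> nat \<Rightarrow> 'v::complex_vector"
  assumes v: "\<And>k l. k \<in> {1..N} \<Longrightarrow> l \<in> {1..N} \<Longrightarrow> (\<Sum>a=1..N. \<Sum>b=1..N. v a b * braid a b k l) = v k l"
  shows "(\<Sum>a=1..N. \<Sum>b=1..N. v a b *\<^sub>C (\<Sum>k=1..N. \<Sum>l=1..N. braid a b k l *\<^sub>C h k l)) =
    (\<Sum>k=1..N. \<Sum>l=1..N. v k l *\<^sub>C h k l)"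
proof -
  have "(\<Sum>a=1..N. \<Sum>b=1..N. v a b *\<^sub>C (\<Sum>k=1..N. \<Sum>l=1..N. braid a b k l *\<^sub>C h k l)) =
      (\<Sum>a=1..N. \<Sum>b=1..N. \<Sum>k=1..N. \<Sum>l=1..N. (v a b * braid a b k l) *\<^sub>C h k l)"
    by (simp add: complex_vector.scale_sum_right cscale_cscale)
  also have "\<dots> = (\<Sum>k=1..N. \<Sum>l=1..N. (\<Sum>a=1..N. \<Sum>b=1..N. v a b * braid a b k l) *\<^sub>C h k l)"
    by (subst sum_swap_pairs) (simp add: complex_vector.scale_sum_left)
  finally show ?thesis by (simp add: v)
qed

lemma inner_inner_relation:
  assumes v: "\<And>k l. k \<in> {1..N} \<Longrightarrow> l \<in> {1..N} \<Longrightarrow> (\<Sum>a=1..N. \<Sum>b=1..N. v a b * braid a b k l) = v k l"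
  shows "(\<Sum>a=1..N. \<Sum>b=1..N. v a b *\<^sub>C inner a (inner b \<alpha>)) = 0"
proof -
  \<comment> \<open>Contract \<open>X_X_relation\<close> with \<open>v\<close>. The quadratic parts
    cancel by invariance, and evaluation at a dual point isolates one coefficient of the remaining
    combination of the \<open>X i\<close>.\<close>
  have struct_zero: "(\<Sum>a=1..N. \<Sum>b=1..N. v a b * struct j a b) = 0" if j: "j \<in> {1..N}" for j
  proof -
    obtain z where z: "\<And>i j. i \<in> {1..N} \<Longrightarrow> j \<in> {1..N} \<Longrightarrow> X i (z j) = (if i = j then 1 else 0)"
      using dual_points by blast
    define h where "h a b = convolution \<Delta> (X a) (X b) (z j)" for a b
    define g where "g a b = (\<Sum>k=1..N. \<Sum>l=1..N. braid a b k l * h k l)" for a b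
    have h_eq: "h a b = g a b + struct j a b" if "a \<in> {1..N}" "b \<in> {1..N}" for a b
    proof -
      have "(\<Sum>i=1..N. struct i a b * X i (z j)) = (\<Sum>i=1..N. (if i = j then 1 else 0) * struct i a b)"
        using j by (intro sum.cong refl) (simp add: z)
      also have "\<dots> = struct j a b" by (rule basis_sum(4)[OF j])
      finally show ?thesis
        unfolding h_def X_X_relation[OF that] g_def
        by (simp only: plus_fun_apply sum_fun_apply cscale_fun_def cscale_complex)
    qed
    have "(\<Sum>a=1..N. \<Sum>b=1..N. v a b * h a b) = (\<Sum>a=1..N. \<Sum>b=1..N. v a b * g a b) +
        (\<Sum>a=1..N. \<Sum>b=1..N. v a b * struct j a b)"
      by (simp add: h_eq distrib_left sum.distrib)
    moreover have "(\<Sum>a=1..N. \<Sum>b=1..N. v a b *\<^sub>C (\<Sum>k=1..N. \<Sum>l=1..N. braid a b k l *\<^sub>C h k l)) =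
        (\<Sum>k=1..N. \<Sum>l=1..N. v k l *\<^sub>C h k l)"
      by (rule braid_invariant_sum) (rule v)
    ultimately show ?thesis by (simp add: g_def cscale_complex)
  qed
  define D where "D \<alpha> = (\<Sum>a=1..N. \<Sum>b=1..N. v a b *\<^sub>C inner a (inner b \<alpha>))" for \<alpha>
  have "D \<alpha> = 0"
  proof (rule operator_eqI[where F = D])
    show "clinear D" unfolding clinear_iff D_def by (simp add: operator_lin)
    show "clinear (\<lambda>\<alpha>. 0 :: 'w)" by (simp add: clinear_iff complex_vector.scale_zero_right)
    show "D (fn x) = 0" for x
      by (simp add: D_def inner_zero clinear_zero[OF inner_linear] complex_vector.scale_zero_right)
    show "D (fn x * \<beta>) = 0" if "D \<beta> = 0" for x \<beta>
    proof -
      have "D (fn x * \<beta>) = fn x * D \<beta>"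
        by (simp add: D_def inner_fn_mult sum_distrib_left cscale_mult_right)
      then show ?thesis by (simp add: that)
    qed
    show "D (dw \<beta>) = 0" if "D \<beta> = 0" for \<beta>
    proof -
      \<comment> \<open>The Cartan formula is used for \<open>b\<close> and then for
        \<open>a\<close>, with \<open>inner_act_X\<close> in between to exchange
        \<open>inner a\<close> and \<open>act (X b)\<close>.\<close>
      have "inner a (inner b (dw \<beta>)) =
          (\<Sum>k=1..N. \<Sum>l=1..N. braid a b k l *\<^sub>C act (X k) (inner l \<beta>)) + (\<Sum>k=1..N. struct k a b *\<^sub>C inner k \<beta>)
          - act (X a) (inner b \<beta>) + dw (inner a (inner b \<beta>))"
        if "a \<in> {1..N}" "b \<in> {1..N}" for a b
        using that by (simp add: inner_dw clinear_diff[OF inner_linear] inner_act_X)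
      then have "D (dw \<beta>) =
          (\<Sum>a=1..N. \<Sum>b=1..N. v a b *\<^sub>C (\<Sum>k=1..N. \<Sum>l=1..N. braid a b k l *\<^sub>C act (X k) (inner l \<beta>)))
          + (\<Sum>a=1..N. \<Sum>b=1..N. v a b *\<^sub>C (\<Sum>k=1..N. struct k a b *\<^sub>C inner k \<beta>))
          - (\<Sum>a=1..N. \<Sum>b=1..N. v a b *\<^sub>C act (X a) (inner b \<beta>)) + dw (D \<beta>)"
        by (simp add: D_def cscale_add_right complex_vector.scale_right_diff_distrib sum.distrib sum_subtractf
            clinear_sum[OF dw_linear] clinear_scale[OF dw_linear])
      also have inv: "(\<Sum>a=1..N. \<Sum>b=1..N. v a b *\<^sub>C (\<Sum>k=1..N. \<Sum>l=1..N. braid a b k l *\<^sub>C act (X k) (inner l \<beta>))) =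
          (\<Sum>k=1..N. \<Sum>l=1..N. v k l *\<^sub>C act (X k) (inner l \<beta>))"
        by (rule braid_invariant_sum) (rule v)
      \<comment> \<open>After the use of invariance the terms with \<open>act\<close> cancel, and
        the differential of \<open>D \<beta>\<close> vanishes by hypothesis. Only the structure
        constants are left.\<close>
      also have "(\<Sum>k=1..N. \<Sum>l=1..N. v k l *\<^sub>C act (X k) (inner l \<beta>))
          + (\<Sum>a=1..N. \<Sum>b=1..N. v a b *\<^sub>C (\<Sum>k=1..N. struct k a b *\<^sub>C inner k \<beta>))
          - (\<Sum>a=1..N. \<Sum>b=1..N. v a b *\<^sub>C act (X a) (inner b \<beta>)) + dw (D \<beta>) =
          (\<Sum>a=1..N. \<Sum>b=1..N. \<Sum>k=1..N. (v a b * struct k a b) *\<^sub>C inner k \<beta>)"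
        by (simp add: that clinear_zero[OF dw_linear] complex_vector.scale_sum_right cscale_cscale)
      also have "\<dots> = (\<Sum>a=1..N. \<Sum>k=1..N. \<Sum>b=1..N. (v a b * struct k a b) *\<^sub>C inner k \<beta>)"
        by (rule sum.cong[OF refl], rule sum.swap)
      also have "\<dots> = (\<Sum>k=1..N. \<Sum>a=1..N. \<Sum>b=1..N. (v a b * struct k a b) *\<^sub>C inner k \<beta>)"
        by (rule sum.swap)
      also have "\<dots> = (\<Sum>k=1..N. (\<Sum>a=1..N. \<Sum>b=1..N. v a b * struct k a b) *\<^sub>C inner k \<beta>)"
        by (simp add: complex_vector.scale_sum_left)
      also have "\<dots> = 0"
        by (simp add: struct_zero complex_vector.scale_zero_left)
      finally show ?thesis .
    qed
  qed
  then show ?thesis by (simp add: D_def)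
qed

end


section \<open>Algebras given by generators and relations\<close>

lemma free_eval_eq_sum:
  assumes "finite K" "Poly_Mapping.keys p \<subseteq> K"
  shows "free_eval \<phi> p = (\<Sum>w\<in>K. Poly_Mapping.lookup p w *\<^sub>C prod_list (map \<phi> (letters w)))"
  unfolding free_eval_def using assms
  by (intro sum.mono_neutral_left) (auto simp: in_keys_iff complex_vector.scale_zero_left)

lemma clinear_free_eval: "clinear (free_eval \<phi>)"
proof -
  have "free_eval \<phi> (p + q) = free_eval \<phi> p + free_eval \<phi> q" for p q
  proof -
    let ?K = "Poly_Mapping.keys p \<union> Poly_Mapping.keys q"
    show ?thesis
      using free_eval_eq_sum[of ?K "p + q" \<phi>] free_eval_eq_sum[of ?K p \<phi>] free_eval_eq_sum[of ?K q \<phi>]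
        Poly_Mapping.keys_add[of p q]
      by (simp add: lookup_add cscale_add_left sum.distrib)
  qed
  moreover have "free_eval \<phi> (c *\<^sub>C p) = c *\<^sub>C free_eval \<phi> p" for c p
  proof -
    have "Poly_Mapping.keys (c *\<^sub>C p) \<subseteq> Poly_Mapping.keys p"
      by (auto simp: in_keys_iff lookup_cscale complex_vector.scale_zero_right)
    then show ?thesis
      using free_eval_eq_sum[of "Poly_Mapping.keys p" "c *\<^sub>C p" \<phi>]
        free_eval_eq_sum[of "Poly_Mapping.keys p" p \<phi>]
      by (simp add: lookup_cscale cscale_complex complex_vector.scale_sum_right cscale_cscale)
  qed
  ultimately show ?thesis by (simp add: clinear_iff)
qed

lemmas free_eval_linear = clinear_add[OF clinear_free_eval] clinear_scale[OF clinear_free_eval]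
  clinear_diff[OF clinear_free_eval] clinear_sum[OF clinear_free_eval] clinear_zero[OF clinear_free_eval]

lemma free_eval_single:
  "free_eval \<phi> (Poly_Mapping.single w c) = c *\<^sub>C prod_list (map \<phi> (letters w))"
  using free_eval_eq_sum[of "{w}" "Poly_Mapping.single w c" \<phi>] by simp

lemma free_eval_letter: "free_eval \<phi> (letter g) = \<phi> g"
  by (simp add: letter_def free_eval_single cscale_one)

lemma free_eval_one: "free_eval \<phi> 1 = 1"
  using free_eval_single[of \<phi> 0 1] by (simp add: zero_word_def cscale_one flip: single_one)

lemma free_eval_mult: "free_eval \<phi> (p * q) = free_eval \<phi> p * free_eval \<phi> q"
proof (induction p rule: poly_mapping_induct_single)
  case (single v b)
  show ?case
    by (induction q rule: poly_mapping_induct_single)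
      (simp_all add: mult_single free_eval_single plus_word_def cscale_mult_left cscale_mult_right cscale_cscale
        distrib_left free_eval_linear)
qed (simp add: distrib_right free_eval_linear)

lemmas free_eval_simps = free_eval_linear free_eval_letter free_eval_one free_eval_mult

lemma free_subalgebra_add: "p \<in> free_subalgebra G \<Longrightarrow> q \<in> free_subalgebra G \<Longrightarrow> p + q \<in> free_subalgebra G"
  using Poly_Mapping.keys_add[of p q] by (auto simp: free_subalgebra_def)

lemma free_subalgebra_scale: "p \<in> free_subalgebra G \<Longrightarrow> c *\<^sub>C p \<in> free_subalgebra G"
  by (auto simp: free_subalgebra_def in_keys_iff lookup_cscale complex_vector.scale_zero_right)

lemma free_subalgebra_diff: "p \<in> free_subalgebra G \<Longrightarrow> q \<in> free_subalgebra G \<Longrightarrow> p - q \<in> free_subalgebra G"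
  using free_subalgebra_add[of p G "(- 1) *\<^sub>C q"] free_subalgebra_scale[of q G "- 1"]
  by (simp add: complex_vector.scale_minus_left cscale_one)

lemma free_subalgebra_mult: "p \<in> free_subalgebra G \<Longrightarrow> q \<in> free_subalgebra G \<Longrightarrow> p * q \<in> free_subalgebra G"
  using keys_mult[of p q] by (fastforce simp: free_subalgebra_def plus_word_def)

lemma free_subalgebra_letter: "g \<in> G \<Longrightarrow> letter g \<in> free_subalgebra G"
  by (simp add: free_subalgebra_def letter_def)

lemma free_subalgebra_one: "1 \<in> free_subalgebra G"
  by (simp add: free_subalgebra_def zero_word_def flip: single_one)

lemma presented_algebra_relation:
  assumes "presented_algebra \<phi> G R" "r \<in> R"
  shows "free_eval \<phi> r = 0"
proof -
  have "1 * r * 1 \<in> ideal_generated (free_subalgebra G) R"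
    unfolding ideal_generated_def using assms(2) free_subalgebra_one[of G]
    by (blast intro: complex_vector.span_base)
  then have "r \<in> {p \<in> free_subalgebra G. free_eval \<phi> p = 0}"
    using assms(1) unfolding presented_algebra_def by (simp only: mult_1_left mult_1_right)
  then show ?thesis by simp
qed

lemma presented_algebra_induct [consumes 1, case_names one gen add scale mult]:
  assumes "presented_algebra \<phi> G R"
    and one: "Q 1" and gen: "\<And>g. g \<in> G \<Longrightarrow> Q (\<phi> g)"
    and add: "\<And>x y. Q x \<Longrightarrow> Q y \<Longrightarrow> Q (x + y)" and scale: "\<And>c x. Q x \<Longrightarrow> Q (c *\<^sub>C x)"
    and mult: "\<And>x y. Q x \<Longrightarrow> Q y \<Longrightarrow> Q (x * y)"
  shows "Q x"
proof -
  obtain p where p: "p \<in> free_subalgebra G" "x = free_eval \<phi> p"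
    using assms(1) unfolding presented_algebra_def by blast
  have zero: "Q 0" using scale[OF one, of 0] by (simp add: complex_vector.scale_zero_left)
  have word: "Q (prod_list (map \<phi> ws))" if "set ws \<subseteq> G" for ws
    using that by (induction ws) (simp_all add: one gen mult)
  have "Q (\<Sum>w\<in>K. Poly_Mapping.lookup p w *\<^sub>C prod_list (map \<phi> (letters w)))"
    if "finite K" "K \<subseteq> Poly_Mapping.keys p" for K
    using that
  proof (induction K)
    case (insert w K)
    then have "Q (prod_list (map \<phi> (letters w)))"
      using p(1) by (intro word) (simp add: free_subalgebra_def)
    with insert show ?case by (simp add: add scale)
  qed (simp add: zero)
  then show ?thesis by (simp add: p(2) free_eval_def)
qed

text \<open>The universal property of the presentation. A value of \<open>F\<close> is computed on a
  chosen preimage in the free algebra; two preimages differ by an element of the ideal, on which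
  evaluation at \<psi> vanishes.\<close>

lemma presented_algebra_hom:
  fixes \<phi> :: "'x \<Rightarrow> 'c::complex_algebra" and \<psi> :: "'x \<Rightarrow> 'e::complex_algebra"
  assumes pres: "presented_algebra \<phi> G R" and rel: "\<And>r. r \<in> R \<Longrightarrow> free_eval \<psi> r = 0"
  obtains F where "clinear F" "F 1 = 1" "\<And>x y. F (x * y) = F x * F y" "\<And>g. g \<in> G \<Longrightarrow> F (\<phi> g) = \<psi> g"
proof
  define F where "F x = free_eval \<psi> (SOME p. p \<in> free_subalgebra G \<and> free_eval \<phi> p = x)" for x
  have ideal: "free_eval \<psi> p = 0" if "p \<in> ideal_generated (free_subalgebra G) R" for p
    using that unfolding ideal_generated_def
    by (induction rule: cspan_induct) (auto simp: free_eval_simps rel complex_vector.scale_zero_right)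
  have F: "F (free_eval \<phi> p) = free_eval \<psi> p" if p: "p \<in> free_subalgebra G" for p
  proof -
    define q where "q = (SOME q. q \<in> free_subalgebra G \<and> free_eval \<phi> q = free_eval \<phi> p)"
    have q: "q \<in> free_subalgebra G \<and> free_eval \<phi> q = free_eval \<phi> p"
      unfolding q_def by (rule someI) (use p in blast)
    have "q - p \<in> {p \<in> free_subalgebra G. free_eval \<phi> p = 0}"
      using p q by (simp add: free_subalgebra_diff free_eval_linear)
    also have "\<dots> = ideal_generated (free_subalgebra G) R"
      using pres by (simp only: presented_algebra_def)
    finally have "free_eval \<psi> (q - p) = 0" by (rule ideal)
    then show ?thesis by (simp add: F_def flip: q_def) (simp add: free_eval_linear)
  qed
  have surj: "\<exists>p\<in>free_subalgebra G. x = free_eval \<phi> p" for x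
    using pres unfolding presented_algebra_def by blast
  show "clinear F"
    unfolding clinear_iff
  proof (intro conjI allI)
    fix x y c
    obtain p q where "p \<in> free_subalgebra G" "x = free_eval \<phi> p" "q \<in> free_subalgebra G" "y = free_eval \<phi> q"
      using surj by blast
    then show "F (x + y) = F x + F y" "F (c *\<^sub>C x) = c *\<^sub>C F x"
      using F[of "p + q"] F[of "c *\<^sub>C p"] F[of p] F[of q]
      by (simp_all add: free_subalgebra_add free_subalgebra_scale free_eval_linear)
  qed
  show "F 1 = 1" using F[OF free_subalgebra_one] by (simp add: free_eval_one)
  show "F (x * y) = F x * F y" for x y
  proof -
    obtain p q where "p \<in> free_subalgebra G" "x = free_eval \<phi> p" "q \<in> free_subalgebra G" "y = free_eval \<phi> q"
      using surj by blast
    then show ?thesis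
      using F[of "p * q"] F[of p] F[of q] by (simp add: free_subalgebra_mult free_eval_mult)
  qed
  show "F (\<phi> g) = \<psi> g" if "g \<in> G" for g
    using F[OF free_subalgebra_letter[OF that]] by (simp add: free_eval_letter)
qed

text \<open>\<open>presented_algebra_hom\<close> takes its target as a type of class
  \<open>complex_algebra\<close>, so the linear endomorphisms are made into a type with composition
  as product.\<close>

typedef (overloaded) 'w linear_endo = "{F :: 'w::complex_vector \<Rightarrow> 'w. clinear F}"
  morphisms endo_apply Endo
  by (rule exI[of _ "\<lambda>x. x"]) (simp add: clinear_iff)

setup_lifting type_definition_linear_endo

instantiation linear_endo :: (complex_algebra) complex_algebra
begin
lift_definition zero_linear_endo :: "'a linear_endo" is "\<lambda>x. 0"
  by (simp add: clinear_iff complex_vector.scale_zero_right)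
lift_definition one_linear_endo :: "'a linear_endo" is "\<lambda>x. x"
  by (simp add: clinear_iff)
lift_definition plus_linear_endo :: "'a linear_endo \<Rightarrow> 'a linear_endo \<Rightarrow> 'a linear_endo" is "\<lambda>F G x. F x + G x"
  by (simp add: clinear_iff cscale_add_right algebra_simps)
lift_definition minus_linear_endo :: "'a linear_endo \<Rightarrow> 'a linear_endo \<Rightarrow> 'a linear_endo" is "\<lambda>F G x. F x - G x"
  by (simp add: clinear_iff complex_vector.scale_right_diff_distrib algebra_simps)
lift_definition uminus_linear_endo :: "'a linear_endo \<Rightarrow> 'a linear_endo" is "\<lambda>F x. - F x"
  by (simp add: clinear_iff complex_vector.scale_minus_right)
lift_definition times_linear_endo :: "'a linear_endo \<Rightarrow> 'a linear_endo \<Rightarrow> 'a linear_endo" is "\<lambda>F G x. F (G x)"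
  by (simp add: clinear_iff)
lift_definition cscale_linear_endo :: "complex \<Rightarrow> 'a linear_endo \<Rightarrow> 'a linear_endo" is "\<lambda>c F x. c *\<^sub>C F x"
  by (simp add: clinear_iff cscale_add_right cscale_cscale mult.commute)
instance
proof
  \<comment> \<open>The identity is nonzero because the underlying space is a unital algebra with 0
    different from 1.\<close>
  show "(0 :: 'a linear_endo) \<noteq> 1" by transfer (metis zero_neq_one)
qed (transfer; simp add: fun_eq_iff clinear_iff cscale_add_right cscale_add_left cscale_cscale cscale_one algebra_simps; fail)+
end

lemmas endo_apply_simps = zero_linear_endo.rep_eq one_linear_endo.rep_eq plus_linear_endo.rep_eq
  minus_linear_endo.rep_eq times_linear_endo.rep_eq cscale_linear_endo.rep_eq

lemma endo_apply_sum: "endo_apply (\<Sum>i\<in>I. F i) x = (\<Sum>i\<in>I. endo_apply (F i) x)"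
  by (induction I rule: infinite_finite_induct) (simp_all add: endo_apply_simps)

lemma endo_apply_Endo: "clinear F \<Longrightarrow> endo_apply (Endo F) = F"
  by (simp add: Endo_inverse)

lemma endo_eqI: "(\<And>x. endo_apply F x = endo_apply G x) \<Longrightarrow> F = G"
  by (simp add: endo_apply_inject[symmetric] fun_eq_iff)

section \<open>Graded algebras\<close>

context super_algebra
begin

text \<open>Uniqueness, from the trivial intersection of the two components, is what gives the
  definite description in \<open>even_part\<close> its intended value.\<close>

lemma homogeneous_decomposition:
  assumes "y \<in> C0" "z \<in> C1"
  shows even_part_add: "even_part C0 C1 (y + z) = y" and odd_part_add: "odd_part C0 C1 (y + z) = z"
proof -
  show "even_part C0 C1 (y + z) = y"
    unfolding even_part_def
  proof (rule the_equality)
    show "y \<in> C0 \<and> y + z - y \<in> C1" using assms by simp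
    fix u assume u: "u \<in> C0 \<and> y + z - u \<in> C1"
    then have "u - y \<in> C0" "z - (y + z - u) \<in> C1"
      using assms even_subspace odd_subspace by (simp_all only: complex_vector.subspace_diff)
    then have "u - y \<in> C0 \<inter> C1" by simp
    then show "u = y" by (simp add: even_inter_odd)
  qed
  then show "odd_part C0 C1 (y + z) = z" by (simp add: odd_part_def)
qed

lemma zero_homogeneous: "0 \<in> C0" "0 \<in> C1"
  using even_subspace odd_subspace by (simp_all add: complex_vector.subspace_0)

abbreviation ev :: "'c \<Rightarrow> 'c" where "ev \<equiv> even_part C0 C1"
abbreviation od :: "'c \<Rightarrow> 'c" where "od \<equiv> odd_part C0 C1"
abbreviation gr :: "'c \<Rightarrow> 'c" where "gr \<equiv> grade_involution C0 C1"

lemma parts: "ev x \<in> C0" "od x \<in> C1" "x = ev x + od x"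
  using even_plus_odd[of x] by (auto simp: homogeneous_decomposition)

lemma homogeneous_cases:
  obtains y z where "y \<in> C0" "z \<in> C1" "x = y + z" "ev x = y" "od x = z" "gr x = y - z"
  using even_plus_odd[of x] by (auto simp: homogeneous_decomposition grade_involution_def)

lemma gr_add: "gr (y + z) = y - z" if "y \<in> C0" "z \<in> C1"
  using that by (simp add: grade_involution_def homogeneous_decomposition)

lemma gr_even: "y \<in> C0 \<Longrightarrow> gr y = y" and gr_odd: "z \<in> C1 \<Longrightarrow> gr z = - z"
  using gr_add[of y 0] gr_add[of 0 z] zero_homogeneous by simp_all

lemma clinear_parts: "clinear ev" "clinear od" "clinear gr"
proof -
  have "ev (x + y) = ev x + ev y \<and> od (x + y) = od x + od y" for x y
  proof (rule homogeneous_cases[of x], rule homogeneous_cases[of y])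
    fix a b u v assume *: "a \<in> C0" "b \<in> C1" "x = a + b" "ev x = a" "od x = b"
      "u \<in> C0" "v \<in> C1" "y = u + v" "ev y = u" "od y = v"
    have sum: "x + y = (a + u) + (b + v)" unfolding *(3,8) by (simp add: algebra_simps)
    have "a + u \<in> C0" "b + v \<in> C1"
      using * even_subspace odd_subspace by (simp_all add: complex_vector.subspace_add)
    then show ?thesis
      unfolding *(4,5,9,10) sum by (simp only: homogeneous_decomposition)
  qed
  moreover have "ev (c *\<^sub>C x) = c *\<^sub>C ev x \<and> od (c *\<^sub>C x) = c *\<^sub>C od x" for c x
  proof (rule homogeneous_cases[of x])
    fix a b assume *: "a \<in> C0" "b \<in> C1" "x = a + b" "ev x = a" "od x = b"
    then show ?thesis
      using homogeneous_decomposition[of "c *\<^sub>C a" "c *\<^sub>C b"] even_subspace odd_subspace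
      by (simp add: cscale_add_right complex_vector.subspace_scale)
  qed
  ultimately show "clinear ev" "clinear od" "clinear gr"
    by (simp_all add: clinear_iff grade_involution_def complex_vector.scale_right_diff_distrib)
qed

lemma gr_gr: "gr (gr x) = x"
proof (rule homogeneous_cases[of x])
  fix y z assume *: "y \<in> C0" "z \<in> C1" "x = y + z" "gr x = y - z"
  then have "- z \<in> C1" using odd_subspace by (simp add: complex_vector.subspace_neg)
  with * gr_add[of y "- z"] show ?thesis by simp
qed

lemma gr_mult: "gr (x * y) = gr x * gr y"
proof (rule homogeneous_cases[of x], rule homogeneous_cases[of y])
  fix a b u v assume *: "a \<in> C0" "b \<in> C1" "x = a + b" "gr x = a - b" "u \<in> C0" "v \<in> C1" "y = u + v" "gr y = u - v"
  have "a * u + b * v \<in> C0" "a * v + b * u \<in> C1"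
    using * even_subspace odd_subspace
    by (simp_all add: complex_vector.subspace_add even_even odd_odd even_odd odd_even)
  note gr = gr_add[OF this]
  have "x * y = (a * u + b * v) + (a * v + b * u)" unfolding *(3,7) by (simp add: algebra_simps)
  moreover have "gr x * gr y = (a * u + b * v) - (a * v + b * u)" unfolding *(4,8) by (simp add: algebra_simps)
  ultimately show ?thesis by (simp only: gr)
qed

text \<open>An involution has powers of period two, so the sign attached to a form of degree
  \<open>n\<close> depends on its parity only.\<close>

lemma gr_power_mod: "(gr ^^ n) x = (gr ^^ (n mod 2)) x"
proof (induction n rule: less_induct)
  case (less n)
  show ?case
  proof (cases "n < 2")
    case False
    then have n: "n = Suc (Suc (n - 2))" by simp
    have "(gr ^^ n) x = (gr ^^ (n - 2)) x" by (subst n) (simp add: gr_gr)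
    also have "\<dots> = (gr ^^ ((n - 2) mod 2)) x" using False by (intro less) simp
    also have "(n - 2) mod 2 = n mod 2" using False by (metis le_mod_geq not_less)
    finally show ?thesis .
  qed simp
qed

lemma gr_power_mult: "(gr ^^ n) (x * y) = (gr ^^ n) x * (gr ^^ n) y"
  by (induction n) (simp_all add: gr_mult)

lemma clinear_gr_power: "clinear (gr ^^ n)"
proof (induction n)
  case (Suc n)
  then show ?case using clinear_parts(3) by (simp add: clinear_iff)
qed (simp add: clinear_iff)

lemma gr_power_even: "y \<in> C0 \<Longrightarrow> (gr ^^ n) y = y"
  by (induction n) (simp_all add: gr_even)

lemma gr_power_odd: "z \<in> C1 \<Longrightarrow> (gr ^^ n) z = (- 1) ^ n *\<^sub>C z"
  by (induction n)
    (simp_all add: clinear_scale[OF clinear_parts(3)] gr_odd cscale_one complex_vector.scale_minus_left)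

end

section \<open>The action of the quantum Cartan algebra\<close>

locale cartan_calculus =
  exterior_algebra \<Delta> \<epsilon> S lact ract \<Delta>\<^sub>L \<Delta>\<^sub>R d N \<omega> f J pairing X \<iota>\<^sub>A \<iota>\<^sub>\<Gamma> \<sigma> \<pi> dw \<rho> inner +
  quantum_cartan_algebra \<Delta> \<epsilon> S lact ract \<Delta>\<^sub>L \<Delta>\<^sub>R d N \<omega> f J pairing X C0 C1 \<Delta>\<^sub>C \<epsilon>\<^sub>C S\<^sub>C \<sigma>\<^sub>t P t emb \<xi> \<delta>
  for \<Delta> :: "'a::complex_algebra \<Rightarrow> ('a, 'a) tensor"
    and \<epsilon> :: "'a \<Rightarrow> complex"
    and S :: "'a \<Rightarrow> 'a"
    and lact :: "'a \<Rightarrow> 'g::complex_vector \<Rightarrow> 'g"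
    and ract :: "'g \<Rightarrow> 'a \<Rightarrow> 'g"
    and \<Delta>\<^sub>L :: "'g \<Rightarrow> ('a, 'g) tensor"
    and \<Delta>\<^sub>R :: "'g \<Rightarrow> ('g, 'a) tensor"
    and d :: "'a \<Rightarrow> 'g"
    and N :: nat
    and \<omega> :: "nat \<Rightarrow> 'g"
    and f :: "nat \<Rightarrow> nat \<Rightarrow> 'a \<Rightarrow> complex"
    and J :: "nat \<Rightarrow> nat \<Rightarrow> 'a"
    and pairing :: "('a \<Rightarrow> complex) \<Rightarrow> 'g \<Rightarrow> complex"
    and X :: "nat \<Rightarrow> 'a \<Rightarrow> complex"
    and \<iota>\<^sub>A :: "'a \<Rightarrow> 't::complex_algebra"
    and \<iota>\<^sub>\<Gamma> :: "'g \<Rightarrow> 't"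
    and \<sigma> :: "'t \<Rightarrow> 't"
    and \<pi> :: "'t \<Rightarrow> 'w::complex_algebra"
    and dw :: "'w \<Rightarrow> 'w"
    and \<rho> :: "'w \<Rightarrow> ('w, 'a) tensor"
    and inner :: "nat \<Rightarrow> 'w \<Rightarrow> 'w"
    and C0 C1 :: "'c::complex_algebra set"
    and \<Delta>\<^sub>C :: "'c \<Rightarrow> ('c, 'c) tensor"
    and \<epsilon>\<^sub>C :: "'c \<Rightarrow> complex"
    and S\<^sub>C :: "'c \<Rightarrow> 'c"
    and \<sigma>\<^sub>t :: "('a \<Rightarrow> complex, 'a \<Rightarrow> complex) tensor \<Rightarrow> ('a \<Rightarrow> complex, 'a \<Rightarrow> complex) tensor"
    and P :: "(nat \<times> nat) set"
    and t :: "nat \<Rightarrow> nat \<Rightarrow> nat \<Rightarrow> nat \<Rightarrow> complex"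
    and emb :: "('a \<Rightarrow> complex) \<Rightarrow> 'c"
    and \<xi> :: "nat \<Rightarrow> 'c"
    and \<delta> :: 'c
begin

section \<open>Generators, relations and the operators they define\<close>

abbreviation gen :: "'a cartan_generator \<Rightarrow> 'c"
  where "gen \<equiv> case_cartan_generator emb \<xi> \<delta>"

lemma calculus_bialgebra_X: "i \<in> {1..N} \<Longrightarrow> X i \<in> calculus_bialgebra"
  and calculus_bialgebra_f: "i \<in> {1..N} \<Longrightarrow> j \<in> {1..N} \<Longrightarrow> f i j \<in> calculus_bialgebra"
  and calculus_bialgebra_unit: "\<epsilon> \<in> calculus_bialgebra"
  unfolding calculus_bialgebra_def by (blast intro: generated_dual_subalgebra.intros)+

lemma calculus_bialgebra_add: "g \<in> calculus_bialgebra \<Longrightarrow> h \<in> calculus_bialgebra \<Longrightarrow> g + h \<in> calculus_bialgebra"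
  and calculus_bialgebra_scale: "h \<in> calculus_bialgebra \<Longrightarrow> c *\<^sub>C h \<in> calculus_bialgebra"
  and calculus_bialgebra_conv:
    "g \<in> calculus_bialgebra \<Longrightarrow> h \<in> calculus_bialgebra \<Longrightarrow> convolution \<Delta> g h \<in> calculus_bialgebra"
  unfolding calculus_bialgebra_def by (rule generated_dual_subalgebra.intros; assumption)+

lemma calculus_bialgebra_induct [consumes 1, case_names X f unit add scale conv]:
  assumes "h \<in> calculus_bialgebra"
    and "\<And>i. i \<in> {1..N} \<Longrightarrow> Q (X i)" "\<And>i j. i \<in> {1..N} \<Longrightarrow> j \<in> {1..N} \<Longrightarrow> Q (f i j)" "Q \<epsilon>"
    and "\<And>g h. g \<in> calculus_bialgebra \<Longrightarrow> h \<in> calculus_bialgebra \<Longrightarrow> Q g \<Longrightarrow> Q h \<Longrightarrow> Q (g + h)"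
    and "\<And>c h. h \<in> calculus_bialgebra \<Longrightarrow> Q h \<Longrightarrow> Q (c *\<^sub>C h)"
    and "\<And>g h. g \<in> calculus_bialgebra \<Longrightarrow> h \<in> calculus_bialgebra \<Longrightarrow> Q g \<Longrightarrow> Q h \<Longrightarrow> Q (convolution \<Delta> g h)"
  shows "Q h"
  using assms(1) unfolding calculus_bialgebra_def
proof (induction rule: generated_dual_subalgebra.induct)
  case (gen h)
  then show ?case by (auto intro: assms(2,3))
qed (simp_all only: assms(4) assms(5-7)[unfolded calculus_bialgebra_def])

lemma calculus_bialgebra_linear: "h \<in> calculus_bialgebra \<Longrightarrow> clinear h"
proof (induction rule: calculus_bialgebra_induct)
  case (add g h)
  then show ?case by (simp add: clinear_iff algebra_simps)
next
  case (scale c h)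
  then show ?case
    unfolding clinear_iff by (simp add: cscale_fun_def cscale_add_right cscale_cscale mult.commute)
qed (simp_all add: X_linear f_linear counit_linear clinear_convolution)

lemmas gen_relation = presented_algebra_relation[OF cartan_presented]

lemma emb_unit: "emb \<epsilon> = 1"
proof -
  have "letter (Fun \<epsilon>) - 1 \<in> cartan_relations P t" unfolding cartan_relations_def by blast
  from gen_relation[OF this] show ?thesis by (simp add: free_eval_simps)
qed

lemma emb_add: "emb (g + h) = emb g + emb h"
  and emb_conv: "emb (convolution \<Delta> g h) = emb g * emb h"
  if "g \<in> calculus_bialgebra" "h \<in> calculus_bialgebra"
proof -
  have "letter (Fun (g + h)) - letter (Fun g) - letter (Fun h) \<in> cartan_relations P t"
    "letter (Fun (convolution \<Delta> g h)) - letter (Fun g) * letter (Fun h) \<in> cartan_relations P t"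
    unfolding cartan_relations_def using that by blast+
  from this[THEN gen_relation] show "emb (g + h) = emb g + emb h" "emb (convolution \<Delta> g h) = emb g * emb h"
    by (simp_all add: free_eval_simps algebra_simps)
qed

lemma emb_scale: "emb (c *\<^sub>C h) = c *\<^sub>C emb h" if "h \<in> calculus_bialgebra"
proof -
  have "letter (Fun (c *\<^sub>C h)) - c *\<^sub>C letter (Fun h) \<in> cartan_relations P t"
    unfolding cartan_relations_def using that by blast
  from gen_relation[OF this] show ?thesis by (simp add: free_eval_simps)
qed

text \<open>The presentation takes all of \<open>calculus_bialgebra\<close> as generators. Since
  \<open>emb\<close> turns convolution into the product and \<epsilon> into 1, the images of the
  \<open>X i\<close> and \<open>f i j\<close> suffice in even degree.\<close>

lemma cartan_induct [case_names one X f \<xi> \<delta> add scale mult]: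
  assumes one: "Q 1"
    and X: "\<And>i. i \<in> {1..N} \<Longrightarrow> Q (emb (X i))"
    and f: "\<And>i j. i \<in> {1..N} \<Longrightarrow> j \<in> {1..N} \<Longrightarrow> Q (emb (f i j))"
    and \<xi>: "\<And>i. i \<in> {1..N} \<Longrightarrow> Q (\<xi> i)" and \<delta>: "Q \<delta>"
    and add: "\<And>x y. Q x \<Longrightarrow> Q y \<Longrightarrow> Q (x + y)" and scale: "\<And>c x. Q x \<Longrightarrow> Q (c *\<^sub>C x)"
    and mult: "\<And>x y. Q x \<Longrightarrow> Q y \<Longrightarrow> Q (x * y)"
  shows "Q x"
  using cartan_presented
proof (induction rule: presented_algebra_induct)
  case (gen g)
  have "Q (emb h)" if "h \<in> calculus_bialgebra" for h
    using that
    by (induction rule: calculus_bialgebra_induct)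
      (simp_all only: X f one emb_unit emb_add emb_scale emb_conv add scale mult)
  with gen show ?case by (auto simp: cartan_generators_def \<xi> \<delta>)
qed (fact one add scale mult)+

text \<open>The defining property of \<open>t\<close>, evaluated at points dual to the basis of the tangent space.\<close>
lemma t_braid_invariant:
  assumes ij: "(i, j) \<in> P" and k: "k \<in> {1..N}" and l: "l \<in> {1..N}"
  defines "v \<equiv> \<lambda>a b. (if a = i then 1 else 0) * (if b = j then 1 else 0) + t i j a b"
  shows "(\<Sum>a=1..N. \<Sum>b=1..N. v a b * braid a b k l) = v k l"
proof -
  have i: "i \<in> {1..N}" and j: "j \<in> {1..N}" using ij P_pairs by auto
  obtain z where z: "\<And>i j. i \<in> {1..N} \<Longrightarrow> j \<in> {1..N} \<Longrightarrow> X i (z j) = (if i = j then 1 else 0)"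
    using dual_points by blast
  \<comment> \<open>Evaluating the two legs at the points dual to \<open>X k\<close> and
    \<open>X l\<close> extracts the coefficient of \<open>X k \<otimes> X l\<close>.\<close>
  define E where "E = tensor_lift (\<lambda>g h. g (z k) * h (z l) :: complex)"
  have bil: "cbilinear (\<lambda>g h. g (z k) * h (z l) :: complex)"
    by (simp add: cbilinear_iff cscale_fun_def cscale_complex algebra_simps)
  have E: "clinear E" unfolding E_def by (rule clinear_tensor_lift[OF bil])
  have E_tens: "E (X a \<otimes> X b) = (if k = a then 1 else 0) * (if l = b then 1 else 0)"
    if "a \<in> {1..N}" "b \<in> {1..N}" for a b
    unfolding E_def tensor_lift_tens[OF bil] using that k l by (simp add: z)
  have E_sum: "E (\<Sum>a=1..N. \<Sum>b=1..N. c a b *\<^sub>C (X a \<otimes> X b)) = c k l" for c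
  proof -
    have "E (\<Sum>a=1..N. \<Sum>b=1..N. c a b *\<^sub>C (X a \<otimes> X b)) =
        (\<Sum>a=1..N. (if k = a then 1 else 0) * (\<Sum>b=1..N. (if l = b then 1 else 0) * c a b))"
      by (simp add: clinear_sum[OF E] clinear_scale[OF E] E_tens cscale_complex sum_distrib_left mult_ac)
    then show ?thesis by (simp only: basis_sum(3)[OF k] basis_sum(3)[OF l])
  qed
  let ?s = "X i \<otimes> X j + (\<Sum>a=1..N. \<Sum>b=1..N. t i j a b *\<^sub>C (X a \<otimes> X b))"
  have "(\<Sum>a=1..N. \<Sum>b=1..N. ((if a = i then 1 else 0) * (if b = j then 1 else 0)) *\<^sub>C (X a \<otimes> X b)) = X i \<otimes> X j"
  proof -
    have "(\<Sum>a=1..N. \<Sum>b=1..N. ((if a = i then 1 else 0) * (if b = j then 1 else 0)) *\<^sub>C (X a \<otimes> X b)) =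
      (\<Sum>a=1..N. (if a = i then 1 else 0) *\<^sub>C (\<Sum>b=1..N. (if b = j then 1 else 0) *\<^sub>C (X a \<otimes> X b)))"
      by (simp only: complex_vector.scale_sum_right cscale_cscale)
    then show ?thesis by (simp only: basis_sum(2)[OF i] basis_sum(2)[OF j])
  qed
  then have s: "?s = (\<Sum>a=1..N. \<Sum>b=1..N. v a b *\<^sub>C (X a \<otimes> X b))"
    by (simp only: v_def cscale_add_left sum.distrib)
  have "?s \<in> cspan {X i \<otimes> X j + (\<Sum>k=1..N. \<Sum>l=1..N. t i j k l *\<^sub>C (X k \<otimes> X l)) | i j. (i, j) \<in> P}"
    by (rule complex_vector.span_base) (use ij in blast)
  then have "\<sigma>\<^sub>t ?s = ?s" unfolding t_spans[symmetric] by blast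
  then have "v k l = E (\<sigma>\<^sub>t ?s)" unfolding s by (simp only: E_sum)
  also have "\<dots> = (\<Sum>a=1..N. \<Sum>b=1..N. v a b * E (\<Sum>k=1..N. \<Sum>l=1..N. braid a b k l *\<^sub>C (X k \<otimes> X l)))"
    unfolding s
    by (simp add: clinear_sum[OF \<sigma>t_linear] clinear_scale[OF \<sigma>t_linear] \<sigma>t_basis cscale_complex
        clinear_sum[OF E, of _ "{1..N}"] clinear_scale[OF E])
  also have "\<dots> = (\<Sum>a=1..N. \<Sum>b=1..N. v a b * braid a b k l)" by (simp only: E_sum)
  finally show ?thesis by simp
qed

definition generator_operator :: "'a cartan_generator \<Rightarrow> 'w linear_endo"
  where "generator_operator = case_cartan_generator (\<lambda>h. Endo (act h)) (\<lambda>i. Endo (inner i)) (Endo dw)"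

lemma generator_operator_apply:
  "h \<in> calculus_bialgebra \<Longrightarrow> endo_apply (generator_operator (Fun h)) = act h"
  "i \<in> {1..N} \<Longrightarrow> endo_apply (generator_operator (Xi i)) = inner i"
  "endo_apply (generator_operator Delta) = dw"
  by (simp_all add: generator_operator_def endo_apply_Endo calculus_bialgebra_linear inner_linear dw_linear
      exterior.clinear_coaction_dual_action)

lemma generator_operator_relations:
  assumes "r \<in> cartan_relations P t"
  shows "free_eval generator_operator r = 0"
proof (rule endo_eqI)
  fix \<alpha>
  note simps = free_eval_simps endo_apply_simps endo_apply_sum generator_operator_apply
    calculus_bialgebra_X calculus_bialgebra_f calculus_bialgebra_unit calculus_bialgebra_add
    calculus_bialgebra_scale calculus_bialgebra_conv
  \<comment> \<open>The array \<open>v\<close> from \<open>t_braid_invariant\<close>, an indicator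
    plus \<open>t\<close>, is inserted into \<open>inner_inner_relation\<close>; the indicator part
    of the sum collapses to the leading term.\<close>
  have quadratic: "inner i (inner j \<alpha>) + (\<Sum>k=1..N. \<Sum>l=1..N. t i j k l *\<^sub>C inner k (inner l \<alpha>)) = 0"
    if ij: "(i, j) \<in> P" for i j
  proof -
    have i: "i \<in> {1..N}" and j: "j \<in> {1..N}" using ij P_pairs by auto
    have "(\<Sum>a=1..N. \<Sum>b=1..N. ((if a = i then 1 else 0) * (if b = j then 1 else 0) + t i j a b) *\<^sub>C inner a (inner b \<alpha>)) = 0"
      by (rule inner_inner_relation) (rule t_braid_invariant[OF ij])
    moreover have "(\<Sum>a=1..N. \<Sum>b=1..N. ((if a = i then 1 else 0) * (if b = j then 1 else 0)) *\<^sub>C inner a (inner b \<alpha>)) =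
        (\<Sum>a=1..N. (if a = i then 1 else 0) *\<^sub>C (\<Sum>b=1..N. (if b = j then 1 else 0) *\<^sub>C inner a (inner b \<alpha>)))"
      by (simp only: complex_vector.scale_sum_right cscale_cscale)
    ultimately show ?thesis
      by (simp only: cscale_add_left sum.distrib basis_sum(2)[OF i] basis_sum(2)[OF j])
  qed
  have P_index: "i \<in> {1..N}" "j \<in> {1..N}" if "(i, j) \<in> P" for i j
    using that P_pairs by auto
  \<comment> \<open>One case per family of relations: the first four are the laws of the comodule
    action, \<open>Xi\<close> with \<open>Delta\<close> is the Cartan formula, and the rest are
    \<open>quadratic\<close>, \<open>dw_dw\<close>, \<open>inner_act_f\<close>,
    \<open>inner_act_X\<close> and \<open>act_dw\<close>.\<close>
  from assms show "endo_apply (free_eval generator_operator r) \<alpha> = endo_apply 0 \<alpha>"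
    unfolding cartan_relations_def
    by (elim UnE CollectE exE conjE singletonE)
      (simp_all add: simps P_index quadratic exterior.dual_action_add exterior.dual_action_scale
        exterior.dual_action_convolution exterior.dual_action_counit calculus_bialgebra_linear
        inner_dw inner_act_f inner_act_X dw_dw act_dw f_linear X_linear)
qed

section \<open>Parity and existence of the action\<close>

abbreviation cartan_operators :: "('c \<Rightarrow> 'w \<Rightarrow> 'w) \<Rightarrow> bool"
  where "cartan_operators \<equiv> cartan_action C0 C1 forms N f X emb \<xi> \<delta> \<rho> inner dw"

text \<open>For \<open>s\<close> equal to 0 and 1 these are the even and odd components that occur
  in \<open>super_representation\<close>.\<close>

definition parity_forms :: "nat \<Rightarrow> 'w set"
  where "parity_forms s = cspan (\<Union>n. forms (2 * n + s))"

lemma parity_forms_subspace: "csubspace (parity_forms s)"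
  by (simp add: parity_forms_def complex_vector.subspace_span)

lemma forms_parity: "\<alpha> \<in> forms n \<Longrightarrow> \<alpha> \<in> parity_forms (n mod 2)"
proof -
  have "n = 2 * (n div 2) + n mod 2" by simp
  then show "\<alpha> \<in> forms n \<Longrightarrow> \<alpha> \<in> parity_forms (n mod 2)"
    unfolding parity_forms_def by (intro complex_vector.span_base) (metis UN_iff UNIV_I)
qed

lemma parity_forms_eqI:
  assumes "\<alpha> \<in> parity_forms s" "clinear F" "clinear G"
    and "\<And>n \<alpha>. \<alpha> \<in> forms (2 * n + s) \<Longrightarrow> F \<alpha> = G \<alpha>"
  shows "F \<alpha> = G \<alpha>"
  using assms(1) unfolding parity_forms_def
  by (induction rule: cspan_induct)
    (auto simp: clinear_zero[OF assms(2)] clinear_zero[OF assms(3)] clinear_add[OF assms(2)]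
      clinear_add[OF assms(3)] clinear_scale[OF assms(2)] clinear_scale[OF assms(3)] assms(4))

lemma parity_forms_image:
  assumes F: "clinear F" and "\<And>n \<alpha>. \<alpha> \<in> forms n \<Longrightarrow> n mod 2 = s \<Longrightarrow> F \<alpha> \<in> parity_forms r" and s: "s < 2"
  shows "F ` parity_forms s \<subseteq> parity_forms r"
proof (rule image_subsetI)
  fix \<alpha> assume "\<alpha> \<in> parity_forms s"
  then show "F \<alpha> \<in> parity_forms r"
    unfolding parity_forms_def[of s]
  proof (induction rule: cspan_induct)
    case zero
    then show ?case using parity_forms_subspace by (simp add: clinear_zero[OF F] complex_vector.subspace_0)
  next
    case (step c b y)
    then obtain n where "b \<in> forms (2 * n + s)" by blast
    then have "F b \<in> parity_forms r" using assms(2)[of b "2 * n + s"] s by simp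
    with step(2) show ?case
      using parity_forms_subspace
      by (simp add: clinear_add[OF F] clinear_scale[OF F] complex_vector.subspace_add complex_vector.subspace_scale)
  qed
qed

definition shifts_parity :: "nat \<Rightarrow> ('w \<Rightarrow> 'w) \<Rightarrow> bool"
  where "shifts_parity q F \<longleftrightarrow>
    F ` parity_forms 0 \<subseteq> parity_forms (q mod 2) \<and> F ` parity_forms 1 \<subseteq> parity_forms (Suc q mod 2)"

lemma shifts_parityI:
  assumes F: "clinear F" and deg: "\<And>n \<alpha>. \<alpha> \<in> forms n \<Longrightarrow> F \<alpha> \<in> parity_forms ((n + q) mod 2)"
  shows "shifts_parity q F"
  unfolding shifts_parity_def
proof (intro conjI parity_forms_image F)
  fix n \<alpha> assume \<alpha>: "\<alpha> \<in> forms n"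
  have "(n + q) mod 2 = (n mod 2 + q) mod 2" by (simp add: mod_simps)
  with deg[OF \<alpha>] show "n mod 2 = 0 \<Longrightarrow> F \<alpha> \<in> parity_forms (q mod 2)"
    "n mod 2 = 1 \<Longrightarrow> F \<alpha> \<in> parity_forms (Suc q mod 2)"
    by (simp_all add: plus_1_eq_Suc)
qed simp_all

lemma shifts_parity_add: "shifts_parity q F \<Longrightarrow> shifts_parity q G \<Longrightarrow> shifts_parity q (\<lambda>x. F x + G x)"
  and shifts_parity_scale: "shifts_parity q F \<Longrightarrow> shifts_parity q (\<lambda>x. c *\<^sub>C F x)"
  unfolding shifts_parity_def image_subset_iff
  using parity_forms_subspace
  by (simp_all add: complex_vector.subspace_add complex_vector.subspace_scale)

lemma shifts_parity_comp:
  "shifts_parity 0 F \<Longrightarrow> shifts_parity 0 G \<Longrightarrow> shifts_parity 0 (\<lambda>x. F (G x))"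
  "shifts_parity 0 F \<Longrightarrow> shifts_parity 1 G \<Longrightarrow> shifts_parity 1 (\<lambda>x. F (G x))"
  "shifts_parity 1 F \<Longrightarrow> shifts_parity 0 G \<Longrightarrow> shifts_parity 1 (\<lambda>x. F (G x))"
  "shifts_parity 1 F \<Longrightarrow> shifts_parity 1 G \<Longrightarrow> shifts_parity 0 (\<lambda>x. F (G x))"
  unfolding shifts_parity_def image_subset_iff by (simp_all add: numeral_2_eq_2)

lemma generators_shift_parity:
  "clinear h \<Longrightarrow> shifts_parity 0 (act h)"
  "i \<in> {1..N} \<Longrightarrow> shifts_parity 1 (inner i)"
  "shifts_parity 1 dw"
proof -
  show "clinear h \<Longrightarrow> shifts_parity 0 (act h)"
    by (rule shifts_parityI) (simp_all only: exterior.clinear_coaction_dual_action act_forms forms_parity add_0_right)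
  show "shifts_parity 1 dw"
  proof (rule shifts_parityI[OF dw_linear])
    fix n \<alpha> assume "\<alpha> \<in> forms n"
    from forms_parity[OF dw_degree[OF this]] show "dw \<alpha> \<in> parity_forms ((n + 1) mod 2)"
      by (simp only: Suc_eq_plus1)
  qed
  assume i: "i \<in> {1..N}"
  show "shifts_parity 1 (inner i)"
  proof (rule shifts_parityI[OF inner_linear[OF i]])
    fix n \<alpha> assume \<alpha>: "\<alpha> \<in> forms n"
    show "inner i \<alpha> \<in> parity_forms ((n + 1) mod 2)"
    proof (cases n)
      case 0
      then have "inner i \<alpha> = 0" using \<alpha> i by (auto simp: inner_zero)
      then show ?thesis using parity_forms_subspace by (simp add: complex_vector.subspace_0)
    next
      case (Suc m)
      have "(n + 1) mod 2 = m mod 2" by (simp add: Suc One_nat_def)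
      then show ?thesis using forms_parity[OF inner_degree[OF i \<alpha>[unfolded Suc]]] by simp
    qed
  qed
qed

lemma super_representation_iff:
  "super_representation C0 C1 forms lam \<longleftrightarrow>
    clinear lam \<and> (\<forall>x. clinear (lam x)) \<and> lam 1 = id \<and> (\<forall>x y. lam (x * y) = lam x \<circ> lam y) \<and>
    (\<forall>x\<in>C0. shifts_parity 0 (lam x)) \<and> (\<forall>x\<in>C1. shifts_parity 1 (lam x))"
  by (simp add: super_representation_def Let_def shifts_parity_def parity_forms_def numeral_2_eq_2)

text \<open>The operators satisfy the relations, so the universal property yields a homomorphism
  into \<open>linear_endo\<close>. What is left to show is that it respects the grading.\<close>

lemma cartan_action_exists: "\<exists>lam. cartan_operators lam"
proof -
  obtain F where F: "clinear F" "F 1 = 1" "\<And>x y. F (x * y) = F x * F y"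
    and F_gen: "\<And>g. g \<in> cartan_generators \<Longrightarrow> F (gen g) = generator_operator g"
    using presented_algebra_hom[OF cartan_presented generator_operator_relations] by blast
  define lam where "lam x = endo_apply (F x)" for x
  have lam_add: "lam (x + y) = (\<lambda>\<alpha>. lam x \<alpha> + lam y \<alpha>)" and lam_scale: "lam (c *\<^sub>C x) = (\<lambda>\<alpha>. c *\<^sub>C lam x \<alpha>)"
    and lam_mult: "lam (x * y) = (\<lambda>\<alpha>. lam x (lam y \<alpha>))" for c x y
    by (simp_all add: lam_def clinear_add[OF F(1)] clinear_scale[OF F(1)] F(3) endo_apply_simps)
  have lam_one: "lam 1 = (\<lambda>\<alpha>. \<alpha>)" by (simp add: lam_def F(2) endo_apply_simps)
  have lam_gen: "i \<in> {1..N} \<Longrightarrow> lam (emb (X i)) = act (X i)"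
    "i \<in> {1..N} \<Longrightarrow> j \<in> {1..N} \<Longrightarrow> lam (emb (f i j)) = act (f i j)"
    "i \<in> {1..N} \<Longrightarrow> lam (\<xi> i) = inner i" "lam \<delta> = dw" for i j
    using F_gen[of "Fun (X i)"] F_gen[of "Fun (f i j)"] F_gen[of "Xi i"] F_gen[of Delta]
    by (simp_all add: cartan_generators_def lam_def generator_operator_apply calculus_bialgebra_X calculus_bialgebra_f)
  \<comment> \<open>\<open>C0\<close> and \<open>C1\<close> are given abstractly and not as spans of
    words. Induction over the generators produces, for every element, a decomposition whose parts
    are homogeneous and also shift the parity of forms correctly.\<close>
  have graded: "\<exists>y z. x = y + z \<and> y \<in> C0 \<and> shifts_parity 0 (lam y) \<and> z \<in> C1 \<and> shifts_parity 1 (lam z)" for x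
  proof -
    define Ev where "Ev y \<longleftrightarrow> y \<in> C0 \<and> shifts_parity 0 (lam y)" for y
    define Od where "Od z \<longleftrightarrow> z \<in> C1 \<and> shifts_parity 1 (lam z)" for z
    have lam_zero: "lam 0 = (\<lambda>\<alpha>. 0)"
      using lam_scale[of 0 0] by (simp add: complex_vector.scale_zero_left)
    have closed: "Ev y \<Longrightarrow> Ev y' \<Longrightarrow> Ev (y + y')" "Od y \<Longrightarrow> Od y' \<Longrightarrow> Od (y + y')"
      "Ev y \<Longrightarrow> Ev (c *\<^sub>C y)" "Od y \<Longrightarrow> Od (c *\<^sub>C y)"
      "Ev y \<Longrightarrow> Ev y' \<Longrightarrow> Ev (y * y')" "Od y \<Longrightarrow> Od y' \<Longrightarrow> Ev (y * y')"
      "Ev y \<Longrightarrow> Od y' \<Longrightarrow> Od (y * y')" "Od y \<Longrightarrow> Ev y' \<Longrightarrow> Od (y * y')" for y y' c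
      unfolding Ev_def Od_def lam_add lam_scale lam_mult
      using cartan.even_subspace cartan.odd_subspace
      by (auto intro: shifts_parity_add shifts_parity_scale shifts_parity_comp
          complex_vector.subspace_add complex_vector.subspace_scale
          cartan.even_even cartan.odd_odd cartan.even_odd cartan.odd_even)
    have zero: "Ev 0" "Od 0"
      unfolding Ev_def Od_def lam_zero using cartan.zero_homogeneous parity_forms_subspace
      by (auto simp: shifts_parity_def complex_vector.subspace_0)
    have "\<exists>y z. x = y + z \<and> Ev y \<and> Od z"
    proof (induction x rule: cartan_induct)
      case one
      have "Ev 1" by (auto simp: Ev_def cartan.one_even lam_one shifts_parity_def)
      then show ?case using zero by (metis add_0_right)
    next
      case (X i)
      then have "Ev (emb (X i))"
        by (simp add: Ev_def emb_even calculus_bialgebra_X lam_gen generators_shift_parity X_linear)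
      then show ?case using zero by (metis add_0_right)
    next
      case (f i j)
      then have "Ev (emb (f i j))"
        by (simp add: Ev_def emb_even calculus_bialgebra_f lam_gen generators_shift_parity f_linear)
      then show ?case using zero by (metis add_0_right)
    next
      case (\<xi> i)
      then have "Od (\<xi> i)" by (simp add: Od_def \<xi>_odd lam_gen generators_shift_parity)
      then show ?case using zero by (metis add_0_left)
    next
      case \<delta>
      have "Od \<delta>" by (simp add: Od_def \<delta>_odd lam_gen generators_shift_parity)
      then show ?case using zero by (metis add_0_left)
    next
      case (add x x')
      then obtain y z y' z' where *: "x = y + z" "Ev y" "Od z" "x' = y' + z'" "Ev y'" "Od z'" by blast
      then have "x + x' = (y + y') + (z + z')" by (simp add: algebra_simps)
      with * closed show ?case by blast
    next
      case (scale c x)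
      then show ?case using closed by (metis cscale_add_right)
    next
      case (mult x x')
      then obtain y z y' z' where *: "x = y + z" "Ev y" "Od z" "x' = y' + z'" "Ev y'" "Od z'" by blast
      then have "x * x' = (y * y' + z * z') + (y * z' + z * y')" by (simp add: algebra_simps)
      moreover have "Ev (y * y' + z * z')"
        by (rule closed(1)[OF closed(5)[OF *(2,5)] closed(6)[OF *(3,6)]])
      moreover have "Od (y * z' + z * y')"
        by (rule closed(2)[OF closed(7)[OF *(2,6)] closed(8)[OF *(3,5)]])
      ultimately show ?case by blast
    qed
    then show ?thesis unfolding Ev_def Od_def by blast
  qed
  \<comment> \<open>For an even element the odd part of that decomposition lies in
    \<open>C0 \<inter> C1\<close> and vanishes, so the element is its own even part.\<close>
  have even: "shifts_parity 0 (lam x)" if "x \<in> C0" for x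
  proof -
    obtain y z where *: "x = y + z" "y \<in> C0" "shifts_parity 0 (lam y)" "z \<in> C1" using graded by blast
    have "z \<in> C0 \<inter> C1"
      using complex_vector.subspace_diff[OF cartan.even_subspace that *(2)] * by simp
    then show ?thesis using * by (simp add: cartan.even_inter_odd)
  qed
  have odd: "shifts_parity 1 (lam x)" if "x \<in> C1" for x
  proof -
    obtain y z where *: "x = y + z" "y \<in> C0" "z \<in> C1" "shifts_parity 1 (lam z)" using graded by blast
    have "y \<in> C0 \<inter> C1"
      using complex_vector.subspace_diff[OF cartan.odd_subspace that *(3)] * by simp
    then show ?thesis using * by (simp add: cartan.even_inter_odd)
  qed
  have "clinear (lam x)" for x using endo_apply[of "F x"] by (simp add: lam_def)
  moreover have "clinear lam" by (simp add: clinear_iff lam_add lam_scale cscale_fun_def plus_fun_def)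
  ultimately have "super_representation C0 C1 forms lam"
    by (simp add: super_representation_iff even odd lam_one lam_mult fun_eq_iff)
  then show ?thesis by (auto simp: cartan_action_def lam_gen)
qed

section \<open>Compatibility of the action with products and unit\<close>

context
  fixes lam
  assumes action: "cartan_operators lam"
begin

lemma action_representation:
  "lam 1 \<alpha> = \<alpha>" "lam (x + y) \<alpha> = lam x \<alpha> + lam y \<alpha>" "lam (c *\<^sub>C x) \<alpha> = c *\<^sub>C lam x \<alpha>"
  "lam (x * y) \<alpha> = lam x (lam y \<alpha>)"
  "lam x (\<alpha> + \<beta>) = lam x \<alpha> + lam x \<beta>" "lam x (c *\<^sub>C \<alpha>) = c *\<^sub>C lam x \<alpha>"
  using action clinear_add[of lam x y] clinear_scale[of lam c x]
    clinear_add[of "lam x" \<alpha> \<beta>] clinear_scale[of "lam x" c \<alpha>]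
  by (simp_all add: cartan_action_def super_representation_iff cscale_fun_def)

lemma action_linear: "clinear (lam x)"
  by (simp add: clinear_iff action_representation)

lemma action_generators:
  "i \<in> {1..N} \<Longrightarrow> lam (emb (X i)) = act (X i)"
  "i \<in> {1..N} \<Longrightarrow> j \<in> {1..N} \<Longrightarrow> lam (emb (f i j)) = act (f i j)"
  "i \<in> {1..N} \<Longrightarrow> lam (\<xi> i) = inner i" "lam \<delta> = dw"
  using action by (simp_all add: cartan_action_def)

lemma action_parity:
  assumes "\<alpha> \<in> parity_forms s" "s < 2"
  shows "y \<in> C0 \<Longrightarrow> lam y \<alpha> \<in> parity_forms s" "y \<in> C1 \<Longrightarrow> lam y \<alpha> \<in> parity_forms (1 - s)"
proof -
  have "y \<in> C0 \<Longrightarrow> shifts_parity 0 (lam y)" "y \<in> C1 \<Longrightarrow> shifts_parity 1 (lam y)"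
    using action by (simp_all add: cartan_action_def super_representation_iff)
  moreover have "s = 0 \<or> s = 1" using assms(2) by auto
  ultimately show "y \<in> C0 \<Longrightarrow> lam y \<alpha> \<in> parity_forms s" "y \<in> C1 \<Longrightarrow> lam y \<alpha> \<in> parity_forms (1 - s)"
    using assms(1) by (auto simp: shifts_parity_def image_subset_iff numeral_2_eq_2)
qed

abbreviation coproduct_action :: "nat \<Rightarrow> 'c \<Rightarrow> 'w \<Rightarrow> 'w \<Rightarrow> 'w"
  where "coproduct_action s x \<alpha> \<beta> \<equiv> tensor_lift (\<lambda>y z. lam y \<alpha> * lam ((cartan.gr ^^ s) z) \<beta>) (\<Delta>\<^sub>C x)"

lemma coproduct_action_bilinear: "cbilinear (\<lambda>y z. lam y \<alpha> * lam ((cartan.gr ^^ s) z) \<beta>)"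
  by (simp add: cbilinear_iff action_representation clinear_add[OF cartan.clinear_gr_power]
      clinear_scale[OF cartan.clinear_gr_power] distrib_left distrib_right cscale_mult_left cscale_mult_right)

text \<open>Formulated on parity components and not on degrees: homogeneous elements of the Cartan
  algebra control only the parity of a form, and products need the property again for
  \<open>lam y \<alpha>\<close>.\<close>

definition acts_by_coproduct :: "'c \<Rightarrow> bool"
  where "acts_by_coproduct x \<longleftrightarrow>
    (\<forall>s<2. \<forall>\<alpha>\<in>parity_forms s. \<forall>\<beta>. lam x (\<alpha> * \<beta>) = coproduct_action s x \<alpha> \<beta>)"

text \<open>Splitting \<open>x'\<^sub>(\<^sub>1\<^sub>)\<close> into its even and odd part makes the first factor homogeneous, so that the
  hypothesis on \<open>x\<close> applies; the signs are those of \<open>super_tensor_mult\<close>.\<close>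
lemma acts_by_coproduct_mult:
  assumes x: "acts_by_coproduct x" and x': "acts_by_coproduct x'"
  shows "acts_by_coproduct (x * x')"
  unfolding acts_by_coproduct_def
proof (intro allI impI ballI)
  fix s :: nat and \<alpha> \<beta> assume s: "s < 2" and \<alpha>: "\<alpha> \<in> parity_forms s"
  let ?g = "\<lambda>s. cartan.gr ^^ s"
  note bil = coproduct_action_bilinear
  \<comment> \<open>An odd element moves \<alpha> to the opposite parity, which amounts to one
    further application of the grade involution to the second leg.\<close>
  have flip: "?g (1 - s) z = ?g s (cartan.gr z)" for z
    using s by (cases s) (auto simp: cartan.gr_gr less_2_cases_iff One_nat_def)
  have inner: "lam x (lam y' \<alpha> * lam (?g s z') \<beta>) = tensor_lift (\<lambda>y z.
      lam (y * cartan.ev y') \<alpha> * lam (?g s (z * z')) \<beta> +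
      lam (y * cartan.od y') \<alpha> * lam (?g s (cartan.gr z * z')) \<beta>) (\<Delta>\<^sub>C x)" for y' z'
  proof -
    have "lam x (lam (cartan.ev y') \<alpha> * lam (?g s z') \<beta>) =
        coproduct_action s x (lam (cartan.ev y') \<alpha>) (lam (?g s z') \<beta>)"
      using x s action_parity(1)[OF \<alpha> s cartan.parts(1)] unfolding acts_by_coproduct_def by blast
    moreover have "lam x (lam (cartan.od y') \<alpha> * lam (?g s z') \<beta>) =
        coproduct_action (1 - s) x (lam (cartan.od y') \<alpha>) (lam (?g s z') \<beta>)"
      using x action_parity(2)[OF \<alpha> s cartan.parts(2)] unfolding acts_by_coproduct_def by simp
    moreover have "lam y' \<alpha> = lam (cartan.ev y') \<alpha> + lam (cartan.od y') \<alpha>"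
      by (subst cartan.parts(3)) (rule action_representation(2))
    ultimately show ?thesis
      by (simp add: distrib_right action_representation flip cartan.gr_power_mult tensor_lift_fun_add)
  qed
  have "lam (x * x') (\<alpha> * \<beta>) = lam x (coproduct_action s x' \<alpha> \<beta>)"
    using x' s \<alpha> by (simp add: acts_by_coproduct_def action_representation)
  also have "\<dots> = tensor_lift (\<lambda>y' z'. lam x (lam y' \<alpha> * lam (?g s z') \<beta>)) (\<Delta>\<^sub>C x')"
    by (rule clinear_tensor_lift_commute[OF action_linear])
  also have "\<dots> = tensor_lift (\<lambda>y z. tensor_lift (\<lambda>y' z'.
      lam (y * cartan.ev y') \<alpha> * lam (?g s (z * z')) \<beta> +
      lam (y * cartan.od y') \<alpha> * lam (?g s (cartan.gr z * z')) \<beta>) (\<Delta>\<^sub>C x')) (\<Delta>\<^sub>C x)"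
    unfolding inner by (rule tensor_lift_swap)
  also have "\<dots> = coproduct_action s (x * x') \<alpha> \<beta>"
    unfolding cartan.super_comult_mult super_tensor_mult_def
    by (simp add: tensor_lift_tensor_lift[OF bil] tensor_lift_add[OF bil] tensor_lift_tens[OF bil])
  finally show "lam (x * x') (\<alpha> * \<beta>) = coproduct_action s (x * x') \<alpha> \<beta>" .
qed

text \<open>On generators the coproducts are the Leibniz rules of the four kinds of operators;
  products are handled by \<open>acts_by_coproduct_mult\<close>.\<close>

lemma acts_by_coproduct: "acts_by_coproduct x"
proof (induction x rule: cartan_induct)
  note tens = tensor_lift_add[OF coproduct_action_bilinear] tensor_lift_sum[OF coproduct_action_bilinear]
    tensor_lift_tens[OF coproduct_action_bilinear] action_representation action_generators
    cartan.gr_power_even cartan.gr_power_odd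
  {
    case one
    show ?case by (simp add: acts_by_coproduct_def cartan.super_comult_one tens cartan.one_even)
  next
    case (X i)
    then show ?case
      by (simp add: acts_by_coproduct_def comult_X tens emb_even calculus_bialgebra_X calculus_bialgebra_f act_X_mult)
  next
    case (f i j)
    then show ?case
      by (simp add: acts_by_coproduct_def comult_f tens emb_even calculus_bialgebra_f act_f_mult)
  next
    case (\<xi> i)
    \<comment> \<open>The product rule is known degree by degree. Its sign is the same for all
      degrees \<open>2 * n + s\<close>, so by linearity it extends to the whole parity
      component.\<close>
    have "inner i (\<alpha> * \<beta>) = (- 1) ^ s *\<^sub>C (\<alpha> * inner i \<beta>) + (\<Sum>j=1..N. inner j \<alpha> * act (f j i) \<beta>)"
      if "\<alpha> \<in> parity_forms s" for s \<alpha> \<beta>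
      using that
    proof (rule parity_forms_eqI)
      show "clinear (\<lambda>\<alpha>. inner i (\<alpha> * \<beta>))"
        "clinear (\<lambda>\<alpha>. (- 1) ^ s *\<^sub>C (\<alpha> * inner i \<beta>) + (\<Sum>j=1..N. inner j \<alpha> * act (f j i) \<beta>))"
        unfolding clinear_iff using \<xi>
        by (simp_all add: clinear_add[OF inner_linear] clinear_scale[OF inner_linear] distrib_right
            cscale_mult_left cscale_add_right cscale_cscale complex_vector.scale_sum_right sum.distrib mult.commute add_ac)
      show "inner i (\<alpha> * \<beta>) = (- 1) ^ s *\<^sub>C (\<alpha> * inner i \<beta>) + (\<Sum>j=1..N. inner j \<alpha> * act (f j i) \<beta>)"
        if "\<alpha> \<in> forms (2 * n + s)" for n \<alpha>
        using inner_product[OF \<xi> that, of \<beta>] by (simp add: sign_mult mult.assoc power_add cscale_mult_left)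
    qed
    with \<xi> show ?case
      by (simp add: acts_by_coproduct_def comult_\<xi> tens \<xi>_odd emb_even calculus_bialgebra_f cscale_mult_right)
  next
    case \<delta>
    have "dw (\<alpha> * \<beta>) = (- 1) ^ s *\<^sub>C (\<alpha> * dw \<beta>) + dw \<alpha> * \<beta>"
      if "\<alpha> \<in> parity_forms s" for s \<alpha> \<beta>
      using that
    proof (rule parity_forms_eqI)
      show "clinear (\<lambda>\<alpha>. dw (\<alpha> * \<beta>))" "clinear (\<lambda>\<alpha>. (- 1) ^ s *\<^sub>C (\<alpha> * dw \<beta>) + dw \<alpha> * \<beta>)"
        unfolding clinear_iff
        by (simp_all add: clinear_add[OF dw_linear] clinear_scale[OF dw_linear] distrib_right
            cscale_mult_left cscale_add_right cscale_cscale mult.commute add_ac)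
      show "dw (\<alpha> * \<beta>) = (- 1) ^ s *\<^sub>C (\<alpha> * dw \<beta>) + dw \<alpha> * \<beta>" if "\<alpha> \<in> forms (2 * n + s)" for n \<alpha>
        using dw_leibniz[OF that, of \<beta>] by (simp add: sign_mult mult.assoc power_add cscale_mult_left add.commute)
    qed
    then show ?case
      by (simp add: acts_by_coproduct_def comult_\<delta> tens \<delta>_odd cartan.one_even cscale_mult_right)
  next
    case (add x y)
    then show ?case
      by (simp add: acts_by_coproduct_def tens clinear_add[OF cartan.comult_linear])
  next
    case (scale c x)
    then show ?case
      by (simp add: acts_by_coproduct_def tens clinear_scale[OF cartan.comult_linear]
          tensor_lift_scale[OF coproduct_action_bilinear])
  next
    case (mult x y)
    then show ?case by (rule acts_by_coproduct_mult)
  }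
qed

lemma action_one: "lam x 1 = \<epsilon>\<^sub>C x *\<^sub>C 1"
proof (induction x rule: cartan_induct)
  case one
  show ?case by (simp add: action_representation cartan.super_counit_one cscale_one)
next
  case (X i)
  then show ?case by (simp add: action_generators counit_X act_one X_linear X_one)
next
  case (f i j)
  then show ?case by (simp add: action_generators counit_f act_one f_linear f_one)
next
  case (\<xi> i)
  then show ?case
    using inner_zero[OF \<xi>, of 1] by (simp add: action_generators counit_\<xi> fn_one complex_vector.scale_zero_left)
next
  case \<delta>
  \<comment> \<open>The Leibniz rule at \<open>1 * 1\<close> reads
    \<open>d 1 = d 1 + d 1\<close>.\<close>
  have "d 1 = 0" using d_leibniz[of 1 1] by (simp add: ract_one lact_one)
  then have "dw 1 = 0" using dw_fn[of 1] by (simp add: fn_one clinear_zero[OF clinear_one_form])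
  then show ?case by (simp add: action_generators counit_\<delta> complex_vector.scale_zero_left)
next
  case (add x y)
  then show ?case by (simp add: action_representation clinear_add[OF cartan.counit_linear] cscale_add_left)
next
  case (scale c x)
  then show ?case
    by (simp add: action_representation clinear_scale[OF cartan.counit_linear] cscale_complex cscale_cscale)
next
  case (mult x y)
  then show ?case by (simp add: action_representation cartan.super_counit_mult cscale_cscale mult.commute)
qed

lemma action_module_algebra: "super_module_algebra C0 C1 \<Delta>\<^sub>C \<epsilon>\<^sub>C forms lam"
  unfolding super_module_algebra_def
proof (intro conjI allI impI)
  fix x n \<alpha> \<beta> assume "\<alpha> \<in> forms n"
  then have "lam x (\<alpha> * \<beta>) = coproduct_action (n mod 2) x \<alpha> \<beta>"
    using acts_by_coproduct[of x] forms_parity[of \<alpha> n] by (simp add: acts_by_coproduct_def)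
  then show "lam x (\<alpha> * \<beta>) = coproduct_action n x \<alpha> \<beta>"
    by (simp only: cartan.gr_power_mod[of n])
qed (rule action_one)

end

text \<open>Multiplicativity and linearity propagate agreement from the generators through
  \<open>cartan_induct\<close>.\<close>

lemma cartan_action_unique:
  assumes "cartan_operators lam" "cartan_operators lam'"
  shows "lam = lam'"
proof
  fix x
  show "lam x = lam' x"
    by (induction x rule: cartan_induct)
      (simp_all add: fun_eq_iff action_representation[OF assms(1)] action_representation[OF assms(2)]
        action_generators[OF assms(1)] action_generators[OF assms(2)])
qed

theorem cartan_module_algebra:
  "(\<exists>!lam. cartan_operators lam) \<and>
    (\<forall>lam. cartan_operators lam \<longrightarrow> super_module_algebra C0 C1 \<Delta>\<^sub>C \<epsilon>\<^sub>C forms lam)"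
  using cartan_action_exists cartan_action_unique action_module_algebra by blast

end

text \<open>Prescribing \<lambda> on generators and extending it as a graded homomorphism is
  rendered as unique existence of an action with these values; the module algebra property is then
  asserted of that action.\<close>

theorem theorem3p2:
  fixes \<Delta> :: "'a::complex_algebra \<Rightarrow> ('a, 'a) tensor"
    and \<epsilon> :: "'a \<Rightarrow> complex"
    and S :: "'a \<Rightarrow> 'a"
    and lact :: "'a \<Rightarrow> 'g::complex_vector \<Rightarrow> 'g"
    and ract :: "'g \<Rightarrow> 'a \<Rightarrow> 'g"
    and \<Delta>\<^sub>L :: "'g \<Rightarrow> ('a, 'g) tensor"
    and \<Delta>\<^sub>R :: "'g \<Rightarrow> ('g, 'a) tensor"
    and d :: "'a \<Rightarrow> 'g"
    and N :: nat
    and \<omega> :: "nat \<Rightarrow> 'g"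
    and f :: "nat \<Rightarrow> nat \<Rightarrow> 'a \<Rightarrow> complex"
    and J :: "nat \<Rightarrow> nat \<Rightarrow> 'a"
    and pairing :: "('a \<Rightarrow> complex) \<Rightarrow> 'g \<Rightarrow> complex"
    and X :: "nat \<Rightarrow> 'a \<Rightarrow> complex"
    and \<iota>\<^sub>A :: "'a \<Rightarrow> 't::complex_algebra"
    and \<iota>\<^sub>\<Gamma> :: "'g \<Rightarrow> 't"
    and \<sigma> :: "'t \<Rightarrow> 't"
    and \<pi> :: "'t \<Rightarrow> 'w::complex_algebra"
    and dw :: "'w \<Rightarrow> 'w"
    and \<rho> :: "'w \<Rightarrow> ('w, 'a) tensor"
    and inner :: "nat \<Rightarrow> 'w \<Rightarrow> 'w"
    and C0 C1 :: "'c::complex_algebra set"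
    and \<Delta>\<^sub>C :: "'c \<Rightarrow> ('c, 'c) tensor"
    and \<epsilon>\<^sub>C :: "'c \<Rightarrow> complex"
    and S\<^sub>C :: "'c \<Rightarrow> 'c"
    and \<sigma>\<^sub>t :: "('a \<Rightarrow> complex, 'a \<Rightarrow> complex) tensor \<Rightarrow> ('a \<Rightarrow> complex, 'a \<Rightarrow> complex) tensor"
    and P :: "(nat \<times> nat) set"
    and t :: "nat \<Rightarrow> nat \<Rightarrow> nat \<Rightarrow> nat \<Rightarrow> complex"
    and emb :: "('a \<Rightarrow> complex) \<Rightarrow> 'c"
    and \<xi> :: "nat \<Rightarrow> 'c"
    and \<delta> :: 'c
  assumes "exterior_algebra \<Delta> \<epsilon> S lact ract \<Delta>\<^sub>L \<Delta>\<^sub>R d N \<omega> f J pairing X \<iota>\<^sub>A \<iota>\<^sub>\<Gamma> \<sigma> \<pi> dw \<rho> inner"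
    and "quantum_cartan_algebra \<Delta> \<epsilon> S lact ract \<Delta>\<^sub>L \<Delta>\<^sub>R d N \<omega> f J pairing X
           C0 C1 \<Delta>\<^sub>C \<epsilon>\<^sub>C S\<^sub>C \<sigma>\<^sub>t P t emb \<xi> \<delta>"
    and "based_calculus.S_compatible \<Delta> \<epsilon> S N f X"
  shows "(\<exists>!lam. cartan_action C0 C1 (form_degree (\<pi> \<circ> \<iota>\<^sub>A) (\<pi> \<circ> \<iota>\<^sub>\<Gamma>)) N f X emb \<xi> \<delta> \<rho> inner dw lam) \<and>
    (\<forall>lam. cartan_action C0 C1 (form_degree (\<pi> \<circ> \<iota>\<^sub>A) (\<pi> \<circ> \<iota>\<^sub>\<Gamma>)) N f X emb \<xi> \<delta> \<rho> inner dw lam \<longrightarrow>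
      super_module_algebra C0 C1 \<Delta>\<^sub>C \<epsilon>\<^sub>C (form_degree (\<pi> \<circ> \<iota>\<^sub>A) (\<pi> \<circ> \<iota>\<^sub>\<Gamma>)) lam)"
proof -
  interpret exterior_algebra \<Delta> \<epsilon> S lact ract \<Delta>\<^sub>L \<Delta>\<^sub>R d N \<omega> f J pairing X \<iota>\<^sub>A \<iota>\<^sub>\<Gamma> \<sigma> \<pi> dw \<rho> inner
    by (rule assms(1))
  interpret quantum_cartan_algebra \<Delta> \<epsilon> S lact ract \<Delta>\<^sub>L \<Delta>\<^sub>R d N \<omega> f J pairing X
      C0 C1 \<Delta>\<^sub>C \<epsilon>\<^sub>C S\<^sub>C \<sigma>\<^sub>t P t emb \<xi> \<delta>
    by (rule assms(2))
  interpret cartan_calculus \<Delta> \<epsilon> S lact ract \<Delta>\<^sub>L \<Delta>\<^sub>R d N \<omega> f J pairing X \<iota>\<^sub>A \<iota>\<^sub>\<Gamma> \<sigma> \<pi> dw \<rho> inner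
      C0 C1 \<Delta>\<^sub>C \<epsilon>\<^sub>C S\<^sub>C \<sigma>\<^sub>t P t emb \<xi> \<delta> ..
  show ?thesis by (rule cartan_module_algebra)
qed

end
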